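(* Let $B$ be a non-collinear bar of the tree $T(f,g)$. Then $$\mathcal T_B(z)=\tau_B(z)+\mu_B(z)\qquad\text{for all } z\in\mathbb C,$$ and, consequently, $\mathcal T(B)=\tau(B)+\mu(B)$.
   Context: SETTING. Let $f,g:(\mathbb C^2,O)\to(\mathbb C,O)$ be holomorphic germs in coordinates $(x,y)$, with Newton–Puiseux factorisations $f=u\,y^{E_1}\prod_{i=1}^p[x-\alpha_i(y)]$, $g=u'\,y^{E_2}\prod_{j=1}^q[x-\beta_j(y)]$, where $E_1,E_2\ge 0$, $u,u'$ are units and $\alpha_i,\beta_j$ are fractional power series in $y$ of positive order $O_y$. Write $\lambda_1,\dots,\lambda_N$ ($N=p+q\ge1$) for $\alpha_1,\dots,\alpha_p,\beta_1,\dots,\beta_q$; they are assumed pairwise distinct. Put $O(\lambda,\mu):=O_y(\lambda(y)-\mu(y))$ (contact order). An arc is a fractional power series in $y$. Let $J=f_yg_x-f_xg_y$. A polar root is a Newton–Puiseux root $x=\gamma(y)$ of $J$ with $O_y(\gamma)>0$ and $f(\gamma(y),y)g(\gamma(y),y)\ne0$; polar roots are counted with multiplicity. TREE $T(f,g)$. The ground bar $B_*$ has height $h(B_* )=0$ and carries one trunk (the main trunk), consisting of all $\lambda_k$. On top of each trunk there is one bar $B$ whose height $h(B)$ is the minimum of the contact orders between members of the trunk ($\infty$ if the trunk has one member); the members of the trunk are divided into classes by $\lambda\equiv\mu$ iff $O(\lambda,\mu)>h(B)$, and each class is a trunk growing on $B$; continue recursively. Bars of infinite height are omitted: "bar" means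 bar of finite height. A trunk consisting of $s$ of the $\alpha_i$ and $t$ of the $\beta_j$ has bimultiplicity $[s,t]$. For a bar $B$ and a root $\lambda_k$ in a trunk on $B$, let $\lambda_B$ be $\lambda_k$ with all terms $y^e$, $e\ge h(B)$, omitted (independent of the choice of $\lambda_k$; $\lambda_{B_*}=0$). Then $\lambda_k=\lambda_B+cy^{h(B)}+\cdots$, and the trunk containing $\lambda_k$ is said to grow on $B$ at $c\in\mathbb C$ (the main trunk grows on $B_*$ at $0$). An arc $\xi$ climbs over $B$ at $a\in\mathbb C$ if $\xi=\lambda_B+ay^{h(B)}+\cdots$ ($\cdots$ meaning higher order terms). RATIONAL FUNCTION. For a bar $B$ and $F\in\{f,g\}$ let $\nu_F(B):=O_y(F(\lambda_B(y)+zy^{h(B)},y))$ for generic $z$ (so $\nu_f(B_* )=E_1$, $\nu_g(B_* )=E_2$). Let the trunks on $B$ grow at $z_1,\dots,z_l$ with bimultiplicities $[p_k,q_k]$. Put $\Delta_B(z_k):=\nu_f(B)q_k-\nu_g(B)p_k$ and $\mathcal M_B(z):=\sum_{k=1}^l\frac{\Delta_B(z_k)}{z-z_k}$. The point $z_k$ is collinear if $\Delta_B(z_k)=0$ and non-collinear otherwise; $N(B)$ is the set of non-collinear points among the $z_k$, $n(B)$ its cardinality. $B$ is non-collinear if $N(B)\neq\emptyset$. For a non-collinear $B$, $M(B)$ is the set of zeros $z\in\mathbb C$ of $\mathcal M_B$ (mero-zeros) and $m_B(z)$ is the multiplicity of $z\in M(B)$. For non-collinear $B$: $\tau_B(z)=p_k+q_k$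 if $z=z_k$ and $0$ otherwise; $\mu_B(z)=m_B(z)$ if $z\in M(B)$, $-1$ if $z\in N(B)$, $0$ otherwise; $\tau(B)=\sum_{z\in\mathbb C}\tau_B(z)$, $\mu(B)=\sum_{z\in\mathbb C}\mu_B(z)$. $\mathcal T_B(z)$ is the number of polar roots (with multiplicity) climbing over $B$ at $z$, and $\mathcal T(B)$ is the number of polar roots climbing over $B$ (at any point). *)

theory Defs
  imports "HOL-Complex_Analysis.Complex_Analysis"
begin

(* Holomorphic germs at the origin of C^2 are elements of C{x,y}: convergent series
   sum_(i,j) a_ij x^i y^j with a_ij = fps_nth (fps_nth F i) j.  The outer variable is x,
   and the coefficients are series in y. *)

definition holo_germ :: "complex fps fps \<Rightarrow> bool" where
  "holo_germ F \<longleftrightarrow>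
     (\<exists>r>0. (\<lambda>(i, j). norm (fps_nth (fps_nth F i) j) * r ^ (i + j)) summable_on UNIV)"

definition germ_at_O :: "complex fps fps \<Rightarrow> complex" where
  "germ_at_O F = fps_nth (fps_nth F 0) 0"

definition dx :: "complex fps fps \<Rightarrow> complex fps fps" where
  "dx F = fps_deriv F"

definition dy :: "complex fps fps \<Rightarrow> complex fps fps" where
  "dy F = Abs_fps (\<lambda>i. fps_deriv (fps_nth F i))"

definition jac :: "complex fps fps \<Rightarrow> complex fps fps \<Rightarrow> complex fps fps" where
  "jac f g = dy f * dx g - dx f * dy g"


(* A fractional power series sum_e xi(e) y^e is given by its coefficient function
   e |-> xi(e), supported in (1/n)N for some n >= 1. *)

type_synonym arc = "real \<Rightarrow> complex"

definition has_ram :: "nat \<Rightarrow> arc \<Rightarrow> bool" where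
  "has_ram n \<xi> \<longleftrightarrow> n \<ge> 1 \<and> (\<forall>e. \<xi> e \<noteq> 0 \<longrightarrow> (\<exists>k::nat. e = real k / real n))"

definition frac_series :: "arc \<Rightarrow> bool" where
  "frac_series \<xi> \<longleftrightarrow> (\<exists>n. has_ram n \<xi>)"

definition ram :: "arc \<Rightarrow> nat" where
  "ram \<xi> = (LEAST n. has_ram n \<xi>)"

definition arc_order :: "arc \<Rightarrow> ereal" where
  "arc_order \<xi> = (INF e\<in>{e. \<xi> e \<noteq> 0}. ereal e)"

definition contact :: "arc \<Rightarrow> arc \<Rightarrow> ereal" where
  "contact \<xi> \<eta> = arc_order (\<lambda>e. \<xi> e - \<eta> e)"

(* Base change y = t^n: the series xi(t^n) in t, and F(x, t^n) as an element of C[[t]][[x]]. *)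

definition arc_ram :: "nat \<Rightarrow> arc \<Rightarrow> complex fps" where
  "arc_ram n \<xi> = Abs_fps (\<lambda>k. \<xi> (real k / real n))"

definition germ_ram :: "nat \<Rightarrow> complex fps fps \<Rightarrow> complex fps fps" where
  "germ_ram n F = Abs_fps (\<lambda>i. fps_compose (fps_nth F i) (fps_X ^ n))"

(* F(xi(y), y) as a series in t, where y = t^(ram xi).  If xi has positive order, the sum
   over i is finite for each k; for a nonzero constant term (needed only for F(z, y) on
   the ground bar) it is a convergent sum of complex numbers when that term is small. *)

definition subst_arc :: "complex fps fps \<Rightarrow> arc \<Rightarrow> complex fps" where
  "subst_arc F \<xi> = Abs_fps (\<lambda>k. suminf (\<lambda>i.
     fps_nth (fps_nth (germ_ram (ram \<xi>) F) i * arc_ram (ram \<xi>) \<xi> ^ i) k))"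

definition order_along :: "complex fps fps \<Rightarrow> arc \<Rightarrow> ereal" where
  "order_along F \<xi> =
     (if subst_arc F \<xi> = 0 then \<infinity> else ereal (real (subdegree (subst_arc F \<xi>)) / real (ram \<xi>)))"

(* F = u * y^E * prod_(i = 1..m) (x - rho_i(y)), written after the base change y = t^n for
   a common denominator n of the exponents of the rho_i. *)

definition np_factorisation ::
  "complex fps fps \<Rightarrow> complex fps fps \<Rightarrow> nat \<Rightarrow> nat \<Rightarrow> (nat \<Rightarrow> arc) \<Rightarrow> bool" where
  "np_factorisation F u E m \<rho> \<longleftrightarrow>
     (\<forall>i\<in>{1..m}. frac_series (\<rho> i) \<and> arc_order (\<rho> i) > 0) \<and>
     (\<exists>n\<ge>1. (\<forall>i\<in>{1..m}. has_ram n (\<rho> i)) \<and>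
        germ_ram n F = germ_ram n u * fps_const (fps_X ^ (n * E)) *
          (\<Prod>i=1..m. fps_X - fps_const (arc_ram n (\<rho> i))))"

definition polar_root :: "complex fps fps \<Rightarrow> complex fps fps \<Rightarrow> arc \<Rightarrow> bool" where
  "polar_root f g \<gamma> \<longleftrightarrow> frac_series \<gamma> \<and> arc_order \<gamma> > 0 \<and>
     subst_arc (jac f g) \<gamma> = 0 \<and> subst_arc f \<gamma> * subst_arc g \<gamma> \<noteq> 0"

(* Multiplicity of the root x = gamma(y) of F: the largest m such that (x - gamma)^m
   divides F in C[[t]][[x]], y = t^(ram gamma). *)

definition root_mult :: "complex fps fps \<Rightarrow> arc \<Rightarrow> nat" where
  "root_mult F \<gamma> =
     Max {m. (fps_X - fps_const (arc_ram (ram \<gamma>) \<gamma>)) ^ m dvd germ_ram (ram \<gamma>) F}"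


(* A bar is a pair (K, h): K is the set of all roots belonging to the trunks on the bar
   (equivalently, the trunk supporting it), and h is its (finite) height.
   Roots are pairwise distinct, so trunks are sets of roots.

   The ground bar is (R, 0), with R the set of all roots.  All roots have positive order,
   so the general prescription for the trunks on a bar gives exactly one trunk on the
   ground bar, namely R, growing at 0. *)

type_synonym bar = "arc set \<times> real"

definition trunk_height :: "arc set \<Rightarrow> ereal" where
  "trunk_height S = (INF \<xi>\<in>S. INF \<eta>\<in>S. contact \<xi> \<eta>)"

definition trunks :: "bar \<Rightarrow> arc set set" where
  "trunks B = (case B of (K, h) \<Rightarrow>
     K // {(\<xi>, \<eta>). \<xi> \<in> K \<and> \<eta> \<in> K \<and> contact \<xi> \<eta> > ereal h})"

inductive_set bars :: "arc set \<Rightarrow> bar set" for R :: "arc set" where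
  ground: "(R, 0) \<in> bars R"
| on_trunk: "B \<in> bars R \<Longrightarrow> S \<in> trunks B \<Longrightarrow> trunk_height S = ereal h \<Longrightarrow> (S, h) \<in> bars R"

definition bar_height :: "bar \<Rightarrow> real" where
  "bar_height B = snd B"

definition bar_base :: "bar \<Rightarrow> arc" where
  "bar_base B = (\<lambda>e. if e < bar_height B then (SOME \<xi>. \<xi> \<in> fst B) e else 0)"

definition growth_point :: "bar \<Rightarrow> arc set \<Rightarrow> complex" where
  "growth_point B S = (SOME \<xi>. \<xi> \<in> S) (bar_height B)"

definition climbs :: "arc \<Rightarrow> bar \<Rightarrow> complex \<Rightarrow> bool" where
  "climbs \<xi> B a \<longleftrightarrow> (\<forall>e<bar_height B. \<xi> e = bar_base B e) \<and> \<xi> (bar_height B) = a"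

(* Generic z: all but finitely many z in C; on the ground bar F(z, y) makes sense only
   for small z, so there it means all sufficiently small z other than 0. *)

definition generic_pt :: "bar \<Rightarrow> complex filter" where
  "generic_pt B = (if bar_height B = 0 then at 0 else cofinite)"

definition nu :: "complex fps fps \<Rightarrow> bar \<Rightarrow> real" where
  "nu F B = (THE v. \<forall>\<^sub>F z in generic_pt B.
     order_along F ((bar_base B)(bar_height B := z)) = ereal v)"

(* Below, P and Q are the sets of the roots alpha_i of f and beta_j of g, so that
   a trunk S has bimultiplicity [card (S Int P), card (S Int Q)]. *)

definition Delta ::
  "complex fps fps \<Rightarrow> complex fps fps \<Rightarrow> arc set \<Rightarrow> arc set \<Rightarrow> bar \<Rightarrow> arc set \<Rightarrow> real" where
  "Delta f g P Q B S = nu f B * real (card (S \<inter> Q)) - nu g B * real (card (S \<inter> P))"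

definition mero ::
  "complex fps fps \<Rightarrow> complex fps fps \<Rightarrow> arc set \<Rightarrow> arc set \<Rightarrow> bar \<Rightarrow> complex \<Rightarrow> complex" where
  "mero f g P Q B z =
     (\<Sum>S\<in>trunks B. complex_of_real (Delta f g P Q B S) / (z - growth_point B S))"

definition noncollinear_pts ::
  "complex fps fps \<Rightarrow> complex fps fps \<Rightarrow> arc set \<Rightarrow> arc set \<Rightarrow> bar \<Rightarrow> complex set" where
  "noncollinear_pts f g P Q B = growth_point B ` {S \<in> trunks B. Delta f g P Q B S \<noteq> 0}"

definition noncollinear ::
  "complex fps fps \<Rightarrow> complex fps fps \<Rightarrow> arc set \<Rightarrow> arc set \<Rightarrow> bar \<Rightarrow> bool" where
  "noncollinear f g P Q B \<longleftrightarrow> noncollinear_pts f g P Q B \<noteq> {}"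

(* The poles of the rational function have to be excluded by hand, because x / 0 = 0.
   At a collinear point the summand is 0 / (z - z_k), which is 0 everywhere. *)

definition mero_zeros ::
  "complex fps fps \<Rightarrow> complex fps fps \<Rightarrow> arc set \<Rightarrow> arc set \<Rightarrow> bar \<Rightarrow> complex set" where
  "mero_zeros f g P Q B = {z. z \<notin> noncollinear_pts f g P Q B \<and> mero f g P Q B z = 0}"

definition tau_at :: "arc set \<Rightarrow> arc set \<Rightarrow> bar \<Rightarrow> complex \<Rightarrow> int" where
  "tau_at P Q B z =
     (\<Sum>S\<in>{S \<in> trunks B. growth_point B S = z}. int (card (S \<inter> P) + card (S \<inter> Q)))"

definition mu_at ::
  "complex fps fps \<Rightarrow> complex fps fps \<Rightarrow> arc set \<Rightarrow> arc set \<Rightarrow> bar \<Rightarrow> complex \<Rightarrow> int" where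
  "mu_at f g P Q B z =
     (if z \<in> mero_zeros f g P Q B then zorder (mero f g P Q B) z
      else if z \<in> noncollinear_pts f g P Q B then -1 else 0)"

definition tau :: "arc set \<Rightarrow> arc set \<Rightarrow> bar \<Rightarrow> int" where
  "tau P Q B = (\<Sum>z\<in>{z. tau_at P Q B z \<noteq> 0}. tau_at P Q B z)"

definition mu ::
  "complex fps fps \<Rightarrow> complex fps fps \<Rightarrow> arc set \<Rightarrow> arc set \<Rightarrow> bar \<Rightarrow> int" where
  "mu f g P Q B = (\<Sum>z\<in>{z. mu_at f g P Q B z \<noteq> 0}. mu_at f g P Q B z)"

definition polar_at :: "complex fps fps \<Rightarrow> complex fps fps \<Rightarrow> bar \<Rightarrow> complex \<Rightarrow> arc set" where
  "polar_at f g B z = {\<gamma>. polar_root f g \<gamma> \<and> climbs \<gamma> B z}"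

definition polar_over :: "complex fps fps \<Rightarrow> complex fps fps \<Rightarrow> bar \<Rightarrow> arc set" where
  "polar_over f g B = {\<gamma>. polar_root f g \<gamma> \<and> (\<exists>z. climbs \<gamma> B z)}"

definition polar_count_at ::
  "complex fps fps \<Rightarrow> complex fps fps \<Rightarrow> bar \<Rightarrow> complex \<Rightarrow> nat" where
  "polar_count_at f g B z = (\<Sum>\<gamma>\<in>polar_at f g B z. root_mult (jac f g) \<gamma>)"

definition polar_count :: "complex fps fps \<Rightarrow> complex fps fps \<Rightarrow> bar \<Rightarrow> nat" where
  "polar_count f g B = (\<Sum>\<gamma>\<in>polar_over f g B. root_mult (jac f g) \<gamma>)"

end

theory Submission
  imports Defs "HOL-Computational_Algebra.Fundamental_Theorem_Algebra"
begin

text \<open>Let B be a bar of height h = a/n > 0. Substitute y = t^n and x = \<lambda>_B + w t^a. A germ becomes a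
power series in t whose coefficients are polynomials in w. If \<phi> and \<psi> are the products of
w - \<xi>(h) over the roots \<xi> of f, respectively g, that belong to the trunks on B, then the leading
terms of f and g are constant multiples of \<phi>(w) t^(n \<nu>_f) and \<psi>(w) t^(n \<nu>_g). The Jacobian of
the transformed pair with respect to (t, w) is J times a monomial in t, so the leading coefficient
of J is a constant multiple of the weighted Wronskian \<nu>_f \<phi> \<psi>' - \<nu>_g \<phi>' \<psi>, which equals
\<phi> \<psi> times the rational function of B. If B is non-collinear this polynomial is nonzero
and its order at z is \<tau>_B(z) + \<mu>_B(z) (\<open>leading_form_jacobian\<close>, \<open>weighted_wronskian\<close>).

The Newton-Puiseux theorem turns this order into a number of roots: if a series H(w, t) with
polynomial coefficients has a root of order m at w = z for t = 0, then after a substitution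
t \<rightarrow> t^k it has exactly m linear factors w - \<delta>_i(t) with \<delta>_i(0) = z (\<open>puiseux_factorisation\<close>).
Undoing the substitution, the \<delta>_i are the roots of J that climb over B at z, with their
multiplicities (\<open>root_count_over_strip\<close>). Every root of J of positive order is a polar root:
the roots of f are simple, so if f and J vanish along \<gamma>, then g is constant along \<gamma>, hence zero,
and \<gamma> would be a common root of f and g (\<open>jacobian_root_common\<close>).

On the ground bar h = 0, and x = w is not an admissible substitution into a power series. Strips
of small height \<epsilon> > 0 around x = 0 replace it. If f has p roots and g has q roots, their weights
are E1 + \<epsilon> p and E2 + \<epsilon> q, and
(E1 + \<epsilon> p) q - (E2 + \<epsilon> q) p = E1 q - E2 p, so all of them have the \<Delta> of the ground bar and contain
the same number of polar roots. These strips increase as \<epsilon> decreases and exhaust all arcs of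
positive order, so already one of them contains every polar root (\<open>polar_count_ground\<close>).\<close>

section \<open>Homomorphisms and substitution into power series\<close>

locale rhom =
  fixes \<theta> :: "'a::comm_ring_1 \<Rightarrow> 'b::comm_ring_1"
  assumes add: "\<theta> (x + y) = \<theta> x + \<theta> y"
    and mult: "\<theta> (x * y) = \<theta> x * \<theta> y"
    and one: "\<theta> 1 = 1"
begin

lemma zero: "\<theta> 0 = 0"
  using add[of 0 0] by simp

lemma uminus: "\<theta> (- x) = - \<theta> x"
  using add[of x "- x"] zero by (simp add: eq_neg_iff_add_eq_0 add.commute)

lemma diff: "\<theta> (x - y) = \<theta> x - \<theta> y"
  using add[of x "- y"] uminus[of y] by simp

lemma power: "\<theta> (x ^ k) = \<theta> x ^ k"
  by (induction k) (simp_all add: one mult)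

lemma sum: "\<theta> (\<Sum>i\<in>S. F i) = (\<Sum>i\<in>S. \<theta> (F i))"
  by (induction S rule: infinite_finite_induct) (simp_all add: zero add)

lemma prod: "\<theta> (\<Prod>i\<in>S. F i) = (\<Prod>i\<in>S. \<theta> (F i))"
  by (induction S rule: infinite_finite_induct) (simp_all add: one mult)

lemma of_nat: "\<theta> (of_nat k) = of_nat k"
  by (induction k) (simp_all add: zero one add)

lemmas simps = zero one add mult uminus diff power sum prod of_nat

end

lemma rhom_comp: "rhom \<phi> \<Longrightarrow> rhom \<theta> \<Longrightarrow> rhom (\<lambda>x. \<phi> (\<theta> x))"
  by (simp add: rhom_def)

lemma rhom_id: "rhom (\<lambda>x. x)"
  by (simp add: rhom_def)

lemma rhom_fps_const: "rhom fps_const"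
  by (simp add: rhom_def)

lemma rhom_const_poly: "rhom (\<lambda>c. [:c:])"
  by (simp add: rhom_def one_pCons)

lemma fps_first_term_decomp: "H = fps_const (fps_nth H 0) + fps_X * fps_shift 1 (H :: 'a::comm_ring_1 fps)"
  by (intro fps_ext) (simp add: fps_X_mult_nth)

text \<open>A map L on power series with L(c + X H) = \<theta>(c) + W L(H) is determined by this recursion when W has no
constant term, since each step fixes one more coefficient. Identities between substitutions
(multiplicativity, chain rules, compositions) are proved by checking that both sides obey the
same recursion.\<close>

lemma shift_recursion_unique:
  fixes L1 L2 :: "'a::comm_ring_1 fps \<Rightarrow> 'b::comm_ring_1 fps"
  assumes W: "fps_nth W 0 = 0"
    and rec: "\<And>H. L1 H - L2 H = W * (L1 (fps_shift 1 H) - L2 (fps_shift 1 H))"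
  shows "L1 H = L2 H"
proof -
  have "fps_nth (L1 H - L2 H) k = 0" for k H
  proof (induction k arbitrary: H rule: less_induct)
    case (less k)
    have "fps_nth W i * fps_nth (L1 (fps_shift 1 H) - L2 (fps_shift 1 H)) (k - i) = 0"
      if "i \<in> {0..k}" for i
      using W less.IH[of "k - i" "fps_shift 1 H"] that by (cases "i = 0") auto
    then show ?case
      by (subst rec, subst fps_mult_nth) (intro sum.neutral, blast)
  qed
  then show ?thesis
    by (simp add: fps_eq_iff)
qed

text \<open>The sum of \<theta>(H_i) W^i over all i; truncating it at the k-th coefficient is harmless because W is
meant to have no constant term.\<close>

definition fps_subst :: "('a::comm_ring_1 \<Rightarrow> 'b::comm_ring_1 fps) \<Rightarrow> 'b fps \<Rightarrow> 'a fps \<Rightarrow> 'b fps" where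
  "fps_subst \<theta> W H = Abs_fps (\<lambda>k. \<Sum>i\<le>k. fps_nth (\<theta> (fps_nth H i) * W ^ i) k)"

lemma fps_mult_power_nth_eq_0:
  fixes W :: "'b::comm_ring_1 fps"
  assumes "fps_nth W 0 = 0" "k < i"
  shows "fps_nth (c * W ^ i) k = 0"
proof -
  have W: "W = fps_X * fps_shift 1 W"
    using fps_first_term_decomp[of W] assms(1) by simp
  have "c * W ^ i = c * (fps_X * fps_shift 1 W) ^ i"
    using W by simp
  also have "\<dots> = (c * fps_shift 1 W ^ i) * fps_X ^ i"
    by (simp add: power_mult_distrib mult_ac)
  finally have "c * W ^ i = (c * fps_shift 1 W ^ i) * fps_X ^ i" .
  then show ?thesis
    using assms(2) by (simp only: fps_X_power_mult_right_nth) simp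
qed

lemma fps_subst_nth:
  fixes W :: "'b::comm_ring_1 fps"
  assumes "fps_nth W 0 = 0" "k \<le> M"
  shows "fps_nth (fps_subst \<theta> W H) k = (\<Sum>i\<le>M. fps_nth (\<theta> (fps_nth H i) * W ^ i) k)"
  unfolding fps_subst_def fps_nth_Abs_fps
  by (rule sum.mono_neutral_left) (use assms in \<open>auto intro!: fps_mult_power_nth_eq_0\<close>)

lemma fps_subst_rec:
  fixes W :: "'b::comm_ring_1 fps"
  assumes W: "fps_nth W 0 = 0"
  shows "fps_subst \<theta> W H = \<theta> (fps_nth H 0) + W * fps_subst \<theta> W (fps_shift 1 H)"
proof (rule fps_ext)
  fix k
  define T where "T i = \<theta> (fps_nth H (Suc i)) * W ^ i" for i
  have "fps_nth (W * fps_subst \<theta> W (fps_shift 1 H)) k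
      = (\<Sum>j=0..k. fps_nth W j * (\<Sum>i\<le>k. fps_nth (T i) (k - j)))"
    unfolding fps_mult_nth[of W] T_def
    by (intro sum.cong refl) (simp add: fps_subst_nth[OF W, of _ k])
  also have "\<dots> = (\<Sum>i\<le>k. fps_nth (W * T i) k)"
    unfolding fps_mult_nth[of W] sum_distrib_left by (rule sum.swap)
  also have "\<dots> = (\<Sum>i\<le>k. fps_nth (\<theta> (fps_nth H (Suc i)) * W ^ Suc i) k)"
    unfolding T_def by (simp add: mult_ac)
  finally have "fps_nth (\<theta> (fps_nth H 0) + W * fps_subst \<theta> W (fps_shift 1 H)) k
      = (\<Sum>i\<le>Suc k. fps_nth (\<theta> (fps_nth H i) * W ^ i) k)"
    by (simp only: fps_add_nth sum.atMost_Suc_shift) simp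
  then show "fps_nth (fps_subst \<theta> W H) k = fps_nth (\<theta> (fps_nth H 0) + W * fps_subst \<theta> W (fps_shift 1 H)) k"
    using fps_subst_nth[OF W, of k "Suc k" \<theta> H] by simp
qed

lemma fps_subst_unique:
  assumes "fps_nth W 0 = 0"
    and "\<And>H. L H = \<theta> (fps_nth H 0) + W * L (fps_shift 1 H)"
  shows "L H = fps_subst \<theta> W H"
proof (rule shift_recursion_unique[OF assms(1), of L])
  show "L H - fps_subst \<theta> W H = W * (L (fps_shift 1 H) - fps_subst \<theta> W (fps_shift 1 H))" for H
    using assms(2)[of H] fps_subst_rec[OF assms(1), of \<theta> H] by (simp add: algebra_simps)
qed

lemma fps_subst_const:
  assumes "rhom \<theta>" "fps_nth W 0 = 0"
  shows "fps_subst \<theta> W (fps_const c) = \<theta> c"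
proof -
  have "fps_subst \<theta> W 0 = 0"
    by (simp add: fps_subst_def fps_eq_iff rhom.zero[OF assms(1)])
  then show ?thesis
    using fps_subst_rec[OF assms(2), of \<theta> "fps_const c"] by (simp add: fps_shift_fps_const)
qed

lemma fps_subst_add:
  assumes "rhom \<theta>"
  shows "fps_subst \<theta> W (F + G) = fps_subst \<theta> W F + fps_subst \<theta> W G"
  by (simp add: fps_eq_iff fps_subst_def rhom.add[OF assms] distrib_right sum.distrib)

lemma fps_subst_X_mult:
  assumes "rhom \<theta>" "fps_nth W 0 = 0"
  shows "fps_subst \<theta> W (fps_X * H) = W * fps_subst \<theta> W H"
proof -
  have "fps_shift 1 (fps_X * H) = H"
    by (simp add: fps_eq_iff)
  then show ?thesis
    using fps_subst_rec[OF assms(2), of \<theta> "fps_X * H"] by (simp add: rhom.zero[OF assms(1)])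
qed

lemma fps_subst_X:
  assumes "rhom \<theta>" "fps_nth W 0 = 0"
  shows "fps_subst \<theta> W fps_X = W"
  using fps_subst_X_mult[OF assms, of "fps_const 1"] fps_subst_const[OF assms, of 1]
  by (simp add: rhom.one[OF assms(1)])

lemma fps_subst_const_mult:
  assumes "rhom \<theta>" and W: "fps_nth W 0 = 0"
  shows "fps_subst \<theta> W (fps_const c * H) = \<theta> c * fps_subst \<theta> W H"
proof (rule shift_recursion_unique[OF W, of "\<lambda>H. fps_subst \<theta> W (fps_const c * H)" "\<lambda>H. \<theta> c * fps_subst \<theta> W H"])
  fix H
  have "fps_shift 1 (fps_const c * H) = fps_const c * fps_shift 1 H"
    by (simp add: fps_eq_iff)
  then show "fps_subst \<theta> W (fps_const c * H) - \<theta> c * fps_subst \<theta> W H =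
      W * (fps_subst \<theta> W (fps_const c * fps_shift 1 H) - \<theta> c * fps_subst \<theta> W (fps_shift 1 H))"
    using fps_subst_rec[OF W, of \<theta> "fps_const c * H"] fps_subst_rec[OF W, of \<theta> H]
    by (simp add: rhom.mult[OF assms(1)] algebra_simps del: fps_shift_mult_right)
qed

lemma rhom_fps_subst:
  assumes \<theta>: "rhom \<theta>" and W: "fps_nth W 0 = 0"
  shows "rhom (fps_subst \<theta> W)"
proof
  let ?S = "fps_subst \<theta> W"
  show "?S (F + G) = ?S F + ?S G" for F G
    by (rule fps_subst_add[OF \<theta>])
  show "?S 1 = 1"
    using fps_subst_const[OF assms, of 1] rhom.one[OF \<theta>] by simp
  show "?S (F * G) = ?S F * ?S G" for F G
  proof (rule shift_recursion_unique[OF W, of "\<lambda>F. ?S (F * G)" "\<lambda>F. ?S F * ?S G"])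
    fix F
    have "F * G = fps_const (fps_nth F 0) * G + fps_X * (fps_shift 1 F * G)"
      using fps_first_term_decomp[of F] by (metis distrib_right mult.assoc)
    then have "?S (F * G) = \<theta> (fps_nth F 0) * ?S G + W * ?S (fps_shift 1 F * G)"
      by (simp only: fps_subst_add[OF \<theta>] fps_subst_const_mult[OF assms] fps_subst_X_mult[OF assms])
    then show "?S (F * G) - ?S F * ?S G =
        W * (?S (fps_shift 1 F * G) - ?S (fps_shift 1 F) * ?S G)"
      using fps_subst_rec[OF W, of \<theta> F] by (simp add: algebra_simps)
  qed
qed

lemma fps_subst_nth_0:
  "fps_nth (fps_subst \<theta> W H) 0 = fps_nth (\<theta> (fps_nth H 0)) 0"
  by (simp add: fps_subst_def)

text \<open>A homomorphism \<phi> need not commute with infinite sums. It does so here because W and \<phi>(W) have no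
constant term.\<close>

lemma rhom_fps_subst_comp:
  assumes \<phi>: "rhom \<phi>" and \<theta>: "rhom \<theta>" and W: "fps_nth W 0 = 0" and V: "fps_nth (\<phi> W) 0 = 0"
  shows "\<phi> (fps_subst \<theta> W H) = fps_subst (\<lambda>c. \<phi> (\<theta> c)) (\<phi> W) H"
proof (rule fps_subst_unique[OF V])
  show "\<phi> (fps_subst \<theta> W H) = \<phi> (\<theta> (fps_nth H 0)) + \<phi> W * \<phi> (fps_subst \<theta> W (fps_shift 1 H))" for H
    using fps_subst_rec[OF W, of \<theta> H] by (simp only: rhom.add[OF \<phi>] rhom.mult[OF \<phi>])
qed

lemma fps_compose_eq_fps_subst: "fps_compose F W = fps_subst fps_const W F"
  by (simp add: fps_eq_iff fps_compose_nth fps_subst_def atMost_atLeast0)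

lemma rhom_fps_compose:
  fixes W :: "'a::comm_ring_1 fps"
  shows "fps_nth W 0 = 0 \<Longrightarrow> rhom (\<lambda>F. fps_compose F W)"
  unfolding fps_compose_eq_fps_subst by (rule rhom_fps_subst[OF rhom_fps_const])

definition fps_map :: "('a::comm_ring_1 \<Rightarrow> 'b::comm_ring_1) \<Rightarrow> 'a fps \<Rightarrow> 'b fps" where
  "fps_map \<theta> H = Abs_fps (\<lambda>k. \<theta> (fps_nth H k))"

lemma fps_map_nth [simp]: "fps_nth (fps_map \<theta> H) k = \<theta> (fps_nth H k)"
  by (simp add: fps_map_def)

lemma rhom_fps_map: 
  assumes "rhom \<theta>"
  shows "rhom (fps_map \<theta>)"
proof -
  interpret rhom \<theta> by fact
  show ?thesis
    by unfold_locales (simp_all add: fps_eq_iff fps_mult_nth simps)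
qed

lemma fps_map_X: "rhom \<theta> \<Longrightarrow> fps_map \<theta> fps_X = fps_X"
  by (simp add: fps_eq_iff rhom.zero rhom.one)

lemma fps_map_const: "rhom \<theta> \<Longrightarrow> fps_map \<theta> (fps_const c) = fps_const (\<theta> c)"
  by (simp add: fps_eq_iff rhom.zero)

definition poly_subst :: "('a::comm_ring_1 \<Rightarrow> 'b::comm_ring_1) \<Rightarrow> 'b \<Rightarrow> 'a poly \<Rightarrow> 'b" where
  "poly_subst \<kappa> W p = poly (map_poly \<kappa> p) W"

lemma poly_subst_pCons:
  "rhom \<kappa> \<Longrightarrow> poly_subst \<kappa> W (pCons c p) = \<kappa> c + W * poly_subst \<kappa> W p"
  by (simp add: poly_subst_def map_poly_pCons rhom.simps)

lemma poly_subst_0: "poly_subst \<kappa> W 0 = 0"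
  by (simp add: poly_subst_def)

lemma poly_subst_const: "rhom \<kappa> \<Longrightarrow> poly_subst \<kappa> W [:c:] = \<kappa> c"
  by (simp add: poly_subst_pCons poly_subst_0)

lemma rhom_poly_subst:
  assumes \<kappa>: "rhom \<kappa>"
  shows "rhom (poly_subst \<kappa> W)"
proof
  let ?S = "poly_subst \<kappa> W"
  show add: "?S (p + q) = ?S p + ?S q" for p q
  proof (induction p arbitrary: q)
    case (pCons a p)
    then show ?case
      by (cases q) (simp add: poly_subst_pCons[OF \<kappa>] rhom.simps[OF \<kappa>] algebra_simps)
  qed (simp add: poly_subst_0)
  have smult: "?S (smult a q) = \<kappa> a * ?S q" for a q
    by (induction q) (simp_all add: poly_subst_0 poly_subst_pCons[OF \<kappa>] rhom.simps[OF \<kappa>] algebra_simps)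
  show "?S (p * q) = ?S p * ?S q" for p q
  proof (induction p)
    case (pCons a p)
    then show ?case
      by (simp add: add smult poly_subst_pCons[OF \<kappa>] rhom.simps[OF \<kappa>] algebra_simps)
  qed (simp add: poly_subst_0)
  show "?S 1 = 1"
    by (simp add: one_pCons poly_subst_const[OF \<kappa>] rhom.one[OF \<kappa>])
qed

lemma rhom_poly_subst_comp:
  assumes \<phi>: "rhom \<phi>" and \<kappa>: "rhom \<kappa>"
  shows "\<phi> (poly_subst \<kappa> W p) = poly_subst (\<lambda>c. \<phi> (\<kappa> c)) (\<phi> W) p"
  by (induction p)
     (simp_all add: poly_subst_0 poly_subst_pCons[OF \<kappa>] poly_subst_pCons[OF rhom_comp[OF \<phi> \<kappa>]] rhom.simps[OF \<phi>])

section \<open>Series in t with polynomial coefficients in w\<close>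

text \<open>Elements of C[w][[t]] are values of type \<open>complex poly fps\<close>. The map is H(w, t) \<mapsto> H(W, t^n); the parameter \<kappa>
embeds the constants, so that the target can be C[[t]] (evaluation at a series) or C[w][[t]]
(change of the coordinate w).\<close>

definition subst2 :: "(complex \<Rightarrow> 'b::comm_ring_1 fps) \<Rightarrow> 'b fps \<Rightarrow> nat \<Rightarrow> complex poly fps \<Rightarrow> 'b fps" where
  "subst2 \<kappa> W n = fps_subst (poly_subst \<kappa> W) (fps_X ^ n)"

abbreviation eval_at :: "complex fps \<Rightarrow> nat \<Rightarrow> complex poly fps \<Rightarrow> complex fps" where
  "eval_at \<equiv> subst2 fps_const"

abbreviation emb :: "complex fps \<Rightarrow> complex poly fps" where
  "emb \<equiv> fps_map (\<lambda>c. [:c:])"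

abbreviation wder :: "complex poly fps \<Rightarrow> complex poly fps" where
  "wder \<equiv> fps_map pderiv"

abbreviation wvar :: "complex poly fps" where
  "wvar \<equiv> fps_const [:0, 1:]"

lemma rhom_emb: "rhom emb"
  by (rule rhom_fps_map[OF rhom_const_poly])

lemma rhom_const_const: "rhom (\<lambda>c. fps_const [:c:])"
  by (rule rhom_comp[OF rhom_fps_const rhom_const_poly])

lemma X_power_nth_0: "n \<ge> 1 \<Longrightarrow> fps_nth (fps_X ^ n :: 'a::comm_ring_1 fps) 0 = 0"
  by simp

lemma rhom_subst2: "rhom \<kappa> \<Longrightarrow> n \<ge> 1 \<Longrightarrow> rhom (subst2 \<kappa> W n)"
  unfolding subst2_def by (intro rhom_fps_subst rhom_poly_subst X_power_nth_0)

lemmas rhom_eval_at = rhom_subst2[OF rhom_fps_const]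

lemma subst2_const: "rhom \<kappa> \<Longrightarrow> n \<ge> 1 \<Longrightarrow> subst2 \<kappa> W n (fps_const p) = poly_subst \<kappa> W p"
  unfolding subst2_def by (intro fps_subst_const rhom_poly_subst X_power_nth_0)

lemma subst2_X: "rhom \<kappa> \<Longrightarrow> n \<ge> 1 \<Longrightarrow> subst2 \<kappa> W n fps_X = fps_X ^ n"
  unfolding subst2_def by (intro fps_subst_X rhom_poly_subst X_power_nth_0)

lemma subst2_X_power: "rhom \<kappa> \<Longrightarrow> n \<ge> 1 \<Longrightarrow> subst2 \<kappa> W n (fps_X ^ k) = fps_X ^ (n * k)"
  by (simp add: rhom.power[OF rhom_subst2] subst2_X power_mult)

lemma subst2_wvar: "rhom \<kappa> \<Longrightarrow> n \<ge> 1 \<Longrightarrow> subst2 \<kappa> W n wvar = W"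
  by (simp add: subst2_const poly_subst_pCons poly_subst_0 rhom.zero rhom.one)

lemma poly_subst_nth_0: "fps_nth (poly_subst fps_const \<delta> p) 0 = poly p (fps_nth \<delta> 0)"
  by (induction p) (simp_all add: poly_subst_0 poly_subst_pCons[OF rhom_fps_const])

lemma eval_at_nth_0:
  "n \<ge> 1 \<Longrightarrow> fps_nth (eval_at \<delta> n H) 0 = poly (fps_nth H 0) (fps_nth \<delta> 0)"
  by (simp add: subst2_def fps_subst_nth_0 poly_subst_nth_0)

lemma rhom_comp_subst2:
  assumes \<phi>: "rhom \<phi>" "\<phi> fps_X = fps_X ^ k" and \<kappa>: "rhom \<kappa>" and n: "n \<ge> 1" "k \<ge> 1"
  shows "\<phi> (subst2 \<kappa> W n H) = subst2 (\<lambda>c. \<phi> (\<kappa> c)) (\<phi> W) (k * n) H"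
proof -
  have "\<phi> (fps_X ^ n) = fps_X ^ (k * n)"
    using \<phi> by (simp add: rhom.power power_mult)
  then have "\<phi> (subst2 \<kappa> W n H)
      = fps_subst (\<lambda>p. \<phi> (poly_subst \<kappa> W p)) (fps_X ^ (k * n)) H"
    unfolding subst2_def using n
    by (subst rhom_fps_subst_comp[OF \<phi>(1) rhom_poly_subst[OF \<kappa>]]) auto
  then show ?thesis
    by (simp add: subst2_def rhom_poly_subst_comp[OF \<phi>(1) \<kappa>])
qed

lemma eval_at_subst2:
  assumes "n \<ge> 1" "k \<ge> 1"
  shows "eval_at \<epsilon> k (subst2 (\<lambda>c. fps_const [:c:]) W n H) = eval_at (eval_at \<epsilon> k W) (k * n) H"
  using rhom_comp_subst2[where \<phi> = "eval_at \<epsilon> k" and n = n and k = k and W = W and H = H, OF _ _ rhom_const_const] assms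
  by (simp add: rhom_eval_at subst2_X rhom_fps_const subst2_const poly_subst_const)

lemma eval_at_compose:
  assumes "n \<ge> 1" "k \<ge> 1"
  shows "fps_compose (eval_at \<delta> n H) (fps_X ^ k) = eval_at (fps_compose \<delta> (fps_X ^ k)) (k * n) H"
  using rhom_comp_subst2[where \<phi> = "\<lambda>F. fps_compose F (fps_X ^ k)" and n = n and k = k and W = \<delta> and H = H, OF _ _ rhom_fps_const] assms
  by (simp add: rhom_fps_compose)

lemma eval_at_emb:
  assumes "k \<ge> 1"
  shows "eval_at \<epsilon> k (emb \<delta>) = fps_compose \<delta> (fps_X ^ k)"
proof -
  have "eval_at \<epsilon> k (emb \<delta>) = fps_subst fps_const (fps_X ^ k) \<delta>"
  proof (rule fps_subst_unique)
    fix H :: "complex fps"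
    let ?H' = "fps_shift 1 H"
    have "emb H = fps_const [:fps_nth H 0:] + fps_X * emb ?H'"
      using arg_cong[OF fps_first_term_decomp[of H], of emb]
      by (simp only: rhom.add[OF rhom_emb] rhom.mult[OF rhom_emb] fps_map_X[OF rhom_const_poly] fps_map_const[OF rhom_const_poly])
    then show "eval_at \<epsilon> k (emb H) = fps_const (fps_nth H 0) + fps_X ^ k * eval_at \<epsilon> k (emb ?H')"
      using assms
      by (simp only: rhom.add[OF rhom_eval_at] rhom.mult[OF rhom_eval_at] subst2_X[OF rhom_fps_const]
          subst2_const[OF rhom_fps_const] poly_subst_const[OF rhom_fps_const])
  qed (use assms in simp)
  then show ?thesis
    by (simp add: fps_compose_eq_fps_subst)
qed

lemma eval_at_base_change:
  assumes "n \<ge> 1" "k \<ge> 1"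
  shows "eval_at \<delta> k (fps_compose H (fps_X ^ n)) = eval_at \<delta> (k * n) H"
proof -
  have "eval_at \<delta> k (fps_X ^ n) = fps_X ^ (k * n)"
    using assms by (simp add: subst2_X_power rhom_fps_const)
  then have "eval_at \<delta> k (fps_compose H (fps_X ^ n))
      = fps_subst (\<lambda>p. eval_at \<delta> k (fps_const p)) (fps_X ^ (k * n)) H"
    unfolding fps_compose_eq_fps_subst using assms
    by (subst rhom_fps_subst_comp[OF rhom_eval_at rhom_fps_const]) auto
  then show ?thesis
    using assms by (simp add: subst2_def fps_subst_const rhom_poly_subst rhom_fps_const)
qed

lemma wder_add: "wder (F + G) = wder F + wder G"
  by (simp add: fps_eq_iff pderiv_add)

lemma wder_mult: "wder (F * G) = wder F * G + F * wder G"
  by (simp add: fps_eq_iff fps_mult_nth higher_pderiv_sum[of 1, simplified] pderiv_mult sum.distrib[symmetric])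
     (simp add: algebra_simps)

lemma wder_X_power_mult: "wder (fps_X ^ k * F) = fps_X ^ k * wder F"
  by (simp add: fps_eq_iff fps_X_power_mult_nth)

lemma wder_pow_X_power_mult: "(wder ^^ j) (fps_X ^ k * F) = fps_X ^ k * (wder ^^ j) F"
  by (induction j) (simp_all add: wder_X_power_mult)

lemma wder_pow_nth: "fps_nth ((wder ^^ j) F) k = (pderiv ^^ j) (fps_nth F k)"
  by (induction j) simp_all

lemma wder_subst2:
  fixes W :: "complex poly fps"
  assumes n: "n \<ge> 1"
  shows "wder (subst2 (\<lambda>c. fps_const [:c:]) W n H) = wder W * subst2 (\<lambda>c. fps_const [:c:]) W n (wder H)"
proof -
  let ?\<kappa> = "\<lambda>c. fps_const [:c:] :: complex poly fps"
  let ?S = "subst2 ?\<kappa> W n"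
  have rec: "?S H = poly_subst ?\<kappa> W (fps_nth H 0) + fps_X ^ n * ?S (fps_shift 1 H)" for H
    unfolding subst2_def by (rule fps_subst_rec) (use n in simp)
  have poly: "wder (poly_subst ?\<kappa> W p) = wder W * poly_subst ?\<kappa> W (pderiv p)" for p
  proof (induction p)
    case (pCons a p)
    have "wder (fps_const [:a:]) = 0"
      by (simp add: fps_eq_iff pderiv_pCons)
    then show ?case
      using pCons.IH
      by (simp add: poly_subst_pCons[OF rhom_const_const] wder_add wder_mult pderiv_pCons
          rhom.add[OF rhom_poly_subst[OF rhom_const_const]] rhom.zero[OF rhom_const_const] algebra_simps)
  qed (simp add: poly_subst_0 fps_eq_iff)
  show ?thesis
  proof (rule shift_recursion_unique[of "fps_X ^ n" "\<lambda>H. wder (?S H)"])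
    fix H :: "complex poly fps"
    have "fps_shift 1 (wder H) = wder (fps_shift 1 H)"
      by (simp add: fps_eq_iff)
    then show "wder (?S H) - wder W * ?S (wder H) =
        fps_X ^ n * (wder (?S (fps_shift 1 H)) - wder W * ?S (wder (fps_shift 1 H)))"
      using rec[of H] rec[of "wder H"] by (simp add: wder_add wder_X_power_mult poly algebra_simps)
  qed (use n in simp)
qed

section \<open>Lifting simple roots\<close>

text \<open>The Taylor expansion to first order: the factor L starts with the derivative at the
unperturbed point, which is all that Newton iteration needs.\<close>

lemma eval_at_perturb:
  assumes Z: "fps_nth Z 0 = 0"
  shows "\<exists>L. eval_at (\<delta> + Z) 1 H = eval_at \<delta> 1 H + Z * L \<and> fps_nth L 0 = poly (pderiv (fps_nth H 0)) (fps_nth \<delta> 0)"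
proof -
  let ?S = "poly_subst fps_const"
  have "\<exists>L. ?S (\<delta> + Z) p = ?S \<delta> p + Z * L \<and> fps_nth L 0 = poly (pderiv p) (fps_nth \<delta> 0)" for p
  proof (induction p)
    case 0
    show ?case by (rule exI[of _ 0]) (simp add: poly_subst_0)
  next
    case (pCons a p)
    then obtain L where L: "?S (\<delta> + Z) p = ?S \<delta> p + Z * L" "fps_nth L 0 = poly (pderiv p) (fps_nth \<delta> 0)"
      by blast
    have "?S (\<delta> + Z) (pCons a p) = ?S \<delta> (pCons a p) + Z * (?S \<delta> p + (\<delta> + Z) * L)"
      unfolding poly_subst_pCons[OF rhom_fps_const] L(1) by (simp add: algebra_simps)
    moreover have "fps_nth (?S \<delta> p + (\<delta> + Z) * L) 0 = poly (pderiv (pCons a p)) (fps_nth \<delta> 0)"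
      by (simp add: L(2) Z pderiv_pCons poly_subst_nth_0)
    ultimately show ?case by blast
  qed
  then obtain \<Lambda> where \<Lambda>: "?S (\<delta> + Z) p = ?S \<delta> p + Z * \<Lambda> p"
      "fps_nth (\<Lambda> p) 0 = poly (pderiv p) (fps_nth \<delta> 0)" for p
    by metis
  have X0: "fps_nth (fps_X ^ 1 :: complex fps) 0 = 0" by simp
  have rec: "eval_at \<eta> 1 H = ?S \<eta> (fps_nth H 0) + fps_X ^ 1 * eval_at \<eta> 1 (fps_shift 1 H)" for \<eta> H
    unfolding subst2_def by (rule fps_subst_rec[OF X0])
  have "eval_at (\<delta> + Z) 1 H = eval_at \<delta> 1 H + Z * fps_subst \<Lambda> (fps_X ^ 1) H"
  proof (rule shift_recursion_unique[OF X0, of "eval_at (\<delta> + Z) 1" "\<lambda>H. eval_at \<delta> 1 H + Z * fps_subst \<Lambda> (fps_X ^ 1) H"])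
    fix H
    show "eval_at (\<delta> + Z) 1 H - (eval_at \<delta> 1 H + Z * fps_subst \<Lambda> (fps_X ^ 1) H) =
      fps_X ^ 1 * (eval_at (\<delta> + Z) 1 (fps_shift 1 H) -
        (eval_at \<delta> 1 (fps_shift 1 H) + Z * fps_subst \<Lambda> (fps_X ^ 1) (fps_shift 1 H)))"
      using rec[of "\<delta> + Z" H] rec[of \<delta> H] fps_subst_rec[OF X0, of \<Lambda> H]
      unfolding \<Lambda>(1) by (simp add: algebra_simps)
  qed
  moreover have "fps_nth (fps_subst \<Lambda> (fps_X ^ 1) H) 0 = poly (pderiv (fps_nth H 0)) (fps_nth \<delta> 0)"
    unfolding fps_subst_nth_0 by (rule \<Lambda>(2))
  ultimately show ?thesis by blast
qed

text \<open>Hensel's lemma, by determining the coefficients of \<delta> one at a time: changing the coefficient of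
t^(k+1) by c changes that coefficient of H(\<delta>, t) by c times the nonzero derivative s.\<close>

lemma simple_root_lifts:
  assumes root: "poly (fps_nth H 0) r = 0" and simple: "poly (pderiv (fps_nth H 0)) r \<noteq> 0"
  shows "\<exists>\<delta>. fps_nth \<delta> 0 = r \<and> eval_at \<delta> 1 H = 0"
proof -
  define s where "s = poly (pderiv (fps_nth H 0)) r"
  \<comment> \<open>D k is the solution modulo t^(k+1).\<close>
  define D where "D = rec_nat (fps_const r)
    (\<lambda>k d. d + fps_const (- fps_nth (eval_at d 1 H) (Suc k) / s) * fps_X ^ Suc k)"
  have D0: "D 0 = fps_const r"
    and DS: "D (Suc k) = D k + fps_const (- fps_nth (eval_at (D k) 1 H) (Suc k) / s) * fps_X ^ Suc k" for k
    by (simp_all add: D_def)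
  have D_nth0: "fps_nth (D k) 0 = r" for k
    by (induction k) (simp_all add: D0 DS)
  have D_nth_eq: "fps_nth (D (k + l)) j = fps_nth (D k) j" if "j \<le> k" for k l j
    using that by (induction l) (simp_all add: DS fps_X_power_mult_right_nth del: power_Suc)
  have small: "fps_nth (eval_at (D k) 1 H) j = 0" if "j \<le> k" for j k
    using that
  proof (induction k arbitrary: j)
    case 0
    then show ?case by (simp add: eval_at_nth_0 D0 root)
  next
    case (Suc k)
    define c where "c = - fps_nth (eval_at (D k) 1 H) (Suc k) / s"
    obtain L where L: "eval_at (D k + fps_const c * fps_X ^ Suc k) 1 H
          = eval_at (D k) 1 H + fps_const c * fps_X ^ Suc k * L"
        "fps_nth L 0 = poly (pderiv (fps_nth H 0)) (fps_nth (D k) 0)"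
      using eval_at_perturb[of "fps_const c * fps_X ^ Suc k" "D k" H] by auto
    have eq: "fps_nth (eval_at (D (Suc k)) 1 H) j
        = fps_nth (eval_at (D k) 1 H) j + c * (if j < Suc k then 0 else fps_nth L (j - Suc k))"
      unfolding DS c_def[symmetric] L(1)
      by (simp add: mult.assoc fps_X_power_mult_nth del: power_Suc)
    show ?case
    proof (cases "j = Suc k")
      case True
      have "s \<noteq> 0" "fps_nth L 0 = s"
        using simple by (simp_all add: s_def L(2) D_nth0)
      then show ?thesis
        using eq True by (simp add: c_def)
    next
      case False
      then show ?thesis
        using eq Suc by simp
    qed
  qed
  define \<delta> where "\<delta> = Abs_fps (\<lambda>k. fps_nth (D k) k)"
  have "fps_nth (eval_at \<delta> 1 H) k = 0" for k
  proof -
    define Z where "Z = fps_shift (Suc k) (\<delta> - D k)"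
    have "fps_nth (D j) j = fps_nth (D k) j" if "j \<le> k" for j
      using D_nth_eq[of j j "k - j"] that by simp
    then have "\<delta> - D k = fps_X ^ Suc k * Z"
      by (simp add: fps_eq_iff Z_def \<delta>_def fps_X_power_mult_nth del: power_Suc)
    then have \<delta>: "\<delta> = D k + fps_X ^ Suc k * Z"
      by (simp add: algebra_simps)
    obtain L where "eval_at \<delta> 1 H = eval_at (D k) 1 H + fps_X ^ Suc k * Z * L"
      using eval_at_perturb[of "fps_X ^ Suc k * Z" "D k" H] unfolding \<delta>[symmetric] by auto
    then show ?thesis
      using small[of k k] by (simp add: mult.assoc fps_X_power_mult_nth del: power_Suc)
  qed
  then have "eval_at \<delta> 1 H = 0"
    by (simp add: fps_eq_iff)
  moreover have "fps_nth \<delta> 0 = r"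
    by (simp add: \<delta>_def D0)
  ultimately show ?thesis by blast
qed

section \<open>The Newton-Puiseux theorem\<close>

text \<open>A polynomial of degree m with a single root r is c (w - r)^m; its second coefficient - c m r vanishes
only for r = 0, and then it is a monomial.\<close>

lemma exists_root_of_lower_order:
  fixes p :: "complex poly"
  assumes deg: "degree p = m" and m: "m \<ge> 1" and tschirnhaus: "coeff p (m - 1) = 0"
    and i0: "i0 < m" "coeff p i0 \<noteq> 0"
  shows "\<exists>r. poly p r = 0 \<and> order r p < m"
proof -
  have p0: "p \<noteq> 0"
    using i0(2) by auto
  obtain r where r: "poly p r = 0"
    using deg m alg_closed_imp_poly_has_root[of p] by auto
  moreover have "order r p \<noteq> m"
  proof
    assume "order r p = m"
    then obtain q where q: "p = [:- r, 1:] ^ m * q"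
      using order_1[of r p] by (auto elim: dvdE)
    have "q \<noteq> 0" using p0 q by auto
    then have "degree p = m + degree q"
      unfolding q by (subst degree_mult_eq) (auto simp: degree_power_eq)
    then obtain c where c: "q = [:c:]"
      using deg by (metis add_cancel_right_right degree_eq_zeroE)
    with \<open>q \<noteq> 0\<close> have c0: "c \<noteq> 0" by auto
    have co: "coeff p i = c * (of_nat (m choose i) * (- r) ^ (m - i))" if "i \<le> m" for i
      using that by (simp add: q c coeff_linear_poly_power)
    have "c * (of_nat m * (- r)) = 0"
      using co[of "m - 1"] tschirnhaus m by (cases m) auto
    then have "r = 0"
      using c0 m by simp
    then have "coeff p i0 = 0"
      using co[of i0] i0 by simp
    with i0 show False by simp
  qed
  moreover have "order r p \<le> m"
    using order_degree[OF p0, of r] deg by simp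
  ultimately show ?thesis
    by (intro exI[of _ r]) auto
qed

lemma order_higher_pderiv:
  fixes p :: "complex poly"
  assumes "p \<noteq> 0" "i \<le> order r p"
  shows "(pderiv ^^ i) p \<noteq> 0 \<and> order r ((pderiv ^^ i) p) = order r p - i"
  using assms(2)
proof (induction i)
  case (Suc i)
  let ?q = "(pderiv ^^ i) p"
  have IH: "?q \<noteq> 0" "order r ?q = order r p - i"
    using Suc by auto
  then have root: "poly ?q r = 0"
    using Suc.prems order_root by force
  have "pderiv ?q \<noteq> 0"
  proof
    assume "pderiv ?q = 0"
    then obtain c where "?q = [:c:]"
      using pderiv_iszero by blast
    with IH(1) root show False by auto
  qed
  moreover have "order r ?q = Suc (order r (pderiv ?q))"
    by (rule order_pderiv[OF IH(1) root])
  ultimately show ?case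
    using IH(2) by simp
qed (use assms in simp)

lemma poly_higher_pderiv_eq_0_iff:
  fixes p :: "complex poly"
  assumes "p \<noteq> 0" "i \<le> order r p"
  shows "poly ((pderiv ^^ i) p) r = 0 \<longleftrightarrow> i < order r p"
  using order_higher_pderiv[OF assms] assms order_root[of "(pderiv ^^ i) p" r] by auto

lemma coeff_0_higher_pderiv:
  fixes p :: "complex poly"
  shows "coeff ((pderiv ^^ i) p) 0 = fact i * coeff p i"
  by (simp add: coeff_higher_pderiv pochhammer_fact)

lemma poly_subst_at_0: "poly_subst fps_const 0 p = fps_const (coeff p 0)"
  by (cases p) (simp add: poly_subst_pCons[OF rhom_fps_const])

lemma eval_at_0_nth: "fps_nth (eval_at 0 1 H) k = coeff (fps_nth H k) 0"
proof -
  have "fps_map (\<lambda>p. coeff p 0) H = fps_subst (poly_subst fps_const 0) (fps_X ^ 1) H"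
  proof (rule fps_subst_unique)
    show "fps_map (\<lambda>p. coeff p 0) H = poly_subst fps_const 0 (fps_nth H 0)
        + fps_X ^ 1 * fps_map (\<lambda>p. coeff p 0) (fps_shift 1 H)" for H :: "complex poly fps"
      by (simp add: fps_eq_iff poly_subst_at_0 fps_X_mult_nth)
  qed simp
  then show ?thesis
    by (metis fps_map_nth subst2_def)
qed

text \<open>Taylor's formula for H(\<delta>(t^b) + t^a w, t^b): the coefficient of w^i, multiplied by i!, is the i-th
derivative of H along \<delta>, evaluated at t^b and multiplied by t^(a i).\<close>

lemma affine_substitution_coeff:
  fixes \<delta> :: "complex fps" and H :: "complex poly fps" and a b :: nat
  assumes b: "b \<ge> 1"
  defines "K \<equiv> subst2 (\<lambda>c. fps_const [:c:]) (emb (fps_compose \<delta> (fps_X ^ b)) + fps_X ^ a * wvar) b H"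
  shows "fact i * coeff (fps_nth K k) i
    = fps_nth (fps_X ^ (a * i) * fps_compose (eval_at \<delta> 1 ((wder ^^ i) H)) (fps_X ^ b)) k"
proof -
  define W where "W = emb (fps_compose \<delta> (fps_X ^ b)) + fps_X ^ a * wvar"
  let ?S = "subst2 (\<lambda>c. fps_const [:c:]) W b"
  have "wder wvar = 1" "wder (emb \<eta>) = 0" for \<eta>
    by (simp_all add: fps_eq_iff pderiv_pCons one_pCons)
  then have wderW: "wder W = fps_X ^ a"
    by (simp add: W_def wder_add wder_X_power_mult)
  have ders: "(wder ^^ i) (?S H) = fps_X ^ (a * i) * ?S ((wder ^^ i) H)"
  proof (induction i)
    case (Suc i)
    then show ?case
      by (simp add: wder_X_power_mult wder_subst2[OF b] wderW power_add mult_ac)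
  qed simp
  have "eval_at 0 1 W = fps_compose \<delta> (fps_X ^ b)"
    by (simp only: W_def rhom.add[OF rhom_eval_at] rhom.mult[OF rhom_eval_at] subst2_wvar[OF rhom_fps_const]
        eval_at_emb order_refl power_one_right mult_zero_right add_0_right fps_compose_fps_X)
  then have "eval_at 0 1 (?S G) = fps_compose (eval_at \<delta> 1 G) (fps_X ^ b)" for G
    using eval_at_subst2[of b 1 0 W G] eval_at_compose[of 1 b \<delta> G] b by simp
  then have "eval_at 0 1 ((wder ^^ i) (?S H))
      = fps_X ^ (a * i) * fps_compose (eval_at \<delta> 1 ((wder ^^ i) H)) (fps_X ^ b)"
    by (simp only: ders rhom.mult[OF rhom_eval_at] subst2_X_power[OF rhom_fps_const] order_refl mult_1)
  moreover have "fps_nth (eval_at 0 1 ((wder ^^ i) (?S H))) k = fact i * coeff (fps_nth K k) i"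
    by (simp only: eval_at_0_nth wder_pow_nth coeff_0_higher_pderiv) (simp add: K_def W_def)
  ultimately show ?thesis by simp
qed

text \<open>Induction on the order m of the root r for t = 0. The derivative of order m - 1 has a simple root
there, which lifts to a series \<delta>; in the coordinate w - \<delta> the coefficient of w^(m-1) vanishes
(Tschirnhaus). If \<delta> is not itself a root, rescaling along the edge of the Newton polygon that ends at w^m
(t \<rightarrow> t^b, w = \<delta> + t^a w', division by t^(a m)) gives a series whose value at t = 0 has degree m, is not
a monomial and has no term of degree m - 1. Such a polynomial has a root of order less than m.\<close>

theorem exists_puiseux_root:
  fixes H :: "complex poly fps"
  assumes "fps_nth H 0 \<noteq> 0" and "poly (fps_nth H 0) r = 0"
  shows "\<exists>n\<ge>1. \<exists>\<delta>. fps_nth \<delta> 0 = r \<and> eval_at \<delta> n H = 0"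
  using assms
proof (induction "order r (fps_nth H 0)" arbitrary: H r rule: less_induct)
  case (less H r)
  define m where "m = order r (fps_nth H 0)"
  have m: "m \<ge> 1"
    using less.prems order_root[of "fps_nth H 0" r] by (auto simp: m_def)
  let ?D = "\<lambda>i. (wder ^^ i) H"
  have D0: "poly (fps_nth (?D i) 0) r = 0 \<longleftrightarrow> i < m" if "i \<le> m" for i
    using poly_higher_pderiv_eq_0_iff[of "fps_nth H 0" i r] less.prems that
    by (simp add: wder_pow_nth m_def)
  have "pderiv (fps_nth (?D (m - 1)) 0) = fps_nth (?D m) 0"
    using m by (cases m) simp_all
  then obtain \<delta> where \<delta>0: "fps_nth \<delta> 0 = r" and \<delta>: "eval_at \<delta> 1 (?D (m - 1)) = 0"
    using simple_root_lifts[of "?D (m - 1)" r] D0[of "m - 1"] D0[of m] m by auto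
  define h where "h i = eval_at \<delta> 1 (?D i)" for i
  have h0: "fps_nth (h i) 0 = 0 \<longleftrightarrow> i < m" if "i \<le> m" for i
    using D0[OF that] by (simp add: h_def eval_at_nth_0 \<delta>0 del: One_nat_def)
  show ?case
  proof (cases "h 0 = 0")
    case True
    then show ?thesis
      using \<delta>0 by (intro exI[of _ 1] exI[of _ \<delta>] conjI) (simp_all add: h_def)
  next
    case False
    \<comment> \<open>The factorial clears the denominators of all slopes ord(h i) / (m - i); a is the smallest slope times b.\<close>
    define b where "b = (fact m :: nat)"
    have b: "b \<ge> 1" by (simp add: b_def)
    define s where "s i = b div (m - i) * subdegree (h i)" for i
    have s: "(m - i) * s i = b * subdegree (h i)" if "i < m" for i
    proof -
      have "(m - i) dvd b"
        unfolding b_def by (rule dvd_fact) (use that in auto)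
      then show ?thesis by (simp add: s_def mult.assoc[symmetric])
    qed
    define I where "I = {i. i < m \<and> h i \<noteq> 0}"
    define a where "a = Min (s ` I)"
    have I: "finite I" "0 \<in> I"
      using False m by (auto simp: I_def)
    have a_le: "a \<le> s i" if "i \<in> I" for i
      unfolding a_def using I that by auto
    have "a \<in> s ` I"
      unfolding a_def by (rule Min_in) (use I in auto)
    then obtain i0 where i0: "i0 \<in> I" "s i0 = a"
      by auto
    have i0m: "i0 < m" using i0 by (simp add: I_def)
    have a: "a \<ge> 1"
    proof -
      have "subdegree (h i0) \<noteq> 0"
        using i0 h0[of i0] by (auto simp: I_def subdegree_eq_0_iff)
      then have "(m - i0) * s i0 \<noteq> 0"
        using s[OF i0m] b by simp
      then show ?thesis using i0(2) by simp
    qed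
    define W where "W = emb (fps_compose \<delta> (fps_X ^ b)) + fps_X ^ a * wvar"
    define K where "K = subst2 (\<lambda>c. fps_const [:c:]) W b H"
    define h' where "h' i = fps_compose (h i) (fps_X ^ b)" for i
    have K: "fact i * coeff (fps_nth K k) i = (if k < a * i then 0 else fps_nth (h' i) (k - a * i))" for i k
      using affine_substitution_coeff[OF b, where i = i and \<delta> = \<delta> and H = H and k = k and a = a]
      by (simp add: K_def W_def h_def h'_def fps_X_power_mult_nth)
    have K0: "coeff (fps_nth K k) i = 0" if "k < a * i \<or> fps_nth (h' i) (k - a * i) = 0" for i k
      using K[of i k] that by (auto split: if_splits)
    have h'_0: "fps_nth (h' i) j = 0" if "i < m" "j < a * (m - i)" for i j
    proof (cases "h i = 0")
      case False
      then have "a * (m - i) \<le> b * subdegree (h i)"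
        using mult_le_mono2[OF a_le[of i], of "m - i"] s[OF \<open>i < m\<close>] that by (simp add: I_def mult.commute[of a])
      then have "j < subdegree (h' i)"
        using that b by (simp add: h'_def fps_X_power_subdegree mult.commute)
      then show ?thesis by (rule nth_less_subdegree_zero)
    qed (simp add: h'_def)
    \<comment> \<open>For i < m the choice of a makes the order of h i at t^b at least a (m - i); for i at least m the factor t^(a i) suffices.\<close>
    have K_small: "fps_nth K k = 0" if k: "k < a * m" for k
    proof (rule poly_eqI)
      fix i
      have "k < a * i" if "i \<ge> m"
        using k that by (meson less_le_trans mult_le_mono2)
      moreover have "fps_nth (h' i) (k - a * i) = 0" if "i < m" "\<not> k < a * i"
        by (rule h'_0) (use that k in \<open>auto simp: diff_mult_distrib2\<close>)
      ultimately show "coeff (fps_nth K k) i = coeff 0 i"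
        using K0[of k i] by (cases "i < m") auto
    qed
    define H1 where "H1 = fps_shift (a * m) K"
    have K_H1: "K = fps_X ^ (a * m) * H1"
      by (simp add: fps_eq_iff H1_def fps_X_power_mult_nth K_small)
    define p where "p = fps_nth H1 0"
    have p: "p = fps_nth K (a * m)"
      by (simp add: p_def H1_def)
    have pm: "coeff p m \<noteq> 0"
      using K[of m "a * m"] h0[of m] by (auto simp: p h'_def)
    have "coeff p i = 0" if "i > m" for i
      using K0[of "a * m" i] that a by (simp add: p)
    with pm have deg: "degree p = m"
      by (intro le_antisym degree_le le_degree) auto
    have "h (m - 1) = 0"
      by (simp only: h_def \<delta>)
    then have "coeff p (m - 1) = 0"
      using K0[of "a * m" "m - 1"] by (simp add: p h'_def)
    moreover have "coeff p i0 \<noteq> 0"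
    proof -
      have "h i0 \<noteq> 0" using i0 by (simp add: I_def)
      then have "h' i0 \<noteq> 0"
        using b by (simp add: h'_def fps_compose_eq_0_iff)
      moreover have "subdegree (h' i0) = a * m - a * i0"
        using s[OF i0m] b i0(2) by (simp add: h'_def fps_X_power_subdegree algebra_simps diff_mult_distrib2)
      ultimately have "fps_nth (h' i0) (a * m - a * i0) \<noteq> 0"
        by (metis nth_subdegree_nonzero)
      then show ?thesis
        using K[of i0 "a * m"] i0m by (auto simp: p)
    qed
    ultimately obtain r' where r': "poly p r' = 0" "order r' p < m"
      using exists_root_of_lower_order[OF deg m _ i0m] by blast
    moreover have "p \<noteq> 0"
      using pm by auto
    ultimately obtain n \<epsilon> where n: "n \<ge> 1" and "eval_at \<epsilon> n H1 = 0"
      using less.hyps[of r' H1] unfolding m_def[symmetric] p_def[symmetric] by blast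
    then have "eval_at \<epsilon> n K = 0"
      by (simp add: K_H1 rhom.mult[OF rhom_eval_at])
    then have "eval_at (eval_at \<epsilon> n W) (n * b) H = 0"
      using eval_at_subst2[OF b n] by (simp add: K_def)
    moreover have "fps_nth (eval_at \<epsilon> n W) 0 = r"
      using a b n by (simp add: eval_at_nth_0 W_def \<delta>0)
    ultimately show ?thesis
      using n b by (intro exI[of _ "n * b"] exI conjI) auto
  qed
qed

text \<open>Division with remainder by the monic linear polynomial w - \<delta>, coefficient by coefficient in t.\<close>

lemma eval_at_division:
  "\<exists>G. H = emb (eval_at \<delta> 1 H) + (wvar - emb \<delta>) * G"
proof -
  have "\<exists>Q. fps_const p = emb (poly_subst fps_const \<delta> p) + (wvar - emb \<delta>) * Q" for p
  proof (induction p)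
    case 0
    show ?case by (rule exI[of _ 0]) (simp add: poly_subst_0 fps_eq_iff)
  next
    case (pCons a p)
    let ?P = "emb (poly_subst fps_const \<delta> p)"
    from pCons.IH obtain Q where "fps_const p = ?P + (wvar - emb \<delta>) * Q"
      by blast
    moreover have "fps_const (pCons a p) = fps_const [:a:] + wvar * fps_const p"
      by simp
    moreover have "emb (poly_subst fps_const \<delta> (pCons a p)) = fps_const [:a:] + emb \<delta> * ?P"
      by (simp only: poly_subst_pCons[OF rhom_fps_const] rhom.add[OF rhom_emb] rhom.mult[OF rhom_emb]
          fps_map_const[OF rhom_const_poly])
    moreover have "b = e + (w - d) * (x + d * q)"
      if "x = P + (w - d) * q" "b = a' + w * x" "e = a' + d * P" for x P w d q a' b e :: "complex poly fps"
      unfolding that by (simp add: algebra_simps)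
    ultimately show ?case by blast
  qed
  then obtain Q where Q: "fps_const p = emb (poly_subst fps_const \<delta> p) + (wvar - emb \<delta>) * Q p" for p
    by metis
  have X0: "fps_nth (fps_X ^ 1 :: 'a::comm_ring_1 fps) 0 = 0" by simp
  have "H = emb (eval_at \<delta> 1 H) + (wvar - emb \<delta>) * fps_subst Q (fps_X ^ 1) H"
  proof (rule shift_recursion_unique[OF X0, of "\<lambda>H. H" "\<lambda>H. emb (eval_at \<delta> 1 H) + (wvar - emb \<delta>) * fps_subst Q (fps_X ^ 1) H"])
    fix H :: "complex poly fps"
    let ?H' = "fps_shift 1 H"
    have 1: "eval_at \<delta> 1 H = poly_subst fps_const \<delta> (fps_nth H 0) + fps_X ^ 1 * eval_at \<delta> 1 ?H'"
      unfolding subst2_def by (rule fps_subst_rec[OF X0])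
    have 2: "emb (eval_at \<delta> 1 H) = emb (poly_subst fps_const \<delta> (fps_nth H 0)) + fps_X * emb (eval_at \<delta> 1 ?H')"
      unfolding 1 by (simp only: rhom.add[OF rhom_emb] rhom.mult[OF rhom_emb] fps_map_X[OF rhom_const_poly] power_one_right)
    have 3: "fps_subst Q (fps_X ^ 1) H = Q (fps_nth H 0) + fps_X ^ 1 * fps_subst Q (fps_X ^ 1) ?H'"
      by (rule fps_subst_rec[OF X0])
    have 4: "H - fps_X * ?H' = fps_const (fps_nth H 0)"
      using fps_first_term_decomp[of H] by (metis add_diff_cancel_right')
    have ring: "h - (a + x * e + w * (q + x * s)) = x * (h' - (e + w * s))"
      if "h - x * h' = c" "c = a + w * q" for h h' a x e w q s c :: "complex poly fps"
      using that by (simp add: algebra_simps)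
    show "H - (emb (eval_at \<delta> 1 H) + (wvar - emb \<delta>) * fps_subst Q (fps_X ^ 1) H) =
      fps_X ^ 1 * (?H' - (emb (eval_at \<delta> 1 ?H') + (wvar - emb \<delta>) * fps_subst Q (fps_X ^ 1) ?H'))"
      unfolding power_one_right 2 3[unfolded power_one_right] by (rule ring[OF 4 Q])
  qed
  then show ?thesis by blast
qed

lemma emb_compose_X_power:
  "fps_compose (emb \<delta>) (fps_X ^ k) = emb (fps_compose \<delta> (fps_X ^ k))"
proof (rule fps_ext)
  fix n
  have "[:\<delta>:] * (if P then 1 else 0) = [:\<delta> * (if P then 1 else 0):]" for \<delta> :: complex and P
    by simp
  then show "fps_nth (fps_compose (emb \<delta>) (fps_X ^ k)) n = fps_nth (emb (fps_compose \<delta> (fps_X ^ k))) n"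
    by (simp add: fps_compose_nth power_mult[symmetric] rhom.sum[OF rhom_const_poly] del: mult_pCons_left)
qed

text \<open>Splitting off one root lowers the order at r by one, so the previous theorem applies as often as the
order says. The cofactor G does not vanish at r for t = 0, so no further root starts at r.\<close>

theorem puiseux_factorisation:
  fixes H :: "complex poly fps"
  assumes "fps_nth H 0 \<noteq> 0"
  shows "\<exists>n\<ge>1. \<exists>\<delta> G. (\<forall>i<order r (fps_nth H 0). fps_nth (\<delta> i) 0 = r) \<and>
    fps_compose H (fps_X ^ n) = (\<Prod>i<order r (fps_nth H 0). wvar - emb (\<delta> i)) * G \<and> poly (fps_nth G 0) r \<noteq> 0"
  using assms
proof (induction "order r (fps_nth H 0)" arbitrary: H)
  case 0
  then show ?case
    using order_root[of "fps_nth H 0" r] by (intro exI[of _ 1] conjI exI[of _ "\<lambda>_. 0"] exI[of _ H]) auto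
next
  case (Suc m)
  then have "poly (fps_nth H 0) r = 0"
    using order_root[of "fps_nth H 0" r] by auto
  then obtain n0 \<delta>0 where n0: "n0 \<ge> 1" and \<delta>0: "fps_nth \<delta>0 0 = r" "eval_at \<delta>0 n0 H = 0"
    using exists_puiseux_root[OF Suc.prems] by blast
  have "eval_at \<delta>0 1 (fps_compose H (fps_X ^ n0)) = 0"
    using eval_at_base_change[OF n0, of 1 \<delta>0 H] \<delta>0(2) by simp
  then obtain H1 where H1: "fps_compose H (fps_X ^ n0) = (wvar - emb \<delta>0) * H1"
    using eval_at_division[of "fps_compose H (fps_X ^ n0)" \<delta>0] by (auto simp: rhom.zero[OF rhom_emb])
  have "fps_nth H 0 = [:- r, 1:] * fps_nth H1 0"
    using arg_cong[OF H1, of "\<lambda>F. fps_nth F 0"] by (simp add: \<delta>0(1))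
  then have H1_0: "fps_nth H1 0 \<noteq> 0" and "order r (fps_nth H 0) = Suc (order r (fps_nth H1 0))"
    using Suc.prems order_mult[of "[:- r, 1:]" "fps_nth H1 0" r] order_power_n_n[of r 1] by auto
  then have m: "m = order r (fps_nth H1 0)"
    using Suc.hyps(2) by simp
  obtain n1 \<delta> G where n1: "n1 \<ge> 1" and \<delta>: "\<forall>i<m. fps_nth (\<delta> i) 0 = r"
    and G: "fps_compose H1 (fps_X ^ n1) = (\<Prod>i<m. wvar - emb (\<delta> i)) * G" "poly (fps_nth G 0) r \<noteq> 0"
    using Suc.hyps(1)[OF m H1_0] unfolding m[symmetric] by blast
  define \<delta>' where "\<delta>' i = (if i < m then \<delta> i else fps_compose \<delta>0 (fps_X ^ n1))" for i
  have X: "fps_nth (fps_X ^ n1 :: complex poly fps) 0 = 0" "fps_nth (fps_X ^ n0 :: complex poly fps) 0 = 0"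
    using n0 n1 by auto
  have "fps_compose H (fps_X ^ (n0 * n1)) = fps_compose (fps_compose H (fps_X ^ n0)) (fps_X ^ n1)"
    by (simp only: fps_compose_assoc[OF X, symmetric] fps_X_power_compose[OF X(1)] power_mult[symmetric] mult.commute)
  also have "\<dots> = (wvar - emb (fps_compose \<delta>0 (fps_X ^ n1))) * fps_compose H1 (fps_X ^ n1)"
    unfolding H1 fps_compose_mult_distrib[OF X(1)] fps_compose_sub_distrib emb_compose_X_power by simp
  also have "\<dots> = (\<Prod>i<Suc m. wvar - emb (\<delta>' i)) * G"
    by (simp add: G(1) \<delta>'_def)
  finally have "fps_compose H (fps_X ^ (n0 * n1)) = (\<Prod>i<Suc m. wvar - emb (\<delta>' i)) * G" .
  moreover have "\<forall>i<Suc m. fps_nth (\<delta>' i) 0 = r"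
    using \<delta> \<delta>0 by (simp add: \<delta>'_def)
  ultimately show ?case
    using n0 n1 G(2) unfolding Suc.hyps(2)[symmetric] by (intro exI[of _ "n0 * n1"]) auto
qed

section \<open>Root multiplicities\<close>

text \<open>Measured by vanishing derivatives, multiplicities can be compared between C[[t]][[x]] for
different ramifications and C[w][[t]], because the vanishing of a series in t is not
affected by t \<rightarrow> t^k or by factors t^k, whereas divisibility statements live in different rings.\<close>

lemma power_dvd_iff_derivatives:
  fixes \<pi> :: "'a::idom" and e :: "'a \<Rightarrow> complex fps"
  assumes e: "rhom e" and D_mult: "\<And>x y. D (x * y) = D x * y + x * D y"
    and D\<pi>: "D \<pi> = 1" and e\<pi>: "e \<pi> = 0" and factor: "\<And>x. e x = 0 \<Longrightarrow> \<pi> dvd x"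
  shows "\<pi> ^ m dvd F \<longleftrightarrow> (\<forall>j<m. e ((D ^^ j) F) = 0)"
proof -
  have "D (1 * 1) = D 1 * 1 + 1 * D 1"
    by (rule D_mult)
  then have "D 1 = 0"
    by (metis add_cancel_right_right mult.right_neutral mult_1)
  then have D_power: "D (\<pi> ^ Suc k) = of_nat (Suc k) * \<pi> ^ k" for k
    by (induction k) (simp_all add: D_mult D\<pi> algebra_simps)
  have D_prod: "D (\<pi> ^ Suc k * G) = \<pi> ^ k * (of_nat (Suc k) * G + \<pi> * D G)" for k G
    unfolding D_mult D_power by (simp add: algebra_simps)
  have top: "e ((D ^^ k) (\<pi> ^ k * G)) = of_nat (fact k) * e G" for k G
  proof (induction k arbitrary: G)
    case (Suc k)
    have "(D ^^ Suc k) (\<pi> ^ Suc k * G) = (D ^^ k) (\<pi> ^ k * (of_nat (Suc k) * G + \<pi> * D G))"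
      unfolding funpow_Suc_right o_apply D_prod ..
    then show ?case
      by (simp only: Suc.IH) (simp add: rhom.add[OF e] rhom.mult[OF e] rhom.of_nat[OF e] e\<pi> rhom.one[OF e] algebra_simps)
  qed simp
  have low: "e ((D ^^ j) (\<pi> ^ k * G)) = 0" if "j < k" for j k G
    using that
  proof (induction j arbitrary: k G)
    case 0
    then show ?case
      by (simp add: rhom.mult[OF e] rhom.power[OF e] e\<pi>)
  next
    case (Suc j)
    then obtain k' where k': "k = Suc k'" "j < k'"
      by (cases k) auto
    show ?case
      unfolding funpow_Suc_right o_apply k'(1) D_prod by (rule Suc.IH[OF k'(2)])
  qed
  show ?thesis
  proof (induction m)
    case (Suc m)
    show ?case
    proof
      assume "\<pi> ^ Suc m dvd F"
      then show "\<forall>j<Suc m. e ((D ^^ j) F) = 0"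
        using low[of _ "Suc m"] by (auto elim!: dvdE simp del: power_Suc)
    next
      assume *: "\<forall>j<Suc m. e ((D ^^ j) F) = 0"
      then obtain G where G: "F = \<pi> ^ m * G"
        using Suc.IH by (auto elim: dvdE)
      have "of_nat (fact m) * e G = 0"
        using top[of m G] * G by simp
      then have "e G = 0"
        by (simp add: fps_of_nat[symmetric] del: of_nat_fact)
      then show "\<pi> ^ Suc m dvd F"
        using factor G by (simp add: mult_dvd_mono mult.commute)
    qed
  qed simp
qed

lemma wder_wvar_minus_emb: "wder (wvar - emb \<delta>) = 1"
  by (simp add: fps_eq_iff pderiv_diff pderiv_pCons one_pCons)

lemma eval_at_wvar_minus_emb: "eval_at \<delta> 1 (wvar - emb \<eta>) = \<delta> - \<eta>"
  by (simp only: rhom.diff[OF rhom_eval_at] order_refl subst2_wvar[OF rhom_fps_const] eval_at_emb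
      power_one_right fps_compose_fps_X)

lemma w_root_power_dvd_iff:
  "(wvar - emb \<delta>) ^ m dvd H \<longleftrightarrow> (\<forall>j<m. eval_at \<delta> 1 ((wder ^^ j) H) = 0)"
proof (rule power_dvd_iff_derivatives[where e = "eval_at \<delta> 1" and D = wder,
      OF rhom_eval_at[OF order_refl] wder_mult wder_wvar_minus_emb])
  show "eval_at \<delta> 1 (wvar - emb \<delta>) = 0"
    by (simp only: eval_at_wvar_minus_emb) simp
  show "wvar - emb \<delta> dvd G" if "eval_at \<delta> 1 G = 0" for G
    using eval_at_division[of G \<delta>] that by (auto simp: rhom.zero[OF rhom_emb])
qed

text \<open>The cofactor and the factors belonging to other roots are nonzero at \<epsilon>, so only the factors equal to
w - \<epsilon> contribute.\<close>

lemma multiplicity_in_product: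
  fixes m :: nat
  assumes G: "poly (fps_nth G 0) (fps_nth \<epsilon> 0) \<noteq> 0"
  shows "(\<forall>j<l. eval_at \<epsilon> 1 ((wder ^^ j) ((\<Prod>i<m. wvar - emb (\<delta> i)) * G)) = 0)
    \<longleftrightarrow> l \<le> card {i. i < m \<and> \<delta> i = \<epsilon>}"
proof -
  let ?\<pi> = "wvar - emb \<epsilon>"
  define c where "c = card {i. i < m \<and> \<delta> i = \<epsilon>}"
  define R where "R = (\<Prod>i\<in>{i. i < m \<and> \<delta> i \<noteq> \<epsilon>}. wvar - emb (\<delta> i)) * G"
  have "{..<m} = {i. i < m \<and> \<delta> i = \<epsilon>} \<union> {i. i < m \<and> \<delta> i \<noteq> \<epsilon>}"
    by auto
  then have "(\<Prod>i<m. wvar - emb (\<delta> i)) =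
      (\<Prod>i\<in>{i. i < m \<and> \<delta> i = \<epsilon>} \<union> {i. i < m \<and> \<delta> i \<noteq> \<epsilon>}. wvar - emb (\<delta> i))"
    by (rule arg_cong[where f = "prod (\<lambda>i. wvar - emb (\<delta> i))"])
  also have "\<dots> = (\<Prod>i\<in>{i. i < m \<and> \<delta> i = \<epsilon>}. wvar - emb (\<delta> i)) * (\<Prod>i\<in>{i. i < m \<and> \<delta> i \<noteq> \<epsilon>}. wvar - emb (\<delta> i))"
    by (rule prod.union_disjoint) auto
  also have "(\<Prod>i\<in>{i. i < m \<and> \<delta> i = \<epsilon>}. wvar - emb (\<delta> i)) = (\<Prod>i\<in>{i. i < m \<and> \<delta> i = \<epsilon>}. ?\<pi>)"
    by (rule prod.cong) auto
  also have "\<dots> = ?\<pi> ^ c"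
    by (simp add: c_def)
  finally have K: "(\<Prod>i<m. wvar - emb (\<delta> i)) * G = ?\<pi> ^ c * R"
    by (simp add: R_def mult.assoc)
  have "eval_at \<epsilon> 1 G \<noteq> 0"
    using G eval_at_nth_0[of 1 \<epsilon> G] by (metis fps_zero_nth order_refl)
  then have "eval_at \<epsilon> 1 R \<noteq> 0"
    unfolding R_def rhom.mult[OF rhom_eval_at[OF order_refl]] rhom.prod[OF rhom_eval_at[OF order_refl]]
      eval_at_wvar_minus_emb by auto
  then have "\<not> ?\<pi> dvd R"
    using w_root_power_dvd_iff[of \<epsilon> 1 R] by auto
  moreover have "?\<pi> \<noteq> 0"
  proof
    assume "?\<pi> = 0"
    then have "wder 0 = 1"
      using wder_wvar_minus_emb[of \<epsilon>] by metis
    then show False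
      by (metis fps_map_nth fps_one_nth fps_zero_nth pderiv_0 zero_neq_one)
  qed
  ultimately have "\<not> ?\<pi> ^ Suc c dvd ?\<pi> ^ c * R"
    by simp
  then have "?\<pi> ^ l dvd ?\<pi> ^ c * R \<longleftrightarrow> l \<le> c"
    by (meson dvd_trans dvd_triv_left le_imp_power_dvd not_less_eq_eq)
  then show ?thesis
    unfolding K c_def[symmetric] w_root_power_dvd_iff by simp
qed

section \<open>Evaluating germs along series\<close>

abbreviation eval_germ :: "complex fps \<Rightarrow> complex fps fps \<Rightarrow> complex fps" where
  "eval_germ \<equiv> fps_subst (\<lambda>c. c)"

text \<open>The quotient of F by x - \<gamma> is explicit: its j-th coefficient is the value at \<gamma> of the series F shifted
by j + 1 places.\<close>

lemma germ_factor:
  assumes \<gamma>: "fps_nth \<gamma> 0 = 0" and zero: "eval_germ \<gamma> F = 0"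
  shows "fps_X - fps_const \<gamma> dvd F"
proof -
  define Q where "Q = Abs_fps (\<lambda>j. eval_germ \<gamma> (fps_shift (Suc j) F))"
  have rec: "eval_germ \<gamma> (fps_shift j F) = fps_nth F j + \<gamma> * eval_germ \<gamma> (fps_shift (Suc j) F)" for j
    using fps_subst_rec[OF \<gamma>, of "\<lambda>c. c" "fps_shift j F"] fps_shift_fps_shift[of 1 j F] by simp
  have "F = (fps_X - fps_const \<gamma>) * Q"
  proof (rule fps_ext)
    show "fps_nth F j = fps_nth ((fps_X - fps_const \<gamma>) * Q) j" for j
      using rec[of j] zero by (cases j) (simp_all add: Q_def algebra_simps fps_X_mult_nth eq_neg_iff_add_eq_0)
  qed
  then show ?thesis by (rule dvdI)
qed

lemma germ_root_power_dvd_iff: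
  assumes \<gamma>: "fps_nth \<gamma> 0 = 0"
  shows "(fps_X - fps_const \<gamma>) ^ m dvd F \<longleftrightarrow> (\<forall>j<m. eval_germ \<gamma> ((fps_deriv ^^ j) F) = 0)"
proof (rule power_dvd_iff_derivatives[OF rhom_fps_subst[OF rhom_id \<gamma>]])
  show "eval_germ \<gamma> (fps_X - fps_const \<gamma>) = 0"
    using \<gamma> by (simp add: rhom.diff[OF rhom_fps_subst[OF rhom_id \<gamma>]] fps_subst_X fps_subst_const rhom_id)
  show "fps_X - fps_const \<gamma> dvd G" if "eval_germ \<gamma> G = 0" for G
    by (rule germ_factor[OF \<gamma> that])
qed (simp_all add: algebra_simps)

text \<open>The operators D needed here are d/dt and d/dw, applied after a substitution; D0 is the action of D on
the coefficients.\<close>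

lemma chain_rule:
  fixes D :: "'b::comm_ring_1 fps \<Rightarrow> 'b fps" and D0 :: "'a::comm_ring_1 \<Rightarrow> 'a"
  assumes \<theta>: "rhom \<theta>" and W: "fps_nth W 0 = 0"
    and add: "\<And>x y. D (x + y) = D x + D y" and mult: "\<And>x y. D (x * y) = D x * y + x * D y"
    and D0: "\<And>c. D (\<theta> c) = \<theta> (D0 c)"
  shows "D (fps_subst \<theta> W H) = fps_subst \<theta> W (fps_map D0 H) + D W * fps_subst \<theta> W (fps_deriv H)"
proof (rule shift_recursion_unique[OF W, of "\<lambda>H. D (fps_subst \<theta> W H)"])
  fix H :: "'a fps"
  let ?S = "fps_subst \<theta> W" and ?H' = "fps_shift 1 H"
  have "fps_deriv H = fps_deriv (fps_const (fps_nth H 0) + fps_X * ?H')"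
    using fps_first_term_decomp[of H] by simp
  also have "\<dots> = ?H' + fps_X * fps_deriv ?H'"
    by (simp only: fps_deriv_add fps_deriv_mult fps_deriv_const fps_deriv_fps_X) simp
  finally have 1: "?S (fps_deriv H) = ?S ?H' + W * ?S (fps_deriv ?H')"
    by (simp only: fps_subst_add[OF \<theta>] fps_subst_X_mult[OF \<theta> W])
  have "fps_shift 1 (fps_map D0 H) = fps_map D0 ?H'"
    by (simp add: fps_eq_iff)
  then have 2: "?S (fps_map D0 H) = \<theta> (D0 (fps_nth H 0)) + W * ?S (fps_map D0 ?H')"
    using fps_subst_rec[OF W, of \<theta> "fps_map D0 H"] by simp
  have 3: "D (?S H) = \<theta> (D0 (fps_nth H 0)) + (D W * ?S ?H' + W * D (?S ?H'))"
    by (subst fps_subst_rec[OF W]) (simp only: add mult D0)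
  show "D (?S H) - (?S (fps_map D0 H) + D W * ?S (fps_deriv H)) =
      W * (D (?S ?H') - (?S (fps_map D0 ?H') + D W * ?S (fps_deriv ?H')))"
    unfolding 1 2 3 by (simp add: algebra_simps)
qed

lemma germ_ram_eq: "germ_ram n F = fps_map (\<lambda>c. fps_compose c (fps_X ^ n)) F"
  by (simp add: germ_ram_def fps_map_def)

lemma rhom_germ_ram: "n \<ge> 1 \<Longrightarrow> rhom (germ_ram n)"
  unfolding germ_ram_eq by (intro rhom_fps_map rhom_fps_compose) simp

lemma fps_compose_X_power_twice:
  fixes c :: "'a::idom fps"
  assumes "k \<ge> 1" "n \<ge> 1"
  shows "fps_compose (fps_compose c (fps_X ^ n)) (fps_X ^ k) = fps_compose c (fps_X ^ (n * k))"
proof -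
  have X: "fps_nth (fps_X ^ k :: 'a fps) 0 = 0" "fps_nth (fps_X ^ n :: 'a fps) 0 = 0"
    using assms by auto
  show ?thesis
    by (simp only: fps_compose_assoc[OF X, symmetric] fps_X_power_compose[OF X(1)] power_mult[symmetric] mult.commute)
qed

lemma germ_ram_mult:
  assumes "n \<ge> 1" "k \<ge> 1"
  shows "germ_ram (n * k) F = fps_map (\<lambda>c. fps_compose c (fps_X ^ k)) (germ_ram n F)"
  using assms by (simp add: fps_eq_iff germ_ram_eq fps_compose_X_power_twice)

lemma germ_ram_dx: "germ_ram n (dx F) = fps_deriv (germ_ram n F)"
proof -
  have "fps_compose (of_nat k * c) (fps_X ^ n) = of_nat k * fps_compose c (fps_X ^ n)" for k and c :: "complex fps"
    by (simp add: fps_eq_iff fps_compose_nth sum_distrib_left fps_of_nat[symmetric] mult.assoc)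
  then show ?thesis
    by (simp add: fps_eq_iff[of _ "fps_deriv _"] germ_ram_eq dx_def del: of_nat_Suc)
qed

lemma germ_ram_dx_pow: "germ_ram n ((dx ^^ j) F) = (fps_deriv ^^ j) (germ_ram n F)"
  by (induction j) (simp_all add: germ_ram_dx)

lemma germ_ram_dy:
  assumes "n \<ge> 1"
  shows "fps_map fps_deriv (germ_ram n F) = fps_const (of_nat n * fps_X ^ (n - 1)) * germ_ram n (dy F)"
  using assms
  by (simp add: fps_eq_iff[of "fps_map _ _"] germ_ram_eq dy_def fps_compose_deriv fps_deriv_power' mult.commute)

lemma eval_germ_ram_mult:
  assumes \<gamma>: "fps_nth \<gamma> 0 = 0" and "n \<ge> 1" "k \<ge> 1"
  shows "eval_germ (fps_compose \<gamma> (fps_X ^ k)) (germ_ram (n * k) F) = fps_compose (eval_germ \<gamma> (germ_ram n F)) (fps_X ^ k)"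
proof -
  have "fps_compose (eval_germ \<gamma> (germ_ram n F)) (fps_X ^ k)
      = fps_subst (\<lambda>c. fps_compose c (fps_X ^ k)) (fps_compose \<gamma> (fps_X ^ k)) (germ_ram n F)"
    by (rule rhom_fps_subst_comp[OF rhom_fps_compose rhom_id \<gamma>]) (use assms in auto)
  then show ?thesis
    using assms by (simp add: germ_ram_mult fps_subst_def)
qed

section \<open>The substitution x = base(t) + w t^a\<close>

text \<open>The coordinates (w, t) with y = t^n resolve the arcs that agree with a given arc below the exponent a/n: such
an arc becomes a power series in t with an arbitrary value at t = 0. Here the arc enters only
through its series in t; the condition a \<ge> 1 makes the substitution possible for all power series.\<close>

locale strip =
  fixes n a :: nat and base :: "complex fps"
  assumes n: "n \<ge> 1" and a: "a \<ge> 1" and base: "fps_nth base 0 = 0"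
begin

definition strip_coord :: "complex poly fps" where
  "strip_coord = emb base + fps_X ^ a * wvar"

definition pullback :: "complex fps fps \<Rightarrow> complex poly fps" where
  "pullback F = fps_subst emb strip_coord (germ_ram n F)"

lemma strip_coord_nth_0: "fps_nth strip_coord 0 = 0"
  using a base by (simp add: strip_coord_def)

lemma wder_strip_coord: "wder strip_coord = fps_X ^ a"
proof -
  have "wder wvar = 1" "wder (emb base) = 0"
    by (simp_all add: fps_eq_iff pderiv_pCons one_pCons)
  then show ?thesis
    by (simp add: strip_coord_def wder_add wder_X_power_mult)
qed

lemma rhom_strip_subst: "rhom (fps_subst emb strip_coord)"
  by (rule rhom_fps_subst[OF rhom_emb strip_coord_nth_0])

lemma rhom_pullback: "rhom pullback"
  unfolding pullback_def by (rule rhom_comp[OF rhom_strip_subst rhom_germ_ram[OF n]])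

lemma eval_at_pullback:
  assumes k: "k \<ge> 1"
  shows "eval_at \<epsilon> k (pullback F) = eval_germ (fps_compose base (fps_X ^ k) + fps_X ^ (a * k) * \<epsilon>) (germ_ram (n * k) F)"
proof -
  let ?V = "fps_compose base (fps_X ^ k) + fps_X ^ (a * k) * \<epsilon>"
  have V: "eval_at \<epsilon> k strip_coord = ?V"
    unfolding strip_coord_def rhom.add[OF rhom_eval_at[OF k]] rhom.mult[OF rhom_eval_at[OF k]]
      eval_at_emb[OF k] subst2_X_power[OF rhom_fps_const k] subst2_wvar[OF rhom_fps_const k]
    by (simp add: mult.commute)
  have "fps_nth ?V 0 = 0"
    using base a k by simp
  then have "eval_at \<epsilon> k (pullback F) = fps_subst (\<lambda>c. eval_at \<epsilon> k (emb c)) ?V (germ_ram n F)"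
    unfolding pullback_def using rhom_fps_subst_comp[OF rhom_eval_at[OF k] rhom_emb strip_coord_nth_0] V by simp
  also have "\<dots> = eval_germ ?V (germ_ram (n * k) F)"
    using n k by (simp add: eval_at_emb germ_ram_mult fps_subst_def)
  finally show ?thesis .
qed

lemma wder_pullback: "wder (pullback F) = fps_X ^ a * pullback (dx F)"
proof -
  have "wder (emb c) = emb ((\<lambda>_. 0) c)" for c
    by (simp add: fps_eq_iff pderiv_pCons)
  then have "wder (pullback F) = fps_subst emb strip_coord (fps_map (\<lambda>_. 0) (germ_ram n F)) + wder strip_coord * fps_subst emb strip_coord (fps_deriv (germ_ram n F))"
    unfolding pullback_def by (rule chain_rule[where D = wder and D0 = "\<lambda>_. 0", OF rhom_emb strip_coord_nth_0 wder_add wder_mult])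
  moreover have "fps_map (\<lambda>_. 0 :: complex fps) (germ_ram n F) = 0"
    by (simp add: fps_eq_iff)
  ultimately show ?thesis
    by (simp add: rhom.zero[OF rhom_strip_subst] wder_strip_coord pullback_def germ_ram_dx)
qed

lemma wder_pow_pullback: "(wder ^^ j) (pullback F) = fps_X ^ (a * j) * pullback ((dx ^^ j) F)"
  by (induction j) (simp_all add: wder_X_power_mult wder_pullback power_add mult_ac)

lemma tder_pullback: "fps_deriv (pullback F) = of_nat n * fps_X ^ (n - 1) * pullback (dy F) + fps_deriv strip_coord * pullback (dx F)"
proof -
  have emb_deriv: "fps_deriv (emb c) = emb (fps_deriv c)" for c
    by (simp add: fps_eq_iff of_nat_poly)
  have "fps_deriv (pullback F) = fps_subst emb strip_coord (fps_map fps_deriv (germ_ram n F)) + fps_deriv strip_coord * fps_subst emb strip_coord (fps_deriv (germ_ram n F))"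
    unfolding pullback_def
    by (rule chain_rule[where D = fps_deriv and D0 = fps_deriv, OF rhom_emb strip_coord_nth_0 fps_deriv_add _ emb_deriv])
       (simp add: algebra_simps)
  also have "fps_subst emb strip_coord (fps_map fps_deriv (germ_ram n F)) = emb (of_nat n * fps_X ^ (n - 1)) * pullback (dy F)"
    unfolding germ_ram_dy[OF n] fps_subst_const_mult[OF rhom_emb strip_coord_nth_0] pullback_def ..
  finally show ?thesis
    by (simp only: rhom.mult[OF rhom_emb] rhom.of_nat[OF rhom_emb] rhom.power[OF rhom_emb]
        fps_map_X[OF rhom_const_poly] germ_ram_dx pullback_def)
qed

text \<open>The Jacobian determinant of (w, t) \<mapsto> (x, y) is, up to sign, n t^(n - 1 + a).\<close>

lemma jacobian_pullback:
  "fps_deriv (pullback f) * wder (pullback g) - wder (pullback f) * fps_deriv (pullback g) = of_nat n * fps_X ^ (n - 1 + a) * pullback (jac f g)"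
  by (simp add: wder_pullback tder_pullback jac_def rhom.diff[OF rhom_pullback] rhom.mult[OF rhom_pullback] power_add algebra_simps)

text \<open>If the leading terms are \<phi> t^d1 and \<psi> t^d2, then t times the Jacobian starts with
(d1 \<phi> \<psi>' - d2 \<phi>' \<psi>) t^(d1 + d2). Since the same product is n t^(n + a) times the
pullback of J, the power t^(n + a) cancels.\<close>

lemma leading_form_jacobian:
  assumes F: "pullback f = fps_X ^ d1 * F1" and G: "pullback g = fps_X ^ d2 * G1"
    and nz: "of_nat d1 * fps_nth F1 0 * pderiv (fps_nth G1 0) - of_nat d2 * pderiv (fps_nth F1 0) * fps_nth G1 0 \<noteq> 0"
  shows "\<exists>d H. pullback (jac f g) = fps_X ^ d * H \<and>
    of_nat n * fps_nth H 0 = of_nat d1 * fps_nth F1 0 * pderiv (fps_nth G1 0) - of_nat d2 * pderiv (fps_nth F1 0) * fps_nth G1 0"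
proof -
  define Y where "Y = (of_nat d1 * F1 + fps_X * fps_deriv F1) * wder G1 - wder F1 * (of_nat d2 * G1 + fps_X * fps_deriv G1)"
  have Xd: "fps_X * fps_deriv (fps_X ^ d * F) = fps_X ^ d * (of_nat d * F + fps_X * fps_deriv F)"
    for d and F :: "complex poly fps"
  proof (cases d)
    case (Suc k)
    have "fps_deriv (fps_X ^ Suc k :: complex poly fps) = of_nat (Suc k) * fps_X ^ k"
      by (subst fps_deriv_power') simp
    then show ?thesis
      unfolding Suc fps_deriv_mult by (simp add: algebra_simps)
  qed simp
  have of_nat_nth: "fps_nth (of_nat k * F) 0 = of_nat k * fps_nth F 0" for k and F :: "complex poly fps"
    by (simp add: fps_of_nat[symmetric])
  have Y0: "fps_nth Y 0 = of_nat d1 * fps_nth F1 0 * pderiv (fps_nth G1 0) - of_nat d2 * pderiv (fps_nth F1 0) * fps_nth G1 0"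
    by (simp add: Y_def of_nat_nth)
  have "fps_X * (fps_deriv (pullback f) * wder (pullback g) - wder (pullback f) * fps_deriv (pullback g))
      = (fps_X * fps_deriv (pullback f)) * wder (pullback g) - wder (pullback f) * (fps_X * fps_deriv (pullback g))"
    by (simp add: algebra_simps)
  also have "\<dots> = fps_X ^ (d1 + d2) * Y"
    unfolding F G Xd wder_X_power_mult Y_def by (simp add: algebra_simps power_add)
  finally have eq: "fps_X ^ (d1 + d2) * Y = fps_X ^ Suc (n - 1 + a) * (of_nat n * pullback (jac f g))"
    unfolding jacobian_pullback by (simp add: algebra_simps)
  \<comment> \<open>Otherwise the right side would have order greater than d1 + d2, although Y does not vanish at t = 0.\<close>
  have "n + a \<le> d1 + d2"
  proof (rule ccontr)
    assume *: "\<not> n + a \<le> d1 + d2"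
    then have "fps_nth (fps_X ^ Suc (n - 1 + a) * (of_nat n * pullback (jac f g))) (d1 + d2) = 0"
      using n by (simp only: fps_X_power_mult_nth) simp
    moreover have "fps_nth (fps_X ^ (d1 + d2) * Y) (d1 + d2) = fps_nth Y 0"
      by (simp add: fps_X_power_mult_nth)
    ultimately show False
      using eq nz Y0 by simp
  qed
  then have "d1 + d2 = Suc (n - 1 + a) + (d1 + d2 - (n + a))"
    using n by simp
  then have "fps_X ^ Suc (n - 1 + a) * (fps_X ^ (d1 + d2 - (n + a)) * Y) = fps_X ^ Suc (n - 1 + a) * (of_nat n * pullback (jac f g))"
    using eq by (metis mult.assoc power_add)
  then have eq': "fps_X ^ (d1 + d2 - (n + a)) * Y = of_nat n * pullback (jac f g)"
    by simp
  define H where "H = fps_shift (d1 + d2 - (n + a)) (pullback (jac f g))"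
  have nth: "fps_nth (fps_X ^ (d1 + d2 - (n + a)) * Y) k = of_nat n * fps_nth (pullback (jac f g)) k" for k
    unfolding eq' by (simp add: fps_of_nat[symmetric])
  have "pullback (jac f g) = fps_X ^ (d1 + d2 - (n + a)) * H"
  proof (rule fps_ext)
    show "fps_nth (pullback (jac f g)) k = fps_nth (fps_X ^ (d1 + d2 - (n + a)) * H) k" for k
      using nth[of k] n by (simp add: H_def fps_X_power_mult_nth split: if_splits)
  qed
  moreover have "of_nat n * fps_nth H 0 = fps_nth Y 0"
    using nth[of "d1 + d2 - (n + a)"] by (simp add: H_def fps_X_power_mult_nth)
  ultimately show ?thesis
    using Y0 by (intro exI conjI) auto
qed

end

section \<open>Arcs and their ramification\<close>

lemma has_ram_mult:
  assumes "has_ram n \<gamma>" "k \<ge> 1"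
  shows "has_ram (n * k) \<gamma>"
  unfolding has_ram_def
proof (intro conjI allI impI)
  show "1 \<le> n * k"
    using assms by (simp add: has_ram_def)
  fix e assume "\<gamma> e \<noteq> 0"
  then obtain j :: nat where "e = real j / real n"
    using assms(1) by (auto simp: has_ram_def)
  then have "e = real (j * k) / real (n * k)"
    using assms by simp
  then show "\<exists>j::nat. e = real j / real (n * k)" ..
qed

lemma has_ram_ge_1: "has_ram n \<gamma> \<Longrightarrow> n \<ge> 1"
  by (simp add: has_ram_def)

lemma has_ram_ram: "frac_series \<gamma> \<Longrightarrow> has_ram (ram \<gamma>) \<gamma>"
  unfolding frac_series_def ram_def by (rule LeastI_ex)

lemma has_ram_diff: "has_ram n \<xi> \<Longrightarrow> has_ram n \<eta> \<Longrightarrow> has_ram n (\<lambda>e. \<xi> e - \<eta> e)"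
  unfolding has_ram_def by (metis diff_self)

lemma has_ram_cases:
  assumes "has_ram n \<gamma>"
  obtains "\<gamma> e = 0" | j :: nat where "e = real j / real n"
  using assms by (auto simp: has_ram_def)

lemma arc_ram_inject:
  assumes "has_ram n \<xi>" "has_ram n \<eta>" "arc_ram n \<xi> = arc_ram n \<eta>"
  shows "\<xi> = \<eta>"
proof
  fix e
  have eq: "\<xi> (real j / real n) = \<eta> (real j / real n)" for j :: nat
    using arg_cong[OF assms(3), of "\<lambda>F. fps_nth F j"] by (simp add: arc_ram_def)
  show "\<xi> e = \<eta> e"
    by (rule has_ram_cases[OF assms(1), of e]; rule has_ram_cases[OF assms(2), of e]) (auto simp: eq)
qed

lemma fps_compose_X_power_nth:
  fixes c :: "'a::comm_ring_1 fps"
  assumes "k \<ge> 1"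
  shows "fps_nth (fps_compose c (fps_X ^ k)) j = (if k dvd j then fps_nth c (j div k) else 0)"
proof -
  have "fps_nth (fps_compose c (fps_X ^ k)) j = (\<Sum>i=0..j. if j = k * i then fps_nth c i else 0)"
    by (simp add: fps_compose_nth power_mult[symmetric] if_distrib cong: if_cong)
  also have "\<dots> = (\<Sum>i\<in>(if k dvd j then {j div k} else {}). fps_nth c i)"
    using assms by (intro sum.mono_neutral_cong_right) (auto split: if_splits)
  finally show ?thesis by auto
qed

lemma arc_ram_mult:
  assumes \<gamma>: "has_ram n \<gamma>" and k: "k \<ge> 1"
  shows "arc_ram (n * k) \<gamma> = fps_compose (arc_ram n \<gamma>) (fps_X ^ k)"
proof (rule fps_ext)
  fix j
  have n: "n \<ge> 1" using \<gamma> by (rule has_ram_ge_1)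
  show "fps_nth (arc_ram (n * k) \<gamma>) j = fps_nth (fps_compose (arc_ram n \<gamma>) (fps_X ^ k)) j"
  proof (cases "k dvd j")
    case True
    then obtain i where "j = k * i" by (auto elim: dvdE)
    then show ?thesis
      using k by (simp add: fps_compose_X_power_nth arc_ram_def)
  next
    case False
    have "\<gamma> (real j / real (n * k)) = 0"
    proof (rule has_ram_cases[OF \<gamma>])
      fix i :: nat assume "real j / real (n * k) = real i / real n"
      then have "real j = real (i * k)"
        using n k by (simp add: field_simps)
      then have "j = i * k" by (simp only: of_nat_eq_iff)
      with False show ?thesis by simp
    qed
    with False k show ?thesis
      by (simp add: fps_compose_X_power_nth arc_ram_def)
  qed
qed

lemma arc_order_ge_iff: "arc_order \<gamma> \<ge> ereal h \<longleftrightarrow> (\<forall>e<h. \<gamma> e = 0)"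
  unfolding arc_order_def le_INF_iff by (auto simp: not_less[symmetric])

text \<open>The exponents of an arc lie in (1/n)N, so vanishing at all exponents up to h forces the order to be at
least the next element of (1/n)Z, which is strictly larger than h.\<close>

lemma arc_order_gt_iff:
  assumes \<gamma>: "has_ram n \<gamma>"
  shows "arc_order \<gamma> > ereal h \<longleftrightarrow> (\<forall>e\<le>h. \<gamma> e = 0)"
proof
  assume *: "arc_order \<gamma> > ereal h"
  show "\<forall>e\<le>h. \<gamma> e = 0"
  proof (intro allI impI, rule ccontr)
    fix e assume "e \<le> h" "\<gamma> e \<noteq> 0"
    then have "arc_order \<gamma> \<le> ereal e"
      unfolding arc_order_def by (intro INF_lower) simp
    also have "\<dots> \<le> ereal h" using \<open>e \<le> h\<close> by simp
    finally show False using * by simp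
  qed
next
  assume *: "\<forall>e\<le>h. \<gamma> e = 0"
  have n: "n \<ge> 1" using \<gamma> by (rule has_ram_ge_1)
  define h' where "h' = real_of_int (\<lfloor>real n * h\<rfloor> + 1) / real n"
  have "\<gamma> e = 0" if "e < h'" for e
  proof (rule has_ram_cases[OF \<gamma>, of e])
    fix j :: nat assume j: "e = real j / real n"
    then have "real j < real_of_int (\<lfloor>real n * h\<rfloor> + 1)"
      using that n by (simp add: h'_def divide_less_cancel)
    then have "int j \<le> \<lfloor>real n * h\<rfloor>" by linarith
    then have "real j \<le> real n * h" by linarith
    then have "e \<le> h" using j n by (simp add: divide_le_eq mult.commute)
    with * show ?thesis by blast
  qed
  then have "arc_order \<gamma> \<ge> ereal h'"
    by (simp add: arc_order_ge_iff)
  moreover have "h < h'"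
  proof -
    have "real n * h < real_of_int (\<lfloor>real n * h\<rfloor> + 1)" by linarith
    then show ?thesis using n by (simp add: h'_def field_simps)
  qed
  ultimately show "arc_order \<gamma> > ereal h"
    by (meson less_le_trans ereal_less_eq(3) less_ereal.simps(1))
qed

lemma arc_order_pos_iff: "has_ram n \<gamma> \<Longrightarrow> arc_order \<gamma> > 0 \<longleftrightarrow> \<gamma> 0 = 0"
  using arc_order_gt_iff[of n \<gamma> 0] by (auto simp: has_ram_def zero_ereal_def) (metis divide_nonneg_nonneg of_nat_0_le_iff order_antisym)

text \<open>F(\<gamma>(y), y) as a series in t for an arbitrary common denominator n of the exponents, not only the
smallest one; several arcs can then be treated at once.\<close>

definition germ_along :: "nat \<Rightarrow> complex fps fps \<Rightarrow> arc \<Rightarrow> complex fps" where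
  "germ_along n F \<gamma> = eval_germ (arc_ram n \<gamma>) (germ_ram n F)"

lemma arc_ram_nth_0: "fps_nth (arc_ram n \<gamma>) 0 = \<gamma> 0"
  by (simp add: arc_ram_def)

lemma germ_along_mult:
  assumes "has_ram n \<gamma>" "\<gamma> 0 = 0" "k \<ge> 1"
  shows "germ_along (n * k) F \<gamma> = fps_compose (germ_along n F \<gamma>) (fps_X ^ k)"
  unfolding germ_along_def arc_ram_mult[OF assms(1,3)]
  by (rule eval_germ_ram_mult) (use assms has_ram_ge_1 in \<open>auto simp: arc_ram_nth_0\<close>)

lemma germ_along_eq_0_iff_mult:
  assumes "has_ram n \<gamma>" "\<gamma> 0 = 0" "k \<ge> 1"
  shows "germ_along (n * k) F \<gamma> = 0 \<longleftrightarrow> germ_along n F \<gamma> = 0"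
  using assms by (simp add: germ_along_mult fps_compose_eq_0_iff)

lemma germ_along_eq_0_iff:
  assumes "has_ram n \<gamma>" "has_ram m \<gamma>" "\<gamma> 0 = 0"
  shows "germ_along n F \<gamma> = 0 \<longleftrightarrow> germ_along m F \<gamma> = 0"
  using germ_along_eq_0_iff_mult[of n \<gamma> m F] germ_along_eq_0_iff_mult[of m \<gamma> n F] assms has_ram_ge_1
  by (simp add: mult.commute)

lemma subdegree_germ_along:
  assumes "has_ram n \<gamma>" "has_ram m \<gamma>" "\<gamma> 0 = 0"
  shows "real (subdegree (germ_along n F \<gamma>)) / real n = real (subdegree (germ_along m F \<gamma>)) / real m"
proof -
  have "n \<ge> 1" "m \<ge> 1"
    using assms by (auto dest: has_ram_ge_1)
  then have "m * subdegree (germ_along n F \<gamma>) = subdegree (germ_along (n * m) F \<gamma>)"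
      "n * subdegree (germ_along m F \<gamma>) = subdegree (germ_along (m * n) F \<gamma>)"
    using assms by (simp_all add: germ_along_mult fps_X_power_subdegree)
  then have "real m * real (subdegree (germ_along n F \<gamma>)) = real n * real (subdegree (germ_along m F \<gamma>))"
    by (metis mult.commute of_nat_mult)
  then show ?thesis
    using assms(1,2)[THEN has_ram_ge_1] by (simp add: field_simps)
qed

text \<open>For an arc without constant term the series over i that defines the substitution is a finite sum.\<close>

lemma subst_arc_eq:
  assumes "\<gamma> 0 = 0"
  shows "subst_arc F \<gamma> = germ_along (ram \<gamma>) F \<gamma>"
proof (rule fps_ext)
  fix k
  let ?t = "\<lambda>i. fps_nth (fps_nth (germ_ram (ram \<gamma>) F) i * arc_ram (ram \<gamma>) \<gamma> ^ i) k"
  have "?t i = 0" if "i \<notin> {..k}" for i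
    using that assms by (intro fps_mult_power_nth_eq_0) (auto simp: arc_ram_nth_0)
  then have "suminf ?t = sum ?t {..k}"
    by (intro suminf_finite) auto
  then show "fps_nth (subst_arc F \<gamma>) k = fps_nth (germ_along (ram \<gamma>) F \<gamma>) k"
    by (simp add: subst_arc_def germ_along_def fps_subst_def)
qed

lemma subst_arc_eq_0_iff:
  assumes "has_ram n \<gamma>" "\<gamma> 0 = 0"
  shows "subst_arc F \<gamma> = 0 \<longleftrightarrow> germ_along n F \<gamma> = 0"
proof -
  have "has_ram (ram \<gamma>) \<gamma>"
    by (rule has_ram_ram) (use assms in \<open>auto simp: frac_series_def\<close>)
  then show ?thesis
    using germ_along_eq_0_iff[of "ram \<gamma>" \<gamma> n F] assms by (simp add: subst_arc_eq)
qed

lemma order_along_eq: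
  assumes "has_ram n \<gamma>" "\<gamma> 0 = 0" "germ_along n F \<gamma> \<noteq> 0"
  shows "order_along F \<gamma> = ereal (real (subdegree (germ_along n F \<gamma>)) / real n)"
proof -
  have "has_ram (ram \<gamma>) \<gamma>"
    by (rule has_ram_ram) (use assms in \<open>auto simp: frac_series_def\<close>)
  then show ?thesis
    using subst_arc_eq_0_iff[OF assms(1,2), of F] subdegree_germ_along[OF assms(1) _ assms(2), of "ram \<gamma>" F] assms(2,3)
    by (simp add: order_along_def subst_arc_eq)
qed

lemma root_mult_eqI:
  assumes n: "has_ram n \<gamma>" and \<gamma>0: "\<gamma> 0 = 0"
    and c: "\<And>l. (\<forall>j<l. germ_along n ((dx ^^ j) F) \<gamma> = 0) \<longleftrightarrow> l \<le> c"
  shows "root_mult F \<gamma> = c"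
proof -
  have r: "has_ram (ram \<gamma>) \<gamma>"
    by (rule has_ram_ram) (use n in \<open>auto simp: frac_series_def\<close>)
  have "(fps_X - fps_const (arc_ram (ram \<gamma>) \<gamma>)) ^ l dvd germ_ram (ram \<gamma>) F \<longleftrightarrow> l \<le> c" for l
    by (subst germ_root_power_dvd_iff)
       (simp_all add: arc_ram_nth_0 \<gamma>0 germ_ram_dx_pow[symmetric] germ_along_def[symmetric]
          germ_along_eq_0_iff[OF r n \<gamma>0] c)
  then have "root_mult F \<gamma> = Max {..c}"
    by (simp add: root_mult_def atMost_def)
  also have "Max {..c} = c"
    by (rule Max_eqI) auto
  finally show ?thesis .
qed

section \<open>Counting roots over a strip\<close>

text \<open>The bars of positive height are of this kind, with b the common part of the roots on the bar and
n a common denominator; so are the thin strips around the zero arc that are used for the ground bar.\<close>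

locale arc_strip =
  fixes n a :: nat and b :: arc
  assumes b: "has_ram n b" and a: "a \<ge> 1" and b_high: "\<And>e. e \<ge> real a / real n \<Longrightarrow> b e = 0" and b0: "b 0 = 0"
begin

lemma n: "n \<ge> 1"
  using b by (rule has_ram_ge_1)

sublocale strip n a "arc_ram n b"
  by unfold_locales (use n a b0 in \<open>auto simp: arc_ram_nth_0\<close>)

abbreviation h :: real where "h \<equiv> real a / real n"

lemma h_pos: "h > 0"
  using n a by simp

lemma arc_ram_over_strip:
  assumes \<gamma>: "has_ram (n * k) \<gamma>" "\<forall>e<h. \<gamma> e = b e"
  shows "arc_ram (n * k) \<gamma> = fps_compose (arc_ram n b) (fps_X ^ k) + fps_X ^ (a * k) * Abs_fps (\<lambda>j. \<gamma> (h + real j / real (n * k)))"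
    (is "_ = ?r")
proof (rule fps_ext)
  fix j
  have nk: "n * k \<ge> 1" using \<gamma>(1) by (rule has_ram_ge_1)
  then have k: "k \<ge> 1" by simp
  have "h = real (a * k) / real (n * k)"
    using k by simp
  then have "h + real (j - a * k) / real (n * k) = real j / real (n * k)" if "j \<ge> a * k"
    using that by (metis \<open>h = _\<close> add_divide_distrib le_add_diff_inverse of_nat_add)
  moreover have "real j / real (n * k) < h \<longleftrightarrow> j < a * k"
    unfolding \<open>h = _\<close> using nk by (simp add: divide_less_cancel del: of_nat_mult)
  ultimately show "fps_nth (arc_ram (n * k) \<gamma>) j = fps_nth ?r j"
    unfolding arc_ram_mult[OF b k, symmetric]
    using \<gamma>(2) b_high[of "real j / real (n * k)"]
    by (auto simp: arc_ram_def fps_X_power_mult_nth not_less)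
qed

lemma over_strip_nth_0:
  "\<forall>e<h. \<gamma> e = b e \<Longrightarrow> \<gamma> 0 = 0"
  using h_pos b0 by simp

lemma germ_along_over_strip:
  assumes \<gamma>: "has_ram (n * k) \<gamma>" "\<forall>e<h. \<gamma> e = b e"
  shows "germ_along (n * k) F \<gamma> = eval_at (Abs_fps (\<lambda>j. \<gamma> (h + real j / real (n * k)))) k (pullback F)"
proof -
  have k: "k \<ge> 1" using has_ram_ge_1[OF \<gamma>(1)] by simp
  show ?thesis
    unfolding germ_along_def arc_ram_over_strip[OF \<gamma>] eval_at_pullback[OF k] ..
qed

text \<open>The \<delta>_i of the Newton-Puiseux factorisation of H are turned into arcs \<gamma>r i. For an arc \<gamma> through z one
passes to a common ramification N of \<gamma> and all \<gamma>r i; there the derivatives of F along \<gamma> are, up to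
powers of t, the w-derivatives of H, and their vanishing counts the i with \<gamma>r i = \<gamma>.\<close>

theorem root_count_over_strip:
  fixes F :: "complex fps fps" and z :: complex
  assumes H: "pullback F = fps_X ^ d * H" "fps_nth H 0 \<noteq> 0"
  defines "\<Gamma> \<equiv> {\<gamma>. frac_series \<gamma> \<and> (\<forall>e<h. \<gamma> e = b e) \<and> \<gamma> h = z \<and> subst_arc F \<gamma> = 0}"
  shows "finite \<Gamma>" and "(\<Sum>\<gamma>\<in>\<Gamma>. root_mult F \<gamma>) = order z (fps_nth H 0)"
    and "\<And>\<gamma>. \<gamma> \<in> \<Gamma> \<Longrightarrow> root_mult F \<gamma> > 0"
proof -
  define m where "m = order z (fps_nth H 0)"
  obtain n1 \<delta> G where n1: "n1 \<ge> 1" and \<delta>0: "\<And>i. i < m \<Longrightarrow> fps_nth (\<delta> i) 0 = z"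
    and G: "fps_compose H (fps_X ^ n1) = (\<Prod>i<m. wvar - emb (\<delta> i)) * G" "poly (fps_nth G 0) z \<noteq> 0"
    using puiseux_factorisation[OF H(2), of z] unfolding m_def[symmetric] by blast
  let ?N = "n * n1"
  have N: "?N \<ge> 1" using n n1 by simp
  \<comment> \<open>Below the height copy b; from the height on read off the coefficients of the i-th Puiseux root.\<close>
  define \<gamma>r where "\<gamma>r i = (\<lambda>e. if e < h then b e else if \<exists>j::nat. e = h + real j / real ?N
      then fps_nth (\<delta> i) (THE j. e = h + real j / real ?N) else 0)" for i
  have \<gamma>r_high: "\<gamma>r i (h + real j / real ?N) = fps_nth (\<delta> i) j" for i j
  proof -
    have "h + real j / real ?N = h + real j' / real ?N \<longleftrightarrow> j' = j" for j'
      using N by (auto simp: divide_eq_eq)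
    moreover have "\<not> real j / (real n * real n1) < 0"
      by (simp add: not_less)
    ultimately show ?thesis
      unfolding \<gamma>r_def by auto
  qed
  have h_eq: "h = real (a * n1) / real ?N"
    using n1 by simp
  have bN: "has_ram ?N b"
    by (rule has_ram_mult[OF b n1])
  have \<gamma>r_ram: "has_ram ?N (\<gamma>r i)" for i
    unfolding has_ram_def
  proof (intro conjI allI impI N)
    fix e assume e: "\<gamma>r i e \<noteq> 0"
    show "\<exists>j::nat. e = real j / real ?N"
    proof (cases "e < h")
      case True
      then show ?thesis using e bN by (auto simp: \<gamma>r_def has_ram_def)
    next
      case False
      then obtain j :: nat where "e = h + real j / real ?N"
        using e by (auto simp: \<gamma>r_def split: if_splits)
      then have "e = real (a * n1 + j) / real ?N"
        by (simp only: h_eq of_nat_add add_divide_distrib)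
      then show ?thesis ..
    qed
  qed
  have \<gamma>r_low: "\<forall>e<h. \<gamma>r i e = b e" for i
    by (simp add: \<gamma>r_def)
  have \<gamma>r_h: "\<gamma>r i h = z" if "i < m" for i
    using \<gamma>r_high[of i 0] \<delta>0[OF that] by simp
  have \<gamma>r_eps: "Abs_fps (\<lambda>j. \<gamma>r i (h + real j / real ?N)) = \<delta> i" for i
    by (simp only: \<gamma>r_high fps_nth_inverse)
  have main: "(\<forall>j<l. germ_along N ((dx ^^ j) F) \<gamma> = 0) \<longleftrightarrow> l \<le> card {i. i < m \<and> \<gamma>r i = \<gamma>}"
    if \<gamma>: "has_ram N \<gamma>" "\<forall>e<h. \<gamma> e = b e" "\<gamma> h = z" and N': "N = ?N * s" "s \<ge> 1" for \<gamma> l s N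
  proof -
    define k where "k = n1 * s"
    have k: "k \<ge> 1" and Nk: "N = n * k"
      using n1 N' by (auto simp: k_def)
    define \<epsilon> where "\<epsilon> = Abs_fps (\<lambda>j. \<gamma> (h + real j / real (n * k)))"
    define \<delta>' where "\<delta>' i = fps_compose (\<delta> i) (fps_X ^ s)" for i
    have \<epsilon>0: "fps_nth \<epsilon> 0 = z"
      using \<gamma>(3) by (simp add: \<epsilon>_def)
    have arcs: "\<gamma>r i = \<gamma> \<longleftrightarrow> \<delta>' i = \<epsilon>" for i
    proof -
      have "arc_ram (n * k) (\<gamma>r i) = fps_compose (arc_ram ?N (\<gamma>r i)) (fps_X ^ s)"
        using arc_ram_mult[OF \<gamma>r_ram N'(2), of i] by (simp add: k_def mult.assoc)
      also have "\<dots> = fps_compose (fps_compose (arc_ram n b) (fps_X ^ n1)) (fps_X ^ s)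
          + fps_compose (fps_X ^ (a * n1)) (fps_X ^ s) * \<delta>' i"
        unfolding arc_ram_over_strip[OF \<gamma>r_ram \<gamma>r_low] \<gamma>r_eps fps_compose_add_distrib \<delta>'_def
        using N'(2) by (simp add: fps_compose_mult_distrib)
      also have "fps_compose (fps_X ^ (a * n1)) (fps_X ^ s) = (fps_X ^ (a * k) :: complex fps)"
        using N'(2) by (subst fps_X_power_compose) (auto simp: k_def power_mult[symmetric] mult_ac)
      also have "fps_compose (fps_compose (arc_ram n b) (fps_X ^ n1)) (fps_X ^ s) = fps_compose (arc_ram n b) (fps_X ^ k)"
        unfolding k_def by (rule fps_compose_X_power_twice[OF N'(2) n1])
      finally have 1: "arc_ram (n * k) (\<gamma>r i) = fps_compose (arc_ram n b) (fps_X ^ k) + fps_X ^ (a * k) * \<delta>' i" .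
      have 2: "arc_ram (n * k) \<gamma> = fps_compose (arc_ram n b) (fps_X ^ k) + fps_X ^ (a * k) * \<epsilon>"
        unfolding \<epsilon>_def using arc_ram_over_strip[of k \<gamma>] \<gamma> Nk by simp
      have "has_ram (n * k) (\<gamma>r i)" "has_ram (n * k) \<gamma>"
        using has_ram_mult[OF \<gamma>r_ram N'(2), of i] \<gamma>(1) Nk by (simp_all add: k_def mult.assoc)
      then have "\<gamma>r i = \<gamma> \<longleftrightarrow> arc_ram (n * k) (\<gamma>r i) = arc_ram (n * k) \<gamma>"
        using arc_ram_inject by blast
      also have "\<dots> \<longleftrightarrow> \<delta>' i = \<epsilon>"
        unfolding 1 2 by simp
      finally show ?thesis .
    qed
    have X: "fps_nth (fps_X ^ s :: complex poly fps) 0 = 0"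
      using N'(2) by simp
    have "fps_compose H (fps_X ^ k) = fps_compose (fps_compose H (fps_X ^ n1)) (fps_X ^ s)"
      unfolding k_def by (rule fps_compose_X_power_twice[OF N'(2) n1, symmetric])
    also have "\<dots> = (\<Prod>i<m. wvar - emb (\<delta>' i)) * fps_compose G (fps_X ^ s)"
      unfolding G(1) fps_compose_mult_distrib[OF X] fps_compose_prod_distrib[OF X]
        fps_compose_sub_distrib emb_compose_X_power \<delta>'_def by simp
    finally have Hk: "fps_compose H (fps_X ^ k) = (\<Prod>i<m. wvar - emb (\<delta>' i)) * fps_compose G (fps_X ^ s)" .
    have Gz: "poly (fps_nth (fps_compose G (fps_X ^ s)) 0) (fps_nth \<epsilon> 0) \<noteq> 0"
      using G(2) by (simp add: \<epsilon>0)
    have "germ_along N ((dx ^^ j) F) \<gamma> = 0 \<longleftrightarrow> eval_at \<epsilon> 1 ((wder ^^ j) (fps_compose H (fps_X ^ k))) = 0" for j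
    proof -
      have comm: "(wder ^^ j) (fps_compose H (fps_X ^ k)) = fps_compose ((wder ^^ j) H) (fps_X ^ k)"
        using k by (simp add: fps_eq_iff wder_pow_nth fps_compose_X_power_nth)
      have "fps_X ^ (k * (a * j)) * germ_along (n * k) ((dx ^^ j) F) \<gamma> = eval_at \<epsilon> k (fps_X ^ (a * j) * pullback ((dx ^^ j) F))"
        using germ_along_over_strip[of k \<gamma>] \<gamma> Nk
        by (simp add: rhom.mult[OF rhom_eval_at[OF k]] subst2_X_power[OF rhom_fps_const k] \<epsilon>_def)
      also have "\<dots> = eval_at \<epsilon> k ((wder ^^ j) (fps_X ^ d * H))"
        by (simp only: wder_pow_pullback[symmetric] H(1))
      also have "\<dots> = fps_X ^ (k * d) * eval_at \<epsilon> k ((wder ^^ j) H)"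
        by (simp only: wder_pow_X_power_mult rhom.mult[OF rhom_eval_at[OF k]] subst2_X_power[OF rhom_fps_const k])
      also have "eval_at \<epsilon> k ((wder ^^ j) H) = eval_at \<epsilon> 1 ((wder ^^ j) (fps_compose H (fps_X ^ k)))"
        unfolding comm using eval_at_base_change[OF k, of 1] by simp
      finally have *: "fps_X ^ (k * (a * j)) * germ_along (n * k) ((dx ^^ j) F) \<gamma>
          = fps_X ^ (k * d) * eval_at \<epsilon> 1 ((wder ^^ j) (fps_compose H (fps_X ^ k)))" .
      have nz: "fps_X ^ i * c = 0 \<longleftrightarrow> c = 0" for i and c :: "complex fps"
        by simp
      show ?thesis
        unfolding Nk by (metis * nz)
    qed
    then show ?thesis
      unfolding arcs using multiplicity_in_product[OF Gz, where l = l and m = m and \<delta> = \<delta>'] Hk by simp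
  qed
  have count: "root_mult F \<gamma> = card {i. i < m \<and> \<gamma>r i = \<gamma>}"
      "subst_arc F \<gamma> = 0 \<longleftrightarrow> 0 < card {i. i < m \<and> \<gamma>r i = \<gamma>}"
    if \<gamma>: "frac_series \<gamma>" "\<forall>e<h. \<gamma> e = b e" "\<gamma> h = z" for \<gamma>
  proof -
    have \<gamma>0: "\<gamma> 0 = 0"
      by (rule over_strip_nth_0[OF \<gamma>(2)])
    have r: "has_ram (ram \<gamma>) \<gamma>" by (rule has_ram_ram[OF \<gamma>(1)])
    then have rN: "has_ram (?N * ram \<gamma>) \<gamma>"
      using has_ram_mult[OF r N] by (simp add: mult.commute)
    note m' = main[OF rN \<gamma>(2,3) refl has_ram_ge_1[OF r]]
    show "root_mult F \<gamma> = card {i. i < m \<and> \<gamma>r i = \<gamma>}"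
      by (rule root_mult_eqI[OF rN \<gamma>0 m'])
    show "subst_arc F \<gamma> = 0 \<longleftrightarrow> 0 < card {i. i < m \<and> \<gamma>r i = \<gamma>}"
      unfolding subst_arc_eq_0_iff[OF rN \<gamma>0] using m'[of 1] by auto
  qed
  have \<Gamma>: "\<Gamma> = \<gamma>r ` {..<m}"
  proof (intro equalityI subsetI)
    fix \<gamma> assume "\<gamma> \<in> \<Gamma>"
    then have "0 < card {i. i < m \<and> \<gamma>r i = \<gamma>}"
      using count(2)[of \<gamma>] by (simp add: \<Gamma>_def)
    then have "{i. i < m \<and> \<gamma>r i = \<gamma>} \<noteq> {}"
      by (metis card.empty less_irrefl)
    then show "\<gamma> \<in> \<gamma>r ` {..<m}" by auto
  next
    fix \<gamma> assume "\<gamma> \<in> \<gamma>r ` {..<m}"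
    then obtain i where i: "i < m" "\<gamma> = \<gamma>r i" by auto
    have "frac_series (\<gamma>r i)"
      using \<gamma>r_ram unfolding frac_series_def by blast
    moreover have "0 < card {i'. i' < m \<and> \<gamma>r i' = \<gamma>r i}"
      using i by (auto simp: card_gt_0_iff)
    ultimately show "\<gamma> \<in> \<Gamma>"
      using count(2)[of "\<gamma>r i"] \<gamma>r_low \<gamma>r_h i by (simp add: \<Gamma>_def)
  qed
  show "finite \<Gamma>" unfolding \<Gamma> by simp
  show "0 < root_mult F \<gamma>" if "\<gamma> \<in> \<Gamma>" for \<gamma>
    using that count[of \<gamma>] by (auto simp: \<Gamma>_def)
  have "(\<Sum>\<gamma>\<in>\<Gamma>. root_mult F \<gamma>) = (\<Sum>\<gamma>\<in>\<Gamma>. \<Sum>i\<in>{i\<in>{..<m}. \<gamma>r i = \<gamma>}. 1)"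
    by (intro sum.cong refl) (use count(1) in \<open>auto simp: \<Gamma>_def\<close>)
  also have "\<dots> = (\<Sum>i\<in>{..<m}. 1)"
    unfolding \<Gamma> by (rule sum.image_gen[symmetric]) simp
  finally show "(\<Sum>\<gamma>\<in>\<Gamma>. root_mult F \<gamma>) = order z (fps_nth H 0)"
    by (simp add: m_def)
qed

end

section \<open>Germs with simple Newton-Puiseux roots\<close>

text \<open>A Newton-Puiseux factorisation for a fixed n, with pairwise distinct roots collected in a set. Unlike the
existentially quantified n of \<open>np_factorisation\<close>, the n can be made common to f, g and further arcs.\<close>

definition factors_over :: "complex fps fps \<Rightarrow> complex fps fps \<Rightarrow> nat \<Rightarrow> arc set \<Rightarrow> nat \<Rightarrow> bool" where
  "factors_over F u E S n \<longleftrightarrow> finite S \<and> n \<ge> 1 \<and> (\<forall>\<xi>\<in>S. has_ram n \<xi> \<and> \<xi> 0 = 0) \<and>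
     germ_ram n F = germ_ram n u * fps_const (fps_X ^ (n * E)) * (\<Prod>\<xi>\<in>S. fps_X - fps_const (arc_ram n \<xi>))"

lemma np_factorisation_factors_over:
  assumes np: "np_factorisation F u E m \<rho>" and inj: "inj_on \<rho> {1..m}"
  shows "\<exists>n. factors_over F u E (\<rho> ` {1..m}) n"
proof -
  obtain n where n: "n \<ge> 1" "\<forall>i\<in>{1..m}. has_ram n (\<rho> i)"
    and F: "germ_ram n F = germ_ram n u * fps_const (fps_X ^ (n * E)) * (\<Prod>i=1..m. fps_X - fps_const (arc_ram n (\<rho> i)))"
    using np unfolding np_factorisation_def by blast
  have "\<forall>i\<in>{1..m}. \<rho> i 0 = 0"
    using np n(2) arc_order_pos_iff unfolding np_factorisation_def by blast
  moreover have "(\<Prod>\<xi>\<in>\<rho> ` {1..m}. fps_X - fps_const (arc_ram n \<xi>)) = (\<Prod>i=1..m. fps_X - fps_const (arc_ram n (\<rho> i)))"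
    using inj by (rule prod.reindex[unfolded o_def])
  ultimately show ?thesis
    using n F by (intro exI[of _ n]) (auto simp: factors_over_def)
qed

lemma factors_over_mult:
  assumes F: "factors_over F u E S n" and k: "k \<ge> 1"
  shows "factors_over F u E S (n * k)"
proof -
  have n: "n \<ge> 1" using F by (simp add: factors_over_def)
  let ?c = "\<lambda>c. fps_compose c (fps_X ^ k) :: complex fps"
  have c: "rhom ?c"
    by (rule rhom_fps_compose) (use k in simp)
  have X: "?c (fps_X ^ j) = fps_X ^ (k * j)" for j
    using k by (subst fps_X_power_compose) (auto simp: power_mult)
  have "germ_ram (n * k) F = fps_map ?c (germ_ram n u * fps_const (fps_X ^ (n * E)) * (\<Prod>\<xi>\<in>S. fps_X - fps_const (arc_ram n \<xi>)))"
    using F by (simp add: germ_ram_mult[OF n k] factors_over_def)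
  also have "\<dots> = germ_ram (n * k) u * fps_const (fps_X ^ (k * (n * E))) * (\<Prod>\<xi>\<in>S. fps_X - fps_const (?c (arc_ram n \<xi>)))"
    by (simp only: rhom.mult[OF rhom_fps_map[OF c]] rhom.prod[OF rhom_fps_map[OF c]] rhom.diff[OF rhom_fps_map[OF c]]
        fps_map_X[OF c] fps_map_const[OF c] X germ_ram_mult[OF n k, symmetric])
  also have "(\<Prod>\<xi>\<in>S. fps_X - fps_const (?c (arc_ram n \<xi>))) = (\<Prod>\<xi>\<in>S. fps_X - fps_const (arc_ram (n * k) \<xi>))"
    using F k by (intro prod.cong refl) (simp add: arc_ram_mult factors_over_def)
  finally have "germ_ram (n * k) F = germ_ram (n * k) u * fps_const (fps_X ^ (n * k * E)) * (\<Prod>\<xi>\<in>S. fps_X - fps_const (arc_ram (n * k) \<xi>))"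
    by (simp only: mult.assoc mult.left_commute)
  then show ?thesis
    using F k has_ram_mult[OF _ k] by (auto simp: factors_over_def)
qed

lemma germ_along_factors:
  assumes F: "factors_over F u E S n" and \<gamma>: "\<gamma> 0 = 0"
  shows "germ_along n F \<gamma> = germ_along n u \<gamma> * fps_X ^ (n * E) * (\<Prod>\<xi>\<in>S. arc_ram n \<gamma> - arc_ram n \<xi>)"
proof -
  have "fps_nth (arc_ram n \<gamma>) 0 = 0"
    using \<gamma> by (simp add: arc_ram_nth_0)
  note e = rhom_fps_subst[OF rhom_id this] fps_subst_X[OF rhom_id this] fps_subst_const[OF rhom_id this]
  show ?thesis
    using F unfolding factors_over_def germ_along_def
    by (simp add: rhom.mult[OF e(1)] rhom.prod[OF e(1)] rhom.diff[OF e(1)] e(2,3))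
qed

lemma germ_along_nth_0: "fps_nth (germ_along n F \<gamma>) 0 = germ_at_O F" if "\<gamma> 0 = 0"
  using that by (simp add: germ_along_def fps_subst_nth_0 arc_ram_nth_0 germ_ram_eq germ_at_O_def)

lemma germ_along_eq_0_iff_root:
  assumes F: "factors_over F u E S n" and u: "germ_at_O u \<noteq> 0" and \<gamma>: "has_ram n \<gamma>" "\<gamma> 0 = 0"
  shows "germ_along n F \<gamma> = 0 \<longleftrightarrow> \<gamma> \<in> S"
proof -
  have "germ_along n u \<gamma> \<noteq> 0"
    using germ_along_nth_0[of \<gamma>, OF \<gamma>(2), of n u] u by auto
  then have "germ_along n F \<gamma> = 0 \<longleftrightarrow> (\<exists>\<xi>\<in>S. arc_ram n \<gamma> = arc_ram n \<xi>)"
    using F by (simp add: germ_along_factors[OF F, of \<gamma>, OF \<gamma>(2)] factors_over_def)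
  also have "\<dots> \<longleftrightarrow> \<gamma> \<in> S"
    using F \<gamma>(1) arc_ram_inject unfolding factors_over_def by blast
  finally show ?thesis .
qed

text \<open>The roots are pairwise distinct, so each of them is simple.\<close>

lemma germ_along_dx_root_neq_0:
  assumes F: "factors_over F u E S n" and u: "germ_at_O u \<noteq> 0" and \<gamma>: "\<gamma> \<in> S"
  shows "germ_along n (dx F) \<gamma> \<noteq> 0"
proof -
  have ram: "has_ram n \<gamma>" "\<gamma> 0 = 0" and S: "finite S" "\<forall>\<xi>\<in>S. has_ram n \<xi>"
    using F \<gamma> by (auto simp: factors_over_def)
  have c0: "fps_nth (arc_ram n \<gamma>) 0 = 0"
    using ram by (simp add: arc_ram_nth_0)
  note e = rhom_fps_subst[OF rhom_id c0] fps_subst_X[OF rhom_id c0] fps_subst_const[OF rhom_id c0]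
  define R where "R = germ_ram n u * fps_const (fps_X ^ (n * E)) * (\<Prod>\<xi>\<in>S - {\<gamma>}. fps_X - fps_const (arc_ram n \<xi>))"
  have FR: "germ_ram n F = (fps_X - fps_const (arc_ram n \<gamma>)) * R"
    using F S(1) \<gamma> by (simp add: factors_over_def R_def prod.remove mult_ac)
  have "germ_along n (dx F) \<gamma> = eval_germ (arc_ram n \<gamma>) (R + (fps_X - fps_const (arc_ram n \<gamma>)) * fps_deriv R)"
    unfolding germ_along_def germ_ram_dx FR by (simp add: algebra_simps)
  also have "\<dots> = eval_germ (arc_ram n \<gamma>) R"
    by (simp only: rhom.add[OF e(1)] rhom.mult[OF e(1)] rhom.diff[OF e(1)] e(2,3)) simp
  also have "\<dots> = germ_along n u \<gamma> * fps_X ^ (n * E) * (\<Prod>\<xi>\<in>S - {\<gamma>}. arc_ram n \<gamma> - arc_ram n \<xi>)"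
    unfolding R_def germ_along_def
    by (simp only: rhom.mult[OF e(1)] rhom.prod[OF e(1)] rhom.diff[OF e(1)] e(2,3))
  also have "\<dots> \<noteq> 0"
  proof -
    have "germ_along n u \<gamma> \<noteq> 0"
      using germ_along_nth_0[of \<gamma>, OF ram(2), of n u] u by auto
    moreover have "arc_ram n \<gamma> - arc_ram n \<xi> \<noteq> 0" if "\<xi> \<in> S - {\<gamma>}" for \<xi>
      using arc_ram_inject[OF ram(1), of \<xi>] S that by auto
    ultimately show ?thesis
      using S(1) by auto
  qed
  finally show ?thesis .
qed

lemma deriv_germ_along:
  assumes n: "n \<ge> 1" and \<gamma>: "\<gamma> 0 = 0"
  shows "fps_deriv (germ_along n F \<gamma>) = of_nat n * fps_X ^ (n - 1) * germ_along n (dy F) \<gamma> + fps_deriv (arc_ram n \<gamma>) * germ_along n (dx F) \<gamma>"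
proof -
  have c0: "fps_nth (arc_ram n \<gamma>) 0 = 0"
    using \<gamma> by (simp add: arc_ram_nth_0)
  have "fps_deriv (germ_along n F \<gamma>) = eval_germ (arc_ram n \<gamma>) (fps_map fps_deriv (germ_ram n F)) + fps_deriv (arc_ram n \<gamma>) * eval_germ (arc_ram n \<gamma>) (fps_deriv (germ_ram n F))"
    unfolding germ_along_def
    by (rule chain_rule[where D = fps_deriv and D0 = fps_deriv, OF rhom_id c0 fps_deriv_add _ refl]) (simp add: algebra_simps)
  then show ?thesis
    by (simp only: germ_ram_dy[OF n] fps_subst_const_mult[OF rhom_id c0] germ_along_def germ_ram_dx)
qed

text \<open>Differentiating f(\<gamma>(t), t^n) = 0 expresses f_y through f_x along \<gamma>. Then J along \<gamma> is a multiple of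
f_x times the derivative of g(\<gamma>(t), t^n), so the latter vanishes; g being zero at the origin, g is
zero along \<gamma>.\<close>

lemma jacobian_root_common:
  assumes n: "n \<ge> 1" and \<gamma>: "\<gamma> 0 = 0" and f: "germ_along n f \<gamma> = 0" and fx: "germ_along n (dx f) \<gamma> \<noteq> 0"
    and J: "germ_along n (jac f g) \<gamma> = 0" and g: "germ_at_O g = 0"
  shows "germ_along n g \<gamma> = 0"
proof -
  have c0: "fps_nth (arc_ram n \<gamma>) 0 = 0"
    using \<gamma> by (simp add: arc_ram_nth_0)
  have e: "rhom (\<lambda>F. germ_along n F \<gamma>)"
    unfolding germ_along_def by (rule rhom_comp[OF rhom_fps_subst[OF rhom_id c0] rhom_germ_ram[OF n]])
  let ?N = "of_nat n * fps_X ^ (n - 1) :: complex fps" and ?c = "fps_deriv (arc_ram n \<gamma>)"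
  have "?N * germ_along n (dy f) \<gamma> = - (?c * germ_along n (dx f) \<gamma>)"
    using deriv_germ_along[of n \<gamma> f, OF n \<gamma>] f by (simp add: eq_neg_iff_add_eq_0)
  moreover have "germ_along n (dy f) \<gamma> * germ_along n (dx g) \<gamma> - germ_along n (dx f) \<gamma> * germ_along n (dy g) \<gamma> = 0"
    using J by (simp add: jac_def rhom.diff[OF e] rhom.mult[OF e])
  moreover have "fx' * (N * gy + c * gx) = 0"
    if "N * fy = - (c * fx')" "fy * gx - fx' * gy = 0" for N fy c fx' gx gy :: "complex fps"
  proof -
    have "fx' * (N * gy + c * gx) = N * (fx' * gy) + c * fx' * gx"
      by (simp add: algebra_simps)
    also have "fx' * gy = fy * gx"
      using that(2) by simp
    also have "N * (fy * gx) + c * fx' * gx = (N * fy) * gx + c * fx' * gx"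
      by (simp add: mult.assoc)
    finally show ?thesis
      unfolding that(1) by simp
  qed
  ultimately have "germ_along n (dx f) \<gamma> * fps_deriv (germ_along n g \<gamma>) = 0"
    unfolding deriv_germ_along[of n \<gamma> g, OF n \<gamma>] by blast
  then have "fps_deriv (germ_along n g \<gamma>) = 0"
    using fx by simp
  then have "germ_along n g \<gamma> = fps_const (fps_nth (germ_along n g \<gamma>) 0)"
    by (simp add: fps_deriv_eq_0_iff)
  then show ?thesis
    using germ_along_nth_0[of \<gamma>, OF \<gamma>, of n g] g by simp
qed

lemma jac_swap: "jac g f = - jac f g"
  by (simp add: jac_def)

section \<open>Leading forms over a strip\<close>

context arc_strip
begin

abbreviation follows :: "arc \<Rightarrow> bool" where
  "follows \<xi> \<equiv> \<forall>e<h. \<xi> e = b e"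

text \<open>A root that follows b up to the height h contributes the linear factor w - \<xi>(h) and t^a; a root that leaves
b earlier is separated from the whole strip and contributes only a constant and a smaller power of t.\<close>

lemma leading_form_factor:
  assumes \<xi>: "has_ram n \<xi>"
  shows "\<exists>d G c. strip_coord - emb (arc_ram n \<xi>) = fps_X ^ d * G \<and> c \<noteq> 0
    \<and> fps_nth G 0 = (if follows \<xi> then [:- \<xi> h, 1:] else [:c:]) \<and> (follows \<xi> \<longrightarrow> d = a)"
proof (cases "follows \<xi>")
  case True
  define \<epsilon> where "\<epsilon> = Abs_fps (\<lambda>j. \<xi> (h + real j / real n))"
  have "arc_ram n \<xi> = arc_ram n b + fps_X ^ a * \<epsilon>"
    using arc_ram_over_strip[of 1 \<xi>] \<xi> True by (simp add: \<epsilon>_def)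
  then have "strip_coord - emb (arc_ram n \<xi>) = fps_X ^ a * (wvar - emb \<epsilon>)"
    by (simp add: strip_coord_def rhom.add[OF rhom_emb] rhom.mult[OF rhom_emb] rhom.power[OF rhom_emb] fps_map_X[OF rhom_const_poly] algebra_simps)
  moreover have "fps_nth (wvar - emb \<epsilon>) 0 = [:- \<xi> h, 1:]"
    by (simp add: \<epsilon>_def)
  ultimately show ?thesis
    using True by (intro exI[of _ a] exI[of _ "wvar - emb \<epsilon>"] exI[of _ 1]) auto
next
  case False
  then obtain e where e: "e < h" "\<xi> e \<noteq> b e" by blast
  then obtain j :: nat where j: "e = real j / real n"
    using \<xi> b by (metis has_ram_cases)
  define c where "c = arc_ram n b - arc_ram n \<xi>"
  have "fps_nth c j \<noteq> 0"
    using e by (simp add: c_def arc_ram_def j)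
  then have c: "c \<noteq> 0" "subdegree c \<le> j"
    by (auto intro: subdegree_leI)
  moreover have "j < a"
    using e(1) n by (simp add: j divide_less_cancel)
  ultimately have da: "subdegree c < a" by simp
  define d where "d = subdegree c"
  define c' where "c' = fps_shift d c"
  have c': "c = fps_X ^ d * c'"
    unfolding d_def c'_def by (metis mult.commute subdegree_decompose)
  have "strip_coord - emb (arc_ram n \<xi>) = emb c + fps_X ^ (d + (a - d)) * wvar"
    using da by (simp add: strip_coord_def c_def d_def rhom.diff[OF rhom_emb])
  also have "\<dots> = fps_X ^ d * (emb c' + fps_X ^ (a - d) * wvar)"
    unfolding c' power_add
    by (simp add: rhom.mult[OF rhom_emb] rhom.power[OF rhom_emb] fps_map_X[OF rhom_const_poly] algebra_simps)
  finally have "strip_coord - emb (arc_ram n \<xi>) = fps_X ^ d * (emb c' + fps_X ^ (a - d) * wvar)" .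
  moreover have "fps_nth (emb c' + fps_X ^ (a - d) * wvar) 0 = [:fps_nth c d:]"
    using da by (simp add: c'_def d_def)
  moreover have "fps_nth c d \<noteq> 0"
    using c(1) by (simp add: d_def)
  ultimately show ?thesis
    using False by (intro exI[of _ d] exI[of _ "emb c' + fps_X ^ (a - d) * wvar"] exI[of _ "fps_nth c d"] conjI) (simp_all only: if_False simp_thms not_False_eq_True)
qed

lemma leading_form_prod:
  assumes "finite S" "\<forall>\<xi>\<in>S. has_ram n \<xi>"
  shows "\<exists>d G c. (\<Prod>\<xi>\<in>S. strip_coord - emb (arc_ram n \<xi>)) = fps_X ^ d * G \<and> c \<noteq> 0
    \<and> fps_nth G 0 = smult c (\<Prod>\<xi>\<in>{\<xi>\<in>S. follows \<xi>}. [:- \<xi> h, 1:]) \<and> ((\<forall>\<xi>\<in>S. follows \<xi>) \<longrightarrow> d = a * card S)"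
  using assms
proof (induction S rule: finite_induct)
  case empty
  show ?case
    by (intro exI[of _ "0::nat"] exI[of _ "1::complex poly fps"] exI[of _ "1::complex"]) simp
next
  case (insert \<xi> S)
  have S: "\<forall>\<xi>\<in>S. has_ram n \<xi>"
    using insert.prems by simp
  obtain d1 G1 c1 where 1: "(\<Prod>\<xi>\<in>S. strip_coord - emb (arc_ram n \<xi>)) = fps_X ^ d1 * G1" "c1 \<noteq> 0"
      "fps_nth G1 0 = smult c1 (\<Prod>\<xi>\<in>{\<xi>\<in>S. follows \<xi>}. [:- \<xi> h, 1:])" "(\<forall>\<xi>\<in>S. follows \<xi>) \<longrightarrow> d1 = a * card S"
    using insert.IH[OF S] by blast
  obtain d2 G2 c2 where 2: "strip_coord - emb (arc_ram n \<xi>) = fps_X ^ d2 * G2" "c2 \<noteq> 0"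
      "fps_nth G2 0 = (if follows \<xi> then [:- \<xi> h, 1:] else [:c2:])" "follows \<xi> \<longrightarrow> d2 = a"
    using leading_form_factor[of \<xi>] insert.prems by blast
  have set: "{\<xi>'\<in>insert \<xi> S. follows \<xi>'} = (if follows \<xi> then insert \<xi> {\<xi>\<in>S. follows \<xi>} else {\<xi>\<in>S. follows \<xi>})"
    by auto
  show ?case
  proof (intro exI conjI)
    show "(\<Prod>\<xi>\<in>insert \<xi> S. strip_coord - emb (arc_ram n \<xi>)) = fps_X ^ (d2 + d1) * (G2 * G1)"
      using insert.hyps by (simp add: 1(1) 2(1) power_add mult_ac)
    show "(if follows \<xi> then c1 else c1 * c2) \<noteq> 0"
      using 1 2 by simp
    show "fps_nth (G2 * G1) 0 = smult (if follows \<xi> then c1 else c1 * c2) (\<Prod>\<xi>\<in>{\<xi>'\<in>insert \<xi> S. follows \<xi>'}. [:- \<xi> h, 1:])"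
      unfolding set using insert.hyps by (auto simp: 1(3) 2(3) algebra_simps)
    show "(\<forall>\<xi>'\<in>insert \<xi> S. follows \<xi>') \<longrightarrow> d2 + d1 = a * card (insert \<xi> S)"
      using insert.hyps 1(4) 2(4) by simp
  qed
qed

text \<open>The exponent d is made explicit when all roots follow b, because the thin strips of the ground bar are
compared through it.\<close>

lemma leading_form_pullback:
  assumes F: "factors_over F u E S n" and u: "germ_at_O u \<noteq> 0"
  shows "\<exists>d G c. pullback F = fps_X ^ d * G \<and> c \<noteq> 0
    \<and> fps_nth G 0 = smult c (\<Prod>\<xi>\<in>{\<xi>\<in>S. follows \<xi>}. [:- \<xi> h, 1:]) \<and> ((\<forall>\<xi>\<in>S. follows \<xi>) \<longrightarrow> d = n * E + a * card S)"
proof -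
  obtain d G c where 1: "(\<Prod>\<xi>\<in>S. strip_coord - emb (arc_ram n \<xi>)) = fps_X ^ d * G" "c \<noteq> 0"
      "fps_nth G 0 = smult c (\<Prod>\<xi>\<in>{\<xi>\<in>S. follows \<xi>}. [:- \<xi> h, 1:])" "(\<forall>\<xi>\<in>S. follows \<xi>) \<longrightarrow> d = a * card S"
    using leading_form_prod[of S] F unfolding factors_over_def by blast
  have "pullback F = pullback u * fps_X ^ (n * E) * (\<Prod>\<xi>\<in>S. strip_coord - emb (arc_ram n \<xi>))"
    using F unfolding factors_over_def pullback_def
    by (simp add: rhom.mult[OF rhom_strip_subst] rhom.prod[OF rhom_strip_subst] rhom.diff[OF rhom_strip_subst] fps_subst_X[OF rhom_emb strip_coord_nth_0]
        fps_subst_const[OF rhom_emb strip_coord_nth_0] rhom.power[OF rhom_emb] fps_map_X[OF rhom_const_poly])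
  then have "pullback F = fps_X ^ (n * E + d) * (pullback u * G)"
    by (simp add: 1(1) power_add mult_ac)
  moreover have "fps_nth (pullback u * G) 0 = smult (germ_at_O u * c) (\<Prod>\<xi>\<in>{\<xi>\<in>S. follows \<xi>}. [:- \<xi> h, 1:])"
    using u by (simp add: 1(3) pullback_def fps_subst_nth_0 germ_ram_eq germ_at_O_def mult.commute)
  ultimately show ?thesis
    using 1(2,4) u by (intro exI[of _ "n * E + d"] exI[of _ "pullback u * G"] exI[of _ "germ_at_O u * c"]) auto
qed

text \<open>The generic order used to define \<nu> is the exponent of the leading form, attained wherever the leading form
does not vanish.\<close>

lemma order_along_generic:
  assumes F: "pullback F = fps_X ^ d * G" and z: "poly (fps_nth G 0) z \<noteq> 0"
  shows "order_along F (b(h := z)) = ereal (real d / real n)"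
proof -
  define \<gamma> where "\<gamma> = b(h := z)"
  have ram: "has_ram n \<gamma>"
    using b by (auto simp: has_ram_def \<gamma>_def)
  have \<gamma>0: "\<gamma> 0 = 0"
    using b0 h_pos by (auto simp: \<gamma>_def)
  define \<epsilon> where "\<epsilon> = Abs_fps (\<lambda>j. \<gamma> (h + real j / real n))"
  have "\<forall>e<h. \<gamma> e = b e"
    by (simp add: \<gamma>_def)
  then have "germ_along n F \<gamma> = eval_at \<epsilon> 1 (pullback F)"
    using germ_along_over_strip[of 1 \<gamma> F] ram by (simp add: \<epsilon>_def)
  also have "\<dots> = fps_X ^ d * eval_at \<epsilon> 1 G"
    by (simp only: F rhom.mult[OF rhom_eval_at] subst2_X_power[OF rhom_fps_const] order_refl mult_1)
  finally have eq: "germ_along n F \<gamma> = fps_X ^ d * eval_at \<epsilon> 1 G" .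
  have "fps_nth (eval_at \<epsilon> 1 G) 0 \<noteq> 0"
    using z by (simp add: eval_at_nth_0 \<epsilon>_def \<gamma>_def del: One_nat_def)
  then have "subdegree (germ_along n F \<gamma>) = d" "germ_along n F \<gamma> \<noteq> 0"
    unfolding eq by (auto intro!: subdegreeI simp: fps_X_power_mult_nth)
  then show ?thesis
    using order_along_eq[OF ram, of F] \<gamma>0 by (simp add: \<gamma>_def)
qed

end

section \<open>The weighted Wronskian and its order\<close>

definition roots_poly :: "('a \<Rightarrow> complex) \<Rightarrow> 'a set \<Rightarrow> complex poly" where
  "roots_poly pt A = (\<Prod>\<xi>\<in>A. [:- pt \<xi>, 1:])"

lemma roots_poly_nz: "finite A \<Longrightarrow> roots_poly pt A \<noteq> 0"
  by (simp add: roots_poly_def)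

lemma poly_roots_poly: "poly (roots_poly pt A) w = (\<Prod>\<xi>\<in>A. w - pt \<xi>)"
  by (simp add: roots_poly_def poly_prod)

lemma order_roots_poly:
  assumes "finite A"
  shows "order z (roots_poly pt A) = card {\<xi>\<in>A. pt \<xi> = z}"
  using assms
proof (induction A rule: finite_induct)
  case empty
  then show ?case by (simp add: roots_poly_def)
next
  case (insert \<xi> A)
  have nz: "[:- pt \<xi>, 1:] * roots_poly pt A \<noteq> 0"
    using roots_poly_nz[OF insert.hyps(1), of pt] by (simp add: mult_eq_0_iff del: mult_pCons_left)
  have "order z [:- pt \<xi>, 1:] = (if pt \<xi> = z then 1 else 0)"
    using order_power_n_n[of z 1] by (auto intro: order_0I)
  moreover have "{\<xi>'\<in>insert \<xi> A. pt \<xi>' = z} = (if pt \<xi> = z then insert \<xi> {\<xi>\<in>A. pt \<xi> = z} else {\<xi>\<in>A. pt \<xi> = z})"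
    by auto
  moreover have "roots_poly pt (insert \<xi> A) = [:- pt \<xi>, 1:] * roots_poly pt A"
    unfolding roots_poly_def by (rule prod.insert[OF insert.hyps])
  ultimately show ?case
    using insert order_mult[OF nz, of z] by simp
qed

lemma pderiv_roots_poly:
  assumes "finite A" "w \<notin> pt ` A"
  shows "poly (pderiv (roots_poly pt A)) w = poly (roots_poly pt A) w * (\<Sum>\<xi>\<in>A. 1 / (w - pt \<xi>))"
  using assms
proof (induction A rule: finite_induct)
  case empty
  then show ?case by (simp add: roots_poly_def)
next
  case (insert \<xi> A)
  have eq: "roots_poly pt (insert \<xi> A) = [:- pt \<xi>, 1:] * roots_poly pt A"
    unfolding roots_poly_def by (rule prod.insert[OF insert.hyps])
  have "w - pt \<xi> \<noteq> 0" using insert.prems by auto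
  then show ?case
    unfolding eq pderiv_mult using insert by (simp add: pderiv_pCons field_simps)
qed

lemma sum_by_value:
  assumes "finite A" "finite Z" "pt ` A \<subseteq> Z"
  shows "(\<Sum>\<xi>\<in>A. 1 / (w - pt \<xi>)) = (\<Sum>c\<in>Z. of_nat (card {\<xi>\<in>A. pt \<xi> = c}) / (w - c :: complex))"
proof -
  have "(\<Sum>\<xi>\<in>A. 1 / (w - pt \<xi>)) = (\<Sum>c\<in>Z. \<Sum>\<xi>\<in>{\<xi>\<in>A. pt \<xi> = c}. 1 / (w - pt \<xi>))"
    by (rule sum.group[OF assms, symmetric])
  also have "\<dots> = (\<Sum>c\<in>Z. of_nat (card {\<xi>\<in>A. pt \<xi> = c}) / (w - c))"
    by (intro sum.cong refl) simp
  finally show ?thesis .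
qed

text \<open>Away from the points, Wr = \<phi> \<psi> M by logarithmic differentiation. Collinear points drop out of M, so M = V / D
with D the product of w - c over the non-collinear points only; V does not vanish at these points because
the residue of M there is nonzero. Hence Wr D = \<phi> \<psi> V as polynomials, and ord V - ord D at z is what the last
summand says: - 1 at a pole, the order of M at a zero, and 0 elsewhere.\<close>

lemma weighted_wronskian:
  fixes pt :: "'a \<Rightarrow> complex" and d1 d2 :: real
  assumes fin: "finite A" "finite A'"
  defines "\<Delta> \<equiv> \<lambda>c. d1 * real (card {\<xi>\<in>A'. pt \<xi> = c}) - d2 * real (card {\<xi>\<in>A. pt \<xi> = c})"
  defines "Z \<equiv> pt ` (A \<union> A')"
  defines "M \<equiv> \<lambda>w. \<Sum>c\<in>Z. complex_of_real (\<Delta> c) / (w - c)"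
  defines "N \<equiv> {c\<in>Z. \<Delta> c \<noteq> 0}"
  defines "\<phi> \<equiv> roots_poly pt A" and "\<psi> \<equiv> roots_poly pt A'"
  defines "Wr \<equiv> smult (complex_of_real d1) (\<phi> * pderiv \<psi>) - smult (complex_of_real d2) (pderiv \<phi> * \<psi>)"
  assumes N: "N \<noteq> {}"
  shows "Wr \<noteq> 0"
    and "int (order z Wr) = int (card {\<xi>\<in>A. pt \<xi> = z} + card {\<xi>\<in>A'. pt \<xi> = z})
      + (if z \<notin> N \<and> M z = 0 then zorder M z else if z \<in> N then - 1 else 0)"
proof -
  have Z: "finite Z" "pt ` A \<subseteq> Z" "pt ` A' \<subseteq> Z"
    using fin by (auto simp: Z_def)
  have finN: "finite N" using Z by (simp add: N_def)
  define D where "D = roots_poly (\<lambda>c. c) N"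
  define V where "V = (\<Sum>c\<in>N. smult (complex_of_real (\<Delta> c)) (roots_poly (\<lambda>c. c) (N - {c})))"
  have nz: "\<phi> \<noteq> 0" "\<psi> \<noteq> 0" "D \<noteq> 0"
    using fin finN by (simp_all add: \<phi>_def \<psi>_def D_def roots_poly_nz)
  have M_V: "M w = poly V w / poly D w" and D_nz: "poly D w \<noteq> 0" if "w \<notin> N" for w
  proof -
    have "M w = (\<Sum>c\<in>N. complex_of_real (\<Delta> c) / (w - c))"
      unfolding M_def N_def using Z(1) by (intro sum.mono_neutral_right) auto
    also have "\<dots> = (\<Sum>c\<in>N. complex_of_real (\<Delta> c) * poly (roots_poly (\<lambda>c. c) (N - {c})) w / poly D w)"
    proof (intro sum.cong refl)
      fix c assume c: "c \<in> N"
      have "poly D w = (w - c) * poly (roots_poly (\<lambda>c. c) (N - {c})) w"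
        unfolding D_def poly_roots_poly using finN c by (rule prod.remove)
      moreover have "poly (roots_poly (\<lambda>c. c) (N - {c})) w \<noteq> 0" "w - c \<noteq> 0"
        using finN that c by (auto simp: poly_roots_poly)
      ultimately show "complex_of_real (\<Delta> c) / (w - c) = complex_of_real (\<Delta> c) * poly (roots_poly (\<lambda>c. c) (N - {c})) w / poly D w"
        by simp
    qed
    also have "\<dots> = poly V w / poly D w"
      by (simp add: V_def poly_sum sum_divide_distrib)
    finally show "M w = poly V w / poly D w" .
    show "poly D w \<noteq> 0"
      using finN that by (auto simp: D_def poly_roots_poly)
  qed
  have V_N: "poly V c \<noteq> 0" if c: "c \<in> N" for c
  proof -
    have "poly V c = (\<Sum>c'\<in>N. complex_of_real (\<Delta> c') * (\<Prod>c''\<in>N - {c'}. c - c''))"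
      by (simp add: V_def poly_sum poly_roots_poly)
    also have "\<dots> = complex_of_real (\<Delta> c) * (\<Prod>c''\<in>N - {c}. c - c'')"
      using finN c by (subst sum.remove[of _ c]) (auto intro!: sum.neutral)
    finally show ?thesis
      using c finN by (auto simp: N_def)
  qed
  have V0: "V \<noteq> 0"
    using N V_N by auto
  have eq_at: "poly (Wr * D) w = poly (\<phi> * \<psi> * V) w" if w: "w \<notin> Z" for w
  proof -
    have notin: "w \<notin> pt ` A" "w \<notin> pt ` A'" "w \<notin> N"
      using w Z by (auto simp: N_def)
    have "M w = of_real d1 * (\<Sum>c\<in>Z. of_nat (card {\<xi>\<in>A'. pt \<xi> = c}) / (w - c))
        - of_real d2 * (\<Sum>c\<in>Z. of_nat (card {\<xi>\<in>A. pt \<xi> = c}) / (w - c))"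
      by (simp add: M_def \<Delta>_def sum_distrib_left sum_subtractf[symmetric] diff_divide_distrib)
    also have "\<dots> = of_real d1 * (\<Sum>\<xi>\<in>A'. 1 / (w - pt \<xi>)) - of_real d2 * (\<Sum>\<xi>\<in>A. 1 / (w - pt \<xi>))"
      using sum_by_value[OF fin(1) Z(1,2), of w] sum_by_value[OF fin(2) Z(1,3), of w] by simp
    finally have Mw: "M w = of_real d1 * (\<Sum>\<xi>\<in>A'. 1 / (w - pt \<xi>)) - of_real d2 * (\<Sum>\<xi>\<in>A. 1 / (w - pt \<xi>))" .
    have "poly Wr w = poly (\<phi> * \<psi>) w * M w"
      unfolding Mw Wr_def \<phi>_def \<psi>_def
      by (simp add: pderiv_roots_poly[OF fin(1) notin(1)] pderiv_roots_poly[OF fin(2) notin(2)] algebra_simps)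
    then show ?thesis
      using M_V[OF notin(3)] D_nz[OF notin(3)] by simp
  qed
  have eq: "Wr * D = \<phi> * \<psi> * V"
  proof (rule ccontr)
    assume "Wr * D \<noteq> \<phi> * \<psi> * V"
    then have "finite {w. poly (Wr * D - \<phi> * \<psi> * V) w = 0}"
      by (intro poly_roots_finite) simp
    moreover have "- Z \<subseteq> {w. poly (Wr * D - \<phi> * \<psi> * V) w = 0}"
      using eq_at by (auto simp del: poly_mult)
    ultimately have "finite (- Z)"
      by (rule finite_subset[rotated])
    then have "finite (UNIV :: complex set)"
      using Z(1) by (metis Compl_partition2 finite_Un)
    then show False
      using infinite_UNIV_char_0 by blast
  qed
  then show "Wr \<noteq> 0"
    using nz V0 by auto
  then have "order z Wr + order z D = order z \<phi> + order z \<psi> + order z V"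
    using arg_cong[OF eq, of "order z"] nz V0 by (simp add: order_mult)
  moreover have "order z D = (if z \<in> N then 1 else 0)"
  proof -
    have "{c \<in> N. c = z} = (if z \<in> N then {z} else {})" by auto
    then show ?thesis by (simp add: D_def order_roots_poly[OF finN])
  qed
  ultimately have ord: "int (order z Wr) = int (card {\<xi>\<in>A. pt \<xi> = z} + card {\<xi>\<in>A'. pt \<xi> = z})
      + (int (order z V) - (if z \<in> N then 1 else 0))"
    using fin by (auto simp: \<phi>_def \<psi>_def order_roots_poly)
  have "int (order z V) - (if z \<in> N then 1 else 0) = (if z \<notin> N \<and> M z = 0 then zorder M z else if z \<in> N then - 1 else 0)"
  proof (cases "z \<in> N")
    case True
    then show ?thesis
      using V_N[of z] by (simp add: order_0I)
  next
    case False
    show ?thesis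
    proof (cases "M z = 0")
      case True
      obtain V1 where V1: "V = [:- z, 1:] ^ order z V * V1" "\<not> [:- z, 1:] dvd V1"
        using order_decomp[OF V0] by blast
      have "zorder M z = int (order z V)"
      proof (rule zorder_eqI[of "- N" z "\<lambda>w. poly V1 w / poly D w"])
        show "open (- N)"
          using finN by (simp add: finite_imp_closed open_Compl)
        show "(\<lambda>w. poly V1 w / poly D w) holomorphic_on - N"
          using D_nz by (intro holomorphic_intros) auto
        show "poly V1 z / poly D z \<noteq> 0"
          using V1(2) D_nz[OF False] by (simp add: poly_eq_0_iff_dvd)
        fix w assume w: "w \<in> - N" "w \<noteq> z"
        have "poly V w = (w - z) ^ order z V * poly V1 w"
          by (subst V1(1)) (simp add: poly_power)
        then show "M w = poly V1 w / poly D w * (w - z) powi int (order z V)"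
          using w M_V[of w] by simp
      qed (use False in simp)
      then show ?thesis using True False by simp
    next
      case nonzero: False
      then have "poly V z \<noteq> 0"
        using M_V[OF False] by auto
      then show ?thesis
        using False nonzero by (simp add: order_0I)
    qed
  qed
  then show "int (order z Wr) = int (card {\<xi>\<in>A. pt \<xi> = z} + card {\<xi>\<in>A'. pt \<xi> = z})
      + (if z \<notin> N \<and> M z = 0 then zorder M z else if z \<in> N then - 1 else 0)"
    using ord by simp
qed

section \<open>Polar roots over a strip\<close>

locale germ_pair =
  fixes f g u u' :: "complex fps fps" and E1 E2 n0 :: nat and P Q :: "arc set"
  assumes hf: "holo_germ f" and hg: "holo_germ g" and f0: "germ_at_O f = 0" and g0: "germ_at_O g = 0"
    and u: "germ_at_O u \<noteq> 0" and u': "germ_at_O u' \<noteq> 0"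
    and f: "factors_over f u E1 P n0" and g: "factors_over g u' E2 Q n0"
    and disj: "P \<inter> Q = {}"
begin

lemma n0: "n0 \<ge> 1"
  using f by (simp add: factors_over_def)

lemma finite_roots: "finite P" "finite Q"
  using f g by (simp_all add: factors_over_def)

lemma root_ram: "\<xi> \<in> P \<union> Q \<Longrightarrow> has_ram n0 \<xi>" "\<xi> \<in> P \<union> Q \<Longrightarrow> \<xi> 0 = 0"
  using f g by (auto simp: factors_over_def)

lemma jacobian_root_is_polar:
  assumes \<gamma>: "frac_series \<gamma>" "\<gamma> 0 = 0" and J: "subst_arc (jac f g) \<gamma> = 0"
  shows "subst_arc f \<gamma> * subst_arc g \<gamma> \<noteq> 0"
proof -
  have r: "has_ram (ram \<gamma>) \<gamma>" by (rule has_ram_ram[OF \<gamma>(1)])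
  define n where "n = n0 * ram \<gamma>"
  have n: "n \<ge> 1"
    using n0 has_ram_ge_1[OF r] by (simp add: n_def)
  have ram: "has_ram n \<gamma>"
    using has_ram_mult[OF r n0] by (simp add: n_def mult.commute)
  have F: "factors_over f u E1 P n" and G: "factors_over g u' E2 Q n"
    using factors_over_mult[OF f] factors_over_mult[OF g] has_ram_ge_1[OF r] by (simp_all add: n_def)
  note zero = subst_arc_eq_0_iff[OF ram \<gamma>(2)]
  note root_f = germ_along_eq_0_iff_root[OF F u ram \<gamma>(2)]
  note root_g = germ_along_eq_0_iff_root[OF G u' ram \<gamma>(2)]
  have J1: "germ_along n (jac f g) \<gamma> = 0"
    using J zero by blast
  have J2: "germ_along n (jac g f) \<gamma> = 0"
  proof -
    have e: "rhom (\<lambda>F. germ_along n F \<gamma>)"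
      unfolding germ_along_def
      by (rule rhom_comp[OF rhom_fps_subst[OF rhom_id] rhom_germ_ram[OF n]]) (simp add: arc_ram_nth_0 \<gamma>(2))
    show ?thesis
      using J1 unfolding jac_swap[of f g] rhom.uminus[OF e] by simp
  qed
  have "\<gamma> \<notin> P"
  proof
    assume "\<gamma> \<in> P"
    then have "germ_along n f \<gamma> = 0" "germ_along n (dx f) \<gamma> \<noteq> 0"
      using root_f germ_along_dx_root_neq_0[OF F u] by auto
    then have "germ_along n g \<gamma> = 0"
      using jacobian_root_common[where \<gamma> = \<gamma>, OF n \<gamma>(2) _ _ J1 g0] by blast
    with \<open>\<gamma> \<in> P\<close> root_g disj show False by auto
  qed
  moreover have "\<gamma> \<notin> Q"
  proof
    assume "\<gamma> \<in> Q"
    then have "germ_along n g \<gamma> = 0" "germ_along n (dx g) \<gamma> \<noteq> 0"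
      using root_g germ_along_dx_root_neq_0[OF G u'] by auto
    then have "germ_along n f \<gamma> = 0"
      using jacobian_root_common[where \<gamma> = \<gamma>, OF n \<gamma>(2) _ _ J2 f0] by blast
    with \<open>\<gamma> \<in> Q\<close> root_f disj show False by auto
  qed
  ultimately show ?thesis
    using root_f root_g zero by simp
qed

lemma polar_root_iff:
  "polar_root f g \<gamma> \<longleftrightarrow> frac_series \<gamma> \<and> \<gamma> 0 = 0 \<and> subst_arc (jac f g) \<gamma> = 0"
proof -
  have "frac_series \<gamma> \<Longrightarrow> arc_order \<gamma> > 0 \<longleftrightarrow> \<gamma> 0 = 0"
    using arc_order_pos_iff[OF has_ram_ram] .
  then show ?thesis
    using jacobian_root_is_polar unfolding polar_root_def by blast
qed

end

text \<open>The numbers \<nu>1 and \<nu>2 are the exponents of the leading forms divided by n, so that the statement does not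
depend on the ramification; this division multiplies the Wronskian by a nonzero constant only.\<close>

lemma (in germ_pair) polar_count_over_strip:
  fixes b :: arc and a k :: nat
  assumes k: "k \<ge> 1" and strip: "arc_strip (n0 * k) a b"
  defines "h \<equiv> real a / real (n0 * k)"
  defines "Pb \<equiv> {\<xi>\<in>P. \<forall>e<h. \<xi> e = b e}" and "Qb \<equiv> {\<xi>\<in>Q. \<forall>e<h. \<xi> e = b e}"
  defines "\<phi> \<equiv> roots_poly (\<lambda>\<xi>. \<xi> h) Pb" and "\<psi> \<equiv> roots_poly (\<lambda>\<xi>. \<xi> h) Qb"
  defines "\<Gamma> \<equiv> \<lambda>z. {\<gamma>. polar_root f g \<gamma> \<and> (\<forall>e<h. \<gamma> e = b e) \<and> \<gamma> h = z}"
  shows "\<exists>\<nu>1 \<nu>2 :: real.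
      (\<forall>z. poly \<phi> z \<noteq> 0 \<longrightarrow> order_along f (b(h := z)) = ereal \<nu>1) \<and>
      (\<forall>z. poly \<psi> z \<noteq> 0 \<longrightarrow> order_along g (b(h := z)) = ereal \<nu>2) \<and>
      (Pb = P \<longrightarrow> \<nu>1 = real E1 + h * real (card P)) \<and> (Qb = Q \<longrightarrow> \<nu>2 = real E2 + h * real (card Q)) \<and>
      (smult (complex_of_real \<nu>1) (\<phi> * pderiv \<psi>) - smult (complex_of_real \<nu>2) (pderiv \<phi> * \<psi>) \<noteq> 0 \<longrightarrow>
        (\<forall>z. finite (\<Gamma> z) \<and> (\<forall>\<gamma>\<in>\<Gamma> z. root_mult (jac f g) \<gamma> > 0) \<and> (\<Sum>\<gamma>\<in>\<Gamma> z. root_mult (jac f g) \<gamma>) =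
          order z (smult (complex_of_real \<nu>1) (\<phi> * pderiv \<psi>) - smult (complex_of_real \<nu>2) (pderiv \<phi> * \<psi>))))"
proof -
  define n where "n = n0 * k"
  interpret arc_strip n a b
    using strip by (simp add: n_def)
  have h: "h = real a / real n"
    by (simp add: h_def n_def)
  obtain d1 F1 c1 where 1: "pullback f = fps_X ^ d1 * F1" "c1 \<noteq> 0" "fps_nth F1 0 = smult c1 \<phi>"
      "Pb = P \<longrightarrow> d1 = n * E1 + a * card P"
    using leading_form_pullback[OF factors_over_mult[OF f k, folded n_def] u] unfolding \<phi>_def roots_poly_def Pb_def h by blast
  obtain d2 G1 c2 where 2: "pullback g = fps_X ^ d2 * G1" "c2 \<noteq> 0" "fps_nth G1 0 = smult c2 \<psi>"
      "Qb = Q \<longrightarrow> d2 = n * E2 + a * card Q"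
    using leading_form_pullback[OF factors_over_mult[OF g k, folded n_def] u'] unfolding \<psi>_def roots_poly_def Qb_def h by blast
  define \<nu>1 where "\<nu>1 = real d1 / real n"
  define \<nu>2 where "\<nu>2 = real d2 / real n"
  define Wr where "Wr = smult (complex_of_real \<nu>1) (\<phi> * pderiv \<psi>) - smult (complex_of_real \<nu>2) (pderiv \<phi> * \<psi>)"
  have d: "of_nat d1 = of_nat n * complex_of_real \<nu>1" "of_nat d2 = of_nat n * complex_of_real \<nu>2"
    using n by (simp_all add: \<nu>1_def \<nu>2_def)
  have of_nat_smult: "of_nat j * p = smult (of_nat j) p" for j and p :: "complex poly"
    by (simp add: of_nat_poly)
  have Wr: "of_nat d1 * fps_nth F1 0 * pderiv (fps_nth G1 0) - of_nat d2 * pderiv (fps_nth F1 0) * fps_nth G1 0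
      = smult (of_nat n * c1 * c2) Wr"
    by (simp add: of_nat_smult 1(3) 2(3) Wr_def pderiv_smult d smult_diff_right mult_ac)
  have count: "finite (\<Gamma> z) \<and> (\<forall>\<gamma>\<in>\<Gamma> z. root_mult (jac f g) \<gamma> > 0) \<and> (\<Sum>\<gamma>\<in>\<Gamma> z. root_mult (jac f g) \<gamma>) = order z Wr"
    if nz: "Wr \<noteq> 0" for z
  proof -
    have nz': "smult (of_nat n * c1 * c2) Wr \<noteq> 0"
      using nz 1(2) 2(2) n by simp
    then obtain d H where H: "pullback (jac f g) = fps_X ^ d * H" "of_nat n * fps_nth H 0 = smult (of_nat n * c1 * c2) Wr"
      using leading_form_jacobian[OF 1(1) 2(1)] unfolding Wr by blast
    have H0: "fps_nth H 0 = smult (c1 * c2) Wr"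
    proof (rule poly_eqI)
      show "coeff (fps_nth H 0) i = coeff (smult (c1 * c2) Wr) i" for i
        using arg_cong[OF H(2), of "\<lambda>p. coeff p i"] n by (simp add: of_nat_smult mult.assoc)
    qed
    then have "fps_nth H 0 \<noteq> 0"
      using nz' by auto
    note root_count_over_strip[OF H(1) this, where z = z]
    moreover have "{\<gamma>. frac_series \<gamma> \<and> (\<forall>e<real a / real n. \<gamma> e = b e) \<and> \<gamma> (real a / real n) = z \<and> subst_arc (jac f g) \<gamma> = 0} = \<Gamma> z"
      using over_strip_nth_0 by (auto simp: \<Gamma>_def h polar_root_iff)
    moreover have "order z (fps_nth H 0) = order z Wr"
      using 1(2) 2(2) by (simp add: H0 order_smult)
    ultimately show ?thesis by simp
  qed
  have ord_f: "order_along f (b(h := z)) = ereal \<nu>1" if "poly \<phi> z \<noteq> 0" for z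
    using order_along_generic[OF 1(1), of z] that 1(2,3) by (simp add: h \<nu>1_def)
  have ord_g: "order_along g (b(h := z)) = ereal \<nu>2" if "poly \<psi> z \<noteq> 0" for z
    using order_along_generic[OF 2(1), of z] that 2(2,3) by (simp add: h \<nu>2_def)
  have "Pb = P \<longrightarrow> \<nu>1 = real E1 + h * real (card P)" "Qb = Q \<longrightarrow> \<nu>2 = real E2 + h * real (card Q)"
    using 1(4) 2(4) n by (auto simp: \<nu>1_def \<nu>2_def h field_simps)
  then show ?thesis
    using count ord_f ord_g unfolding Wr_def by blast
qed

section \<open>Bars and trunks\<close>

lemma contact_gt_iff:
  "has_ram n \<xi> \<Longrightarrow> has_ram n \<eta> \<Longrightarrow> contact \<xi> \<eta> > ereal h \<longleftrightarrow> (\<forall>e\<le>h. \<xi> e = \<eta> e)"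
  unfolding contact_def using arc_order_gt_iff[OF has_ram_diff] by simp

lemma contact_ge_iff: "contact \<xi> \<eta> \<ge> ereal h \<longleftrightarrow> (\<forall>e<h. \<xi> e = \<eta> e)"
  by (simp add: contact_def arc_order_ge_iff)

lemma trunk_height_attained:
  assumes "finite S" "S \<noteq> {}"
  shows "\<exists>\<xi>\<in>S. \<exists>\<eta>\<in>S. contact \<xi> \<eta> = trunk_height S"
proof -
  have attained: "\<exists>x\<in>S. F x = (INF x\<in>S. F x)" for F :: "arc \<Rightarrow> ereal"
  proof -
    have "(INF x\<in>S. F x) = Min (F ` S)"
      using assms by (simp add: Min_Inf)
    moreover have "Min (F ` S) \<in> F ` S"
      using assms by (intro Min_in) auto
    ultimately show ?thesis by (metis imageE)
  qed
  obtain \<xi> where \<xi>: "\<xi> \<in> S" "(INF \<eta>\<in>S. contact \<xi> \<eta>) = trunk_height S"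
    using attained[of "\<lambda>\<xi>. INF \<eta>\<in>S. contact \<xi> \<eta>"] unfolding trunk_height_def by blast
  obtain \<eta> where "\<eta> \<in> S" "contact \<xi> \<eta> = (INF \<eta>\<in>S. contact \<xi> \<eta>)"
    using attained[of "contact \<xi>"] by blast
  with \<xi> show ?thesis by metis
qed

text \<open>The arcs of K agree below h, so their contact exceeds h exactly if they also agree at h.\<close>

lemma trunks_eq:
  assumes K: "\<forall>\<xi>\<in>K. has_ram n \<xi>" and agree: "\<forall>\<xi>\<in>K. \<forall>\<eta>\<in>K. \<forall>e<h. \<xi> e = \<eta> e"
  shows "trunks (K, h) = (\<lambda>c. {\<xi>\<in>K. \<xi> h = c}) ` ((\<lambda>\<xi>. \<xi> h) ` K)"
proof -
  have "contact \<xi> \<eta> > ereal h \<longleftrightarrow> \<xi> h = \<eta> h" if "\<xi> \<in> K" "\<eta> \<in> K" for \<xi> \<eta>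
    using contact_gt_iff[of n \<xi> \<eta> h] K agree that by (auto simp: le_less)
  then have "{(\<xi>, \<eta>). \<xi> \<in> K \<and> \<eta> \<in> K \<and> contact \<xi> \<eta> > ereal h} `` {\<xi>} = {\<eta>\<in>K. \<eta> h = \<xi> h}" if "\<xi> \<in> K" for \<xi>
    using that by auto
  then show ?thesis
    by (auto simp: trunks_def quotient_def)
qed

text \<open>What the construction of the tree guarantees for each bar: the arcs on it agree below its height, all other
roots have left them before, and a positive height lies in (1/n)Z.\<close>

definition admissible_bar :: "nat \<Rightarrow> arc set \<Rightarrow> bar \<Rightarrow> bool" where
  "admissible_bar n R B \<longleftrightarrow> fst B \<subseteq> R \<and> fst B \<noteq> {} \<and>
     (\<forall>\<xi>\<in>fst B. \<forall>\<eta>\<in>fst B. \<forall>e<snd B. \<xi> e = \<eta> e) \<and>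
     (\<forall>\<xi>\<in>R - fst B. \<forall>\<eta>\<in>fst B. \<exists>e<snd B. \<xi> e \<noteq> \<eta> e) \<and>
     (B = (R, 0) \<or> (\<exists>a\<ge>1. snd B = real a / real n))"

text \<open>The height of a trunk is a minimum over finitely many contact orders. It is attained by two arcs that agree
below it and differ at it, hence it is an exponent of one of them and exceeds the height of the bar below.\<close>

lemma bars_admissible:
  assumes R: "finite R" "R \<noteq> {}" "\<forall>\<xi>\<in>R. has_ram n \<xi>" and B: "B \<in> bars R"
  shows "admissible_bar n R B"
  using B
proof induction
  case ground
  have zero: "\<xi> e = 0" if "\<xi> \<in> R" "e < 0" for \<xi> e
  proof (rule has_ram_cases[of n \<xi> e])
    show "\<xi> e = 0" if "e = real j / real n" for j :: nat
      using that \<open>e < 0\<close> by (simp add: divide_less_0_iff)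
  qed (use R that in auto)
  then show ?case
    using R(2) by (simp add: admissible_bar_def zero)
next
  case (on_trunk B S h)
  obtain K h' where Kh: "B = (K, h')" by (cases B)
  have KR: "K \<subseteq> R" and K: "\<forall>\<xi>\<in>K. has_ram n \<xi>"
    and agree: "\<forall>\<xi>\<in>K. \<forall>\<eta>\<in>K. \<forall>e<h'. \<xi> e = \<eta> e"
    and differ: "\<forall>\<xi>\<in>R - K. \<forall>\<eta>\<in>K. \<exists>e<h'. \<xi> e \<noteq> \<eta> e"
    and h'0: "h' \<ge> 0"
    using on_trunk.IH R(3) unfolding admissible_bar_def Kh by auto
  obtain c where c: "S = {\<xi>\<in>K. \<xi> h' = c}" "S \<noteq> {}"
    using on_trunk.hyps(2) unfolding Kh trunks_eq[OF K agree] by blast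
  have "finite S"
    using finite_subset[OF KR R(1)] c(1) by simp
  then obtain \<xi> \<eta> where \<xi>\<eta>: "\<xi> \<in> S" "\<eta> \<in> S" "contact \<xi> \<eta> = ereal h"
    using trunk_height_attained[OF _ c(2)] on_trunk.hyps(3) by metis
  have ram: "has_ram n \<xi>" "has_ram n \<eta>"
    using \<xi>\<eta> c K by auto
  have "contact \<xi> \<eta> > ereal h'"
    unfolding contact_gt_iff[OF ram] using \<xi>\<eta> c agree by (auto simp: le_less)
  then have hh': "h > h'"
    using \<xi>\<eta>(3) by simp
  have low: "\<forall>e<h. \<xi> e = \<eta> e"
    using contact_ge_iff[of h \<xi> \<eta>] \<xi>\<eta>(3) by simp
  have "\<xi> h \<noteq> \<eta> h"
    using contact_gt_iff[OF ram, of h] \<xi>\<eta>(3) low by (auto simp: le_less)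
  then obtain a :: nat where a: "h = real a / real n"
    using ram by (metis has_ram_cases)
  have a1: "a \<ge> 1"
    using hh' h'0 a by (cases a) auto
  have "\<xi>1 e = \<xi>2 e" if "\<xi>1 \<in> S" "\<xi>2 \<in> S" "e < h" for \<xi>1 \<xi>2 e
  proof -
    have "ereal h \<le> contact \<xi>1 \<xi>2"
      unfolding on_trunk.hyps(3)[symmetric] trunk_height_def
      by (rule INF_lower2[OF that(1)], rule INF_lower2[OF that(2)]) simp
    then show ?thesis
      using that(3) by (simp add: contact_ge_iff)
  qed
  moreover have "\<exists>e<h. \<xi>1 e \<noteq> \<xi>2 e" if \<xi>12: "\<xi>1 \<in> R - S" "\<xi>2 \<in> S" for \<xi>1 \<xi>2
  proof (cases "\<xi>1 \<in> K")
    case True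
    then show ?thesis using that c hh' by auto
  next
    case False
    then obtain e where "e < h'" "\<xi>1 e \<noteq> \<xi>2 e"
      using differ \<xi>12 c by blast
    then show ?thesis using hh' by (meson less_trans)
  qed
  ultimately show ?case
    using c KR a a1 unfolding admissible_bar_def by auto
qed

context germ_pair
begin

text \<open>Sums over trunks are sums over growth points, since a trunk is determined by the point at which it grows.\<close>

lemma bar_formulas:
  assumes B: "admissible_bar n0 (P \<union> Q) B"
  defines "K \<equiv> fst B" and "h \<equiv> snd B"
  defines "\<Delta> \<equiv> \<lambda>c. nu f B * real (card {\<xi>\<in>K \<inter> Q. \<xi> h = c}) - nu g B * real (card {\<xi>\<in>K \<inter> P. \<xi> h = c})"
  shows "mero f g P Q B = (\<lambda>w. \<Sum>c\<in>(\<lambda>\<xi>. \<xi> h) ` (K \<inter> P \<union> K \<inter> Q). complex_of_real (\<Delta> c) / (w - c))"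
    and "noncollinear_pts f g P Q B = {c\<in>(\<lambda>\<xi>. \<xi> h) ` (K \<inter> P \<union> K \<inter> Q). \<Delta> c \<noteq> 0}"
    and "tau_at P Q B z = int (card {\<xi>\<in>K \<inter> P. \<xi> h = z} + card {\<xi>\<in>K \<inter> Q. \<xi> h = z})"
proof -
  have KPQ: "K \<inter> P \<union> K \<inter> Q = K"
    using B by (auto simp: admissible_bar_def K_def)
  let ?S = "\<lambda>c. {\<xi>\<in>K. \<xi> h = c}" and ?Z = "(\<lambda>\<xi>. \<xi> h) ` K"
  have B_eq: "B = (K, h)" by (simp add: K_def h_def)
  have trunks: "trunks B = ?S ` ?Z"
    unfolding B_eq by (rule trunks_eq[of _ n0]) (use B root_ram in \<open>auto simp: admissible_bar_def K_def h_def\<close>)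
  have gp: "growth_point B (?S c) = c" if c: "c \<in> ?Z" for c
  proof -
    obtain \<xi> where "\<xi> \<in> ?S c"
      using c by auto
    then have "(SOME \<xi>. \<xi> \<in> ?S c) \<in> ?S c"
      by (rule someI[of "\<lambda>\<xi>. \<xi> \<in> ?S c"])
    then show ?thesis
      by (simp add: growth_point_def bar_height_def h_def)
  qed
  have inj: "inj_on ?S ?Z"
    by (rule inj_on_inverseI[of _ "growth_point B"]) (rule gp)
  have Delta: "Delta f g P Q B (?S c) = \<Delta> c" for c
  proof -
    have "?S c \<inter> Q = {\<xi>\<in>K \<inter> Q. \<xi> h = c}" "?S c \<inter> P = {\<xi>\<in>K \<inter> P. \<xi> h = c}" by auto
    then show ?thesis by (simp add: Delta_def \<Delta>_def)
  qed
  show "mero f g P Q B = (\<lambda>w. \<Sum>c\<in>(\<lambda>\<xi>. \<xi> h) ` (K \<inter> P \<union> K \<inter> Q). complex_of_real (\<Delta> c) / (w - c))"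
  proof
    fix w
    have "mero f g P Q B w = (\<Sum>c\<in>?Z. complex_of_real (Delta f g P Q B (?S c)) / (w - growth_point B (?S c)))"
      unfolding mero_def trunks by (rule sum.reindex[OF inj, unfolded o_def])
    also have "\<dots> = (\<Sum>c\<in>?Z. complex_of_real (\<Delta> c) / (w - c))"
      by (intro sum.cong refl) (simp only: Delta gp)
    finally show "mero f g P Q B w = (\<Sum>c\<in>(\<lambda>\<xi>. \<xi> h) ` (K \<inter> P \<union> K \<inter> Q). complex_of_real (\<Delta> c) / (w - c))"
      by (simp only: KPQ)
  qed
  have "{S \<in> trunks B. Delta f g P Q B S \<noteq> 0} = ?S ` {c\<in>?Z. \<Delta> c \<noteq> 0}"
    unfolding trunks using Delta by auto
  then have "noncollinear_pts f g P Q B = (\<lambda>c. growth_point B (?S c)) ` {c\<in>?Z. \<Delta> c \<noteq> 0}"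
    unfolding noncollinear_pts_def by (simp only: image_image)
  also have "\<dots> = (\<lambda>c. c) ` {c\<in>?Z. \<Delta> c \<noteq> 0}"
    by (rule image_cong) (auto simp only: gp mem_Collect_eq)
  finally show "noncollinear_pts f g P Q B = {c\<in>(\<lambda>\<xi>. \<xi> h) ` (K \<inter> P \<union> K \<inter> Q). \<Delta> c \<noteq> 0}"
    by (simp only: KPQ image_ident)
  have fibre: "{S \<in> trunks B. growth_point B S = z} = (if z \<in> ?Z then {?S z} else {})"
  proof -
    have "{S \<in> trunks B. growth_point B S = z} = ?S ` {c\<in>?Z. growth_point B (?S c) = z}"
      unfolding trunks by auto
    also have "{c\<in>?Z. growth_point B (?S c) = z} = {c\<in>?Z. c = z}"
    proof (rule Collect_cong)
      show "c \<in> ?Z \<and> growth_point B (?S c) = z \<longleftrightarrow> c \<in> ?Z \<and> c = z" for c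
        by (cases "c \<in> ?Z") (simp_all only: gp simp_thms)
    qed
    finally show ?thesis by auto
  qed
  have sets: "?S z \<inter> P = {\<xi>\<in>K \<inter> P. \<xi> h = z}" "?S z \<inter> Q = {\<xi>\<in>K \<inter> Q. \<xi> h = z}" by auto
  have single: "(\<Sum>S\<in>{X}. G S) = G X" for G :: "arc set \<Rightarrow> int" and X
    by simp
  show "tau_at P Q B z = int (card {\<xi>\<in>K \<inter> P. \<xi> h = z} + card {\<xi>\<in>K \<inter> Q. \<xi> h = z})"
  proof (cases "z \<in> ?Z")
    case True
    then show ?thesis
      unfolding tau_at_def fibre by (simp only: if_True single sets)
  next
    case False
    then have "{\<xi>\<in>K \<inter> P. \<xi> h = z} = {}" "{\<xi>\<in>K \<inter> Q. \<xi> h = z} = {}" by auto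
    then show ?thesis
      unfolding tau_at_def fibre using False by (simp only: if_False sum.empty card.empty)
  qed
qed

end

lemma nu_eqI:
  assumes "\<forall>\<^sub>F z in generic_pt B. order_along F ((bar_base B)(bar_height B := z)) = ereal v"
  shows "nu F B = v"
proof -
  have "generic_pt B \<noteq> bot"
    by (auto simp: generic_pt_def cofinite_bot infinite_UNIV_char_0)
  then have unique: "v' = v" if "\<forall>\<^sub>F z in generic_pt B. order_along F ((bar_base B)(bar_height B := z)) = ereal v'" for v'
    using eventually_happens'[OF _ eventually_conj[OF assms that]] by auto
  show ?thesis
    unfolding nu_def
  proof (rule the_equality)
    show "\<forall>\<^sub>F z in generic_pt B. order_along F ((bar_base B)(bar_height B := z)) = ereal v"
      by (rule assms)
  qed (rule unique)
qed

text \<open>Where \<tau> + \<mu> = 0 there is no polar root, as multiplicities are positive; so the polar roots over B are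
distributed over finitely many points.\<close>

lemma polar_totals:
  assumes fin: "\<And>z. finite (polar_at f g B z)"
    and pos: "\<And>z \<gamma>. \<gamma> \<in> polar_at f g B z \<Longrightarrow> root_mult (jac f g) \<gamma> > 0"
    and count: "\<And>z. int (polar_count_at f g B z) = tau_at P Q B z + mu_at f g P Q B z"
    and tau: "finite {z. tau_at P Q B z \<noteq> 0}" and mu: "finite {z. mu_at f g P Q B z \<noteq> 0}"
  shows "finite (polar_over f g B) \<and> int (polar_count f g B) = tau P Q B + mu f g P Q B"
proof -
  define Z where "Z = {z. tau_at P Q B z \<noteq> 0} \<union> {z. mu_at f g P Q B z \<noteq> 0}"
  have Z: "finite Z" using tau mu by (simp add: Z_def)
  have "polar_at f g B z = {}" if "z \<notin> Z" for z
  proof (rule ccontr)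
    assume "polar_at f g B z \<noteq> {}"
    then have "polar_count_at f g B z > 0"
      unfolding polar_count_at_def using fin pos by (intro sum_pos) auto
    then show False
      using count[of z] that by (simp add: Z_def)
  qed
  then have over: "polar_over f g B = (\<Union>z\<in>Z. polar_at f g B z)"
    unfolding polar_over_def polar_at_def by blast
  have "polar_count f g B = (\<Sum>z\<in>Z. polar_count_at f g B z)"
    unfolding polar_count_def polar_count_at_def over
    by (rule sum.UNION_disjoint) (use Z fin in \<open>auto simp: polar_at_def climbs_def\<close>)
  then have "int (polar_count f g B) = (\<Sum>z\<in>Z. tau_at P Q B z) + (\<Sum>z\<in>Z. mu_at f g P Q B z)"
    by (simp add: count sum.distrib)
  also have "(\<Sum>z\<in>Z. tau_at P Q B z) = tau P Q B"
    unfolding tau_def using Z by (intro sum.mono_neutral_right) (auto simp: Z_def)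
  also have "(\<Sum>z\<in>Z. mu_at f g P Q B z) = mu f g P Q B"
    unfolding mu_def using Z by (intro sum.mono_neutral_right) (auto simp: Z_def)
  finally show ?thesis
    using Z fin over by simp
qed

context germ_pair
begin

text \<open>The coordinate pt and the weights \<nu>1, \<nu>2 may differ from those of the bar as long as they give the same points
and the same \<Delta>. This freedom is what makes the thin strips represent the ground bar.\<close>

lemma order_eq_tau_plus_mu:
  assumes B: "admissible_bar n0 (P \<union> Q) B" and nc: "noncollinear f g P Q B"
  defines "A \<equiv> fst B \<inter> P" and "A' \<equiv> fst B \<inter> Q"
  assumes pt: "\<And>\<xi>. \<xi> \<in> fst B \<Longrightarrow> pt \<xi> = \<xi> (snd B)"
    and \<nu>: "\<And>c. \<nu>1 * real (card {\<xi>\<in>A'. \<xi> (snd B) = c}) - \<nu>2 * real (card {\<xi>\<in>A. \<xi> (snd B) = c})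
      = nu f B * real (card {\<xi>\<in>A'. \<xi> (snd B) = c}) - nu g B * real (card {\<xi>\<in>A. \<xi> (snd B) = c})"
  defines "Wr \<equiv> smult (complex_of_real \<nu>1) (roots_poly pt A * pderiv (roots_poly pt A'))
      - smult (complex_of_real \<nu>2) (pderiv (roots_poly pt A) * roots_poly pt A')"
  shows "Wr \<noteq> 0" and "int (order z Wr) = tau_at P Q B z + mu_at f g P Q B z"
proof -
  have fin: "finite A" "finite A'"
    using finite_roots by (auto simp: A_def A'_def)
  let ?h = "snd B"
  have sets: "{\<xi>\<in>A. pt \<xi> = c} = {\<xi>\<in>A. \<xi> ?h = c}" "{\<xi>\<in>A'. pt \<xi> = c} = {\<xi>\<in>A'. \<xi> ?h = c}" for c
    using pt by (auto simp: A_def A'_def)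
  have img: "pt ` (A \<union> A') = (\<lambda>\<xi>. \<xi> ?h) ` (A \<union> A')"
    using pt by (intro image_cong refl) (auto simp: A_def A'_def)
  note formulas = bar_formulas[OF B, folded A_def A'_def]
  define N where "N = {c\<in>pt ` (A \<union> A'). \<nu>1 * real (card {\<xi>\<in>A'. pt \<xi> = c}) - \<nu>2 * real (card {\<xi>\<in>A. pt \<xi> = c}) \<noteq> 0}"
  define M where "M = (\<lambda>w. \<Sum>c\<in>pt ` (A \<union> A'). complex_of_real (\<nu>1 * real (card {\<xi>\<in>A'. pt \<xi> = c}) - \<nu>2 * real (card {\<xi>\<in>A. pt \<xi> = c})) / (w - c))"
  have N: "N = noncollinear_pts f g P Q B"
    unfolding N_def formulas(2) img sets \<nu> ..
  have M: "M = mero f g P Q B"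
    unfolding M_def formulas(1) img sets \<nu> ..
  have N0: "N \<noteq> {}"
    using nc by (simp add: N noncollinear_def)
  have Mw: "M w = (\<Sum>c\<in>pt ` (A \<union> A'). complex_of_real (\<nu>1 * real (card {\<xi>\<in>A'. pt \<xi> = c}) - \<nu>2 * real (card {\<xi>\<in>A. pt \<xi> = c})) / (w - c))" for w
    by (simp only: M_def)
  note ww = weighted_wronskian[OF fin N0[unfolded N_def], folded Wr_def M_def, folded N_def Mw]
  show "Wr \<noteq> 0" by (rule ww(1))
  show "int (order z Wr) = tau_at P Q B z + mu_at f g P Q B z"
    unfolding ww(2) formulas(3) mu_at_def mero_zeros_def N[symmetric] M[symmetric] sets by simp
qed

section \<open>Bars of positive height\<close>

lemma polar_count_positive_height:
  assumes B: "admissible_bar n0 (P \<union> Q) B" and a: "a \<ge> 1" "snd B = real a / real n0" and nc: "noncollinear f g P Q B"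
  shows "finite (polar_at f g B z)" and "\<forall>\<gamma>\<in>polar_at f g B z. root_mult (jac f g) \<gamma> > 0"
    and "int (polar_count_at f g B z) = tau_at P Q B z + mu_at f g P Q B z"
proof -
  define K h b where "K = fst B" and "h = snd B" and "b = bar_base B"
  have h0: "h > 0"
    using a n0 by (simp add: h_def)
  define \<xi>0 where "\<xi>0 = (SOME \<xi>. \<xi> \<in> K)"
  obtain \<xi>1 where "\<xi>1 \<in> K"
    using B by (auto simp: admissible_bar_def K_def)
  then have \<xi>0: "\<xi>0 \<in> K"
    unfolding \<xi>0_def by (rule someI[of "\<lambda>\<xi>. \<xi> \<in> K"])
  then have \<xi>0R: "\<xi>0 \<in> P \<union> Q"
    using B by (auto simp: admissible_bar_def K_def)
  have b: "b = (\<lambda>e. if e < h then \<xi>0 e else 0)"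
    unfolding b_def bar_base_def bar_height_def \<xi>0_def K_def h_def ..
  have follow: "(\<forall>e<h. \<xi> e = b e) \<longleftrightarrow> \<xi> \<in> K" if "\<xi> \<in> P \<union> Q" for \<xi>
    using B \<xi>0 that unfolding admissible_bar_def K_def[symmetric] h_def[symmetric] b by (metis Diff_iff)
  have strip: "arc_strip (n0 * 1) a b"
  proof
    show "has_ram (n0 * 1) b"
      using root_ram(1)[OF \<xi>0R] by (auto simp: has_ram_def b)
    show "b e = 0" if "real a / real (n0 * 1) \<le> e" for e
      using that a by (simp add: b h_def)
    show "b 0 = 0"
      using root_ram(2)[OF \<xi>0R] by (simp add: b)
  qed (rule a(1))
  have Pb: "{\<xi> \<in> P. \<forall>e<h. \<xi> e = b e} = K \<inter> P" "{\<xi> \<in> Q. \<forall>e<h. \<xi> e = b e} = K \<inter> Q"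
    using follow by auto
  have hh: "real a / real (n0 * 1) = h"
    by (simp add: h_def a)
  let ?\<phi> = "roots_poly (\<lambda>\<xi>. \<xi> h) (K \<inter> P)" and ?\<psi> = "roots_poly (\<lambda>\<xi>. \<xi> h) (K \<inter> Q)"
  obtain \<nu>1 \<nu>2 where \<nu>1: "\<forall>z. poly ?\<phi> z \<noteq> 0 \<longrightarrow> order_along f (b(h := z)) = ereal \<nu>1"
    and \<nu>2: "\<forall>z. poly ?\<psi> z \<noteq> 0 \<longrightarrow> order_along g (b(h := z)) = ereal \<nu>2"
    and count: "smult (complex_of_real \<nu>1) (?\<phi> * pderiv ?\<psi>) - smult (complex_of_real \<nu>2) (pderiv ?\<phi> * ?\<psi>) \<noteq> 0 \<longrightarrow>
        (\<forall>z. finite {\<gamma>. polar_root f g \<gamma> \<and> (\<forall>e<h. \<gamma> e = b e) \<and> \<gamma> h = z} \<and>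
          (\<forall>\<gamma>\<in>{\<gamma>. polar_root f g \<gamma> \<and> (\<forall>e<h. \<gamma> e = b e) \<and> \<gamma> h = z}. root_mult (jac f g) \<gamma> > 0) \<and>
          (\<Sum>\<gamma>\<in>{\<gamma>. polar_root f g \<gamma> \<and> (\<forall>e<h. \<gamma> e = b e) \<and> \<gamma> h = z}. root_mult (jac f g) \<gamma>) =
          order z (smult (complex_of_real \<nu>1) (?\<phi> * pderiv ?\<psi>) - smult (complex_of_real \<nu>2) (pderiv ?\<phi> * ?\<psi>)))"
    using polar_count_over_strip[OF order_refl strip] unfolding hh Pb by blast
  have polar_at: "polar_at f g B z = {\<gamma>. polar_root f g \<gamma> \<and> (\<forall>e<h. \<gamma> e = b e) \<and> \<gamma> h = z}" for z
    by (auto simp: polar_at_def climbs_def bar_height_def h_def b_def)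
  have generic: "generic_pt B = cofinite"
    using h0 by (simp add: generic_pt_def bar_height_def h_def)
  have nu_f: "nu f B = \<nu>1"
  proof (rule nu_eqI)
    have "finite {z. poly ?\<phi> z = 0}"
      by (rule poly_roots_finite) (use finite_roots in \<open>simp add: roots_poly_nz\<close>)
    then have "\<forall>\<^sub>F z in cofinite. poly ?\<phi> z \<noteq> 0"
      by (simp add: eventually_cofinite)
    then show "\<forall>\<^sub>F z in generic_pt B. order_along f ((bar_base B)(bar_height B := z)) = ereal \<nu>1"
      unfolding generic bar_height_def h_def[symmetric] b_def[symmetric] by eventually_elim (use \<nu>1 in blast)
  qed
  have nu_g: "nu g B = \<nu>2"
  proof (rule nu_eqI)
    have "finite {z. poly ?\<psi> z = 0}"
      by (rule poly_roots_finite) (use finite_roots in \<open>simp add: roots_poly_nz\<close>)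
    then have "\<forall>\<^sub>F z in cofinite. poly ?\<psi> z \<noteq> 0"
      by (simp add: eventually_cofinite)
    then show "\<forall>\<^sub>F z in generic_pt B. order_along g ((bar_base B)(bar_height B := z)) = ereal \<nu>2"
      unfolding generic bar_height_def h_def[symmetric] b_def[symmetric] by eventually_elim (use \<nu>2 in blast)
  qed
  have pt: "\<xi> h = \<xi> (snd B)" if "\<xi> \<in> fst B" for \<xi> :: arc
    by (simp add: h_def)
  have \<nu>: "\<nu>1 * x - \<nu>2 * y = nu f B * x - nu g B * y" for x y
    by (simp add: nu_f nu_g)
  note main = order_eq_tau_plus_mu[OF B nc, where pt = "\<lambda>\<xi>. \<xi> h", OF pt \<nu>, folded K_def]
  show "finite (polar_at f g B z)" "\<forall>\<gamma>\<in>polar_at f g B z. root_mult (jac f g) \<gamma> > 0"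
    unfolding polar_at using count main(1) by blast+
  show "int (polar_count_at f g B z) = tau_at P Q B z + mu_at f g P Q B z"
    unfolding polar_count_at_def polar_at using count main(1) main(2)[where z = z] by simp
qed

end

section \<open>The ground bar\<close>

lemma holo_germ_bound:
  assumes "holo_germ F"
  obtains r C where "r > 0" "\<And>i j. norm (fps_nth (fps_nth F i) j) * r ^ (i + j) \<le> C"
proof -
  obtain r where r: "r > 0" and s: "(\<lambda>(i, j). norm (fps_nth (fps_nth F i) j) * r ^ (i + j)) summable_on UNIV"
    using assms by (auto simp: holo_germ_def)
  have "norm (fps_nth (fps_nth F i) j) * r ^ (i + j) \<le> infsum (\<lambda>(i, j). norm (fps_nth (fps_nth F i) j) * r ^ (i + j)) UNIV" for i j
    using finite_sum_le_infsum[OF s, of "{(i, j)}"] r by (auto split: prod.splits)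
  with r show ?thesis by (rule that)
qed

definition y_coeff :: "complex fps fps \<Rightarrow> nat \<Rightarrow> complex fps" where
  "y_coeff F k = Abs_fps (\<lambda>i. fps_nth (fps_nth F i) k)"

text \<open>On the ground bar F(z, y) is formed with a nonzero constant z, so its coefficients are infinite sums
and have to converge.\<close>

lemma y_coeff_conv_radius:
  assumes "holo_germ F"
  shows "fps_conv_radius (y_coeff F k) > 0"
proof -
  obtain r C where r: "r > 0" and C: "\<And>i j. norm (fps_nth (fps_nth F i) j) * r ^ (i + j) \<le> C"
    using holo_germ_bound[OF assms] by blast
  have "norm (fps_nth (y_coeff F k) i) * r ^ i \<le> C / r ^ k" for i
    using C[of i k] r by (simp add: y_coeff_def power_add field_simps)
  then have "summable (\<lambda>i. norm (fps_nth (y_coeff F k) i) * (r / 2) ^ i)"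
    using r by (intro Abel_lemma[of "r / 2" r]) auto
  then have "summable (\<lambda>i. norm (fps_nth (y_coeff F k) i * complex_of_real (r / 2) ^ i))"
    using r by (simp add: norm_mult norm_power power_divide norm_divide)
  then have "summable (\<lambda>i. fps_nth (y_coeff F k) i * complex_of_real (r / 2) ^ i)"
    by (rule summable_norm_cancel)
  then have "fps_conv_radius (y_coeff F k) \<ge> norm (complex_of_real (r / 2))"
    unfolding fps_conv_radius_def by (rule conv_radius_geI)
  moreover have "norm (complex_of_real (r / 2)) > 0"
    using r by simp
  ultimately show ?thesis
    by (meson ereal_less(2) less_le_trans)
qed

lemma eventually_eval_fps_neq_0:
  fixes c :: "complex fps"
  assumes c: "c \<noteq> 0" and r: "fps_conv_radius c > 0"
  shows "\<forall>\<^sub>F z in at 0. eval_fps c z \<noteq> 0"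
proof -
  define s where "s = subdegree c"
  let ?c = "fps_shift s c"
  have "isCont (eval_fps ?c) 0"
    by (rule continuous_eval_fps) (metis norm_zero zero_ereal_def fps_conv_radius_shift r)
  then have "eval_fps ?c \<midarrow>0\<rightarrow> fps_nth c s"
    using eval_fps_at_0[of ?c] by (simp add: isCont_def)
  moreover have "fps_nth c s \<noteq> 0"
    using c by (simp add: s_def)
  ultimately have "\<forall>\<^sub>F z in at 0. eval_fps ?c z \<noteq> 0"
    by (rule tendsto_imp_eventually_ne)
  moreover have "\<forall>\<^sub>F z in at 0. z \<in> eball 0 (fps_conv_radius c)"
    using r by (intro eventually_at_in_open') (simp_all add: zero_ereal_def[symmetric])
  moreover have "\<forall>\<^sub>F z in at (0::complex). z \<noteq> 0"
    by (rule eventually_neq_at_within)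
  ultimately show ?thesis
  proof eventually_elim
    case (elim z)
    then show ?case
      using eval_fps_shift[of s c z] by (auto simp: s_def split: if_splits)
  qed
qed

lemma rhom_nth_0: "rhom (\<lambda>c. fps_nth c 0)"
  by (simp add: rhom_def)

text \<open>Setting t = 0 in F / y^E leaves u(x, 0) times a power of x, because all roots vanish at t = 0.\<close>

lemma y_coeff_factors:
  assumes F: "factors_over F u E S n" and u: "germ_at_O u \<noteq> 0"
  shows "k < E \<Longrightarrow> y_coeff F k = 0" and "y_coeff F E \<noteq> 0"
proof -
  have n: "n \<ge> 1" and S: "finite S" "\<forall>\<xi>\<in>S. \<xi> 0 = 0" using F by (auto simp: factors_over_def)
  define Y where "Y = germ_ram n u * (\<Prod>\<xi>\<in>S. fps_X - fps_const (arc_ram n \<xi>))"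
  have FY: "germ_ram n F = fps_const (fps_X ^ (n * E)) * Y"
    using F by (simp add: factors_over_def Y_def mult_ac)
  have compose: "fps_compose (fps_nth F i) (fps_X ^ n) = fps_X ^ (n * E) * fps_nth Y i" for i
    using arg_cong[OF FY, of "\<lambda>G. fps_nth G i"] by (simp add: germ_ram_def)
  have nth: "fps_nth (fps_nth F i) k = (if k < E then 0 else fps_nth (fps_nth Y i) (n * k - n * E))" for i k
  proof -
    have "fps_nth (fps_compose (fps_nth F i) (fps_X ^ n)) (n * k) = fps_nth (fps_nth F i) k"
      using n by (simp add: fps_compose_X_power_nth)
    then show ?thesis
      using n unfolding compose by (simp add: fps_X_power_mult_nth)
  qed
  show "y_coeff F k = 0" if "k < E"
    using that by (simp add: y_coeff_def nth fps_eq_iff)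
  let ?e = "fps_map (\<lambda>c. fps_nth c 0)"
  have e: "rhom ?e" by (rule rhom_fps_map[OF rhom_nth_0])
  have "y_coeff F E = ?e Y"
    by (simp add: y_coeff_def nth fps_eq_iff)
  also have "\<dots> = ?e (germ_ram n u) * (\<Prod>\<xi>\<in>S. fps_X)"
    unfolding Y_def rhom.mult[OF e] rhom.prod[OF e] rhom.diff[OF e] fps_map_X[OF rhom_nth_0] fps_map_const[OF rhom_nth_0]
    by (intro arg_cong2[of _ _ _ _ "(*)"] prod.cong refl) (use S in \<open>simp add: arc_ram_nth_0\<close>)
  also have "\<dots> \<noteq> 0"
  proof -
    have "fps_nth (?e (germ_ram n u)) 0 \<noteq> 0"
      using u by (simp add: germ_ram_eq germ_at_O_def)
    then have "?e (germ_ram n u) \<noteq> 0" by (metis fps_zero_nth)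
    then show ?thesis by simp
  qed
  finally show "y_coeff F E \<noteq> 0" .
qed

lemma order_along_ground:
  assumes holo: "holo_germ F" and F: "factors_over F u E S n" and u: "germ_at_O u \<noteq> 0"
  shows "\<forall>\<^sub>F z in at 0. order_along F ((\<lambda>e. 0)(0 := z)) = ereal (real E)"
  using eventually_eval_fps_neq_0[OF y_coeff_factors(2)[OF F u] y_coeff_conv_radius[OF holo]]
proof eventually_elim
  case (elim z)
  let ?\<xi> = "(\<lambda>e. 0)(0 := z) :: arc"
  have "has_ram 1 ?\<xi>"
    by (auto simp: has_ram_def intro: exI[of _ 0])
  then have ram: "ram ?\<xi> = 1"
    unfolding ram_def by (rule Least_equality) (simp add: has_ram_def)
  have "arc_ram 1 ?\<xi> = fps_const z"
    by (simp add: arc_ram_def fps_eq_iff)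
  then have nth: "fps_nth (subst_arc F ?\<xi>) k = eval_fps (y_coeff F k) z" for k
    unfolding subst_arc_def ram by (simp add: germ_ram_eq eval_fps_def y_coeff_def fps_const_power)
  have nz: "fps_nth (subst_arc F ?\<xi>) E \<noteq> 0"
    using elim by (simp add: nth)
  moreover have "fps_nth (subst_arc F ?\<xi>) k = 0" if "k < E" for k
    using y_coeff_factors(1)[OF F u that] by (simp add: nth)
  ultimately have "subdegree (subst_arc F ?\<xi>) = E"
    by (intro subdegreeI)
  moreover have "subst_arc F ?\<xi> \<noteq> 0"
    using nz by auto
  ultimately show ?case
    by (simp only: order_along_def ram if_False) simp
qed

lemma arc_small_exponent:
  assumes "has_ram n \<xi>" "\<xi> 0 = 0" "e < 1 / real n"
  shows "\<xi> e = 0"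
  using assms(1)
proof (rule has_ram_cases)
  fix j :: nat assume e: "e = real j / real n"
  then have "real j < 1"
    using assms(3) has_ram_ge_1[OF assms(1)] by (simp add: divide_less_cancel)
  then have "j = 0" by simp
  then show "\<xi> e = 0" using e assms(2) by simp
qed

context germ_pair
begin

text \<open>The condition k \<ge> 2 puts the height 1/(n0 k) below all exponents 1/n0, 2/n0, ... of the roots of f and g, so that
all these roots pass through w = 0.\<close>

lemma polar_count_near_ground:
  assumes B: "admissible_bar n0 (P \<union> Q) B" "B = (P \<union> Q, 0)" and nc: "noncollinear f g P Q B"
    and nu: "nu f B = real E1" "nu g B = real E2" and k: "k \<ge> 2"
  defines "\<epsilon> \<equiv> 1 / real (n0 * k)"
  defines "S \<equiv> {\<gamma>. polar_root f g \<gamma> \<and> (\<forall>e<\<epsilon>. \<gamma> e = 0) \<and> \<gamma> \<epsilon> = 0}"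
  shows "finite S" and "\<forall>\<gamma>\<in>S. root_mult (jac f g) \<gamma> > 0"
    and "int (\<Sum>\<gamma>\<in>S. root_mult (jac f g) \<gamma>) = tau_at P Q B 0 + mu_at f g P Q B 0"
proof -
  have \<epsilon>: "\<epsilon> > 0" "\<epsilon> < 1 / real n0"
    using n0 k by (auto simp: \<epsilon>_def field_simps)
  have small: "\<xi> e = 0" if "\<xi> \<in> P \<union> Q" "e \<le> \<epsilon>" for \<xi> e
    by (rule arc_small_exponent[OF root_ram[OF that(1)]]) (use that \<epsilon> in linarith)
  have strip: "arc_strip (n0 * k) 1 (\<lambda>_. 0)"
    by unfold_locales (use n0 k in \<open>auto simp: has_ram_def\<close>)
  have eps: "real 1 / real (n0 * k) = \<epsilon>"
    by (simp add: \<epsilon>_def)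
  have sets: "{\<xi> \<in> P. \<forall>e<\<epsilon>. \<xi> e = 0} = P" "{\<xi> \<in> Q. \<forall>e<\<epsilon>. \<xi> e = 0} = Q"
    using small by auto
  have k1: "k \<ge> 1" using k by simp
  let ?\<phi> = "roots_poly (\<lambda>\<xi>. \<xi> \<epsilon>) P" and ?\<psi> = "roots_poly (\<lambda>\<xi>. \<xi> \<epsilon>) Q"
  obtain \<nu>1 \<nu>2 where \<nu>: "\<nu>1 = real E1 + \<epsilon> * real (card P)" "\<nu>2 = real E2 + \<epsilon> * real (card Q)"
    and count: "smult (complex_of_real \<nu>1) (?\<phi> * pderiv ?\<psi>) - smult (complex_of_real \<nu>2) (pderiv ?\<phi> * ?\<psi>) \<noteq> 0 \<longrightarrow>
        (\<forall>z. finite {\<gamma>. polar_root f g \<gamma> \<and> (\<forall>e<\<epsilon>. \<gamma> e = 0) \<and> \<gamma> \<epsilon> = z} \<and>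
          (\<forall>\<gamma>\<in>{\<gamma>. polar_root f g \<gamma> \<and> (\<forall>e<\<epsilon>. \<gamma> e = 0) \<and> \<gamma> \<epsilon> = z}. root_mult (jac f g) \<gamma> > 0) \<and>
          (\<Sum>\<gamma>\<in>{\<gamma>. polar_root f g \<gamma> \<and> (\<forall>e<\<epsilon>. \<gamma> e = 0) \<and> \<gamma> \<epsilon> = z}. root_mult (jac f g) \<gamma>) =
          order z (smult (complex_of_real \<nu>1) (?\<phi> * pderiv ?\<psi>) - smult (complex_of_real \<nu>2) (pderiv ?\<phi> * ?\<psi>)))"
    using polar_count_over_strip[OF k1 strip] unfolding eps sets by blast
  have KP: "fst B \<inter> P = P" "fst B \<inter> Q = Q" "snd B = 0"
    using B(2) by auto
  have pt: "\<xi> \<epsilon> = \<xi> (snd B)" if "\<xi> \<in> fst B" for \<xi>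
    using small[of \<xi> \<epsilon>] root_ram(2)[of \<xi>] that B(2) by simp
  have weights: "\<nu>1 * real (card {\<xi> \<in> fst B \<inter> Q. \<xi> (snd B) = c}) - \<nu>2 * real (card {\<xi> \<in> fst B \<inter> P. \<xi> (snd B) = c})
      = nu f B * real (card {\<xi> \<in> fst B \<inter> Q. \<xi> (snd B) = c}) - nu g B * real (card {\<xi> \<in> fst B \<inter> P. \<xi> (snd B) = c})" for c
  proof -
    have "{\<xi> \<in> P. \<xi> 0 = c} = (if c = 0 then P else {})" "{\<xi> \<in> Q. \<xi> 0 = c} = (if c = 0 then Q else {})"
      using root_ram(2) by auto
    then show ?thesis
      unfolding KP nu \<nu> by (simp add: algebra_simps)
  qed
  note main = order_eq_tau_plus_mu[OF B(1) nc, where pt = "\<lambda>\<xi>. \<xi> \<epsilon>", OF pt weights, unfolded KP]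
  show "finite S" "\<forall>\<gamma>\<in>S. root_mult (jac f g) \<gamma> > 0"
    unfolding S_def using count main(1) by blast+
  show "int (\<Sum>\<gamma>\<in>S. root_mult (jac f g) \<gamma>) = tau_at P Q B 0 + mu_at f g P Q B 0"
    unfolding S_def using count main(1) main(2)[where z = 0] by simp
qed

text \<open>The sets S k of polar roots in the strips of height 1/(n0 k) increase with k and have the same total multiplicity,
so they coincide; every polar root lies in one of them.\<close>

lemma polar_count_ground:
  assumes B: "admissible_bar n0 (P \<union> Q) B" "B = (P \<union> Q, 0)" and nc: "noncollinear f g P Q B"
  shows "finite (polar_at f g B z)" and "\<forall>\<gamma>\<in>polar_at f g B z. root_mult (jac f g) \<gamma> > 0"
    and "int (polar_count_at f g B z) = tau_at P Q B z + mu_at f g P Q B z"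
proof -
  obtain \<xi>1 where "\<xi>1 \<in> P \<union> Q"
    using B by (auto simp: admissible_bar_def)
  then have "(SOME \<xi>. \<xi> \<in> P \<union> Q) \<in> P \<union> Q"
    by (rule someI[of "\<lambda>\<xi>. \<xi> \<in> P \<union> Q"])
  then have some: "(SOME \<xi>. \<xi> \<in> P \<union> Q) e = 0" if "e < 0" for e
    by (intro arc_small_exponent[OF root_ram]) (use that in \<open>auto intro: less_le_trans\<close>)
  have base: "bar_base B = (\<lambda>e. 0)"
    unfolding bar_base_def bar_height_def B(2) using some by (intro ext) simp
  have height: "bar_height B = 0" by (simp add: bar_height_def B(2))
  have generic: "generic_pt B = at 0" by (simp add: generic_pt_def height)
  have nu_f: "nu f B = real E1"
    by (rule nu_eqI) (unfold generic base height, rule order_along_ground[OF hf f u])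
  have nu_g: "nu g B = real E2"
    by (rule nu_eqI) (unfold generic base height, rule order_along_ground[OF hg g u'])
  define S where "S k = {\<gamma>. polar_root f g \<gamma> \<and> (\<forall>e<1 / real (n0 * k). \<gamma> e = 0) \<and> \<gamma> (1 / real (n0 * k)) = 0}" for k
  note count = polar_count_near_ground[OF B nc nu_f nu_g, folded S_def]
  have polar_S: "\<exists>k\<ge>2. \<gamma> \<in> S k" if \<gamma>: "polar_root f g \<gamma>" for \<gamma>
  proof -
    obtain m where m: "has_ram m \<gamma>" and \<gamma>0: "\<gamma> 0 = 0"
      using \<gamma> by (auto simp: polar_root_iff frac_series_def)
    have "1 / real (n0 * (m + 2)) < 1 / real m"
    proof -
      have "real m < real (n0 * (m + 2))"
        using n0 by (simp only: of_nat_less_iff) (metis less_add_same_cancel1 less_le_trans mult_1 mult_le_mono1 pos2)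
      then show ?thesis
        using has_ram_ge_1[OF m] by (intro divide_strict_left_mono) auto
    qed
    then have "\<gamma> e = 0" if "e \<le> 1 / real (n0 * (m + 2))" for e
      using arc_small_exponent[OF m \<gamma>0] that by simp
    then show ?thesis
      using \<gamma> by (intro exI[of _ "m + 2"]) (simp add: S_def)
  qed
  have S_mono: "S 2 \<subseteq> S k" if "k \<ge> 2" for k
  proof
    fix \<gamma> assume \<gamma>: "\<gamma> \<in> S 2"
    have "1 / real (n0 * k) \<le> 1 / real (n0 * 2)"
      using n0 that by (intro divide_left_mono) auto
    then have "\<gamma> e = 0" if "e \<le> 1 / real (n0 * k)" for e
    proof (cases "e < 1 / real (n0 * 2)")
      case False
      then have "e = 1 / real (n0 * 2)"
        using that \<open>1 / real (n0 * k) \<le> 1 / real (n0 * 2)\<close> by linarith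
      then show ?thesis using \<gamma> by (simp add: S_def)
    qed (use \<gamma> in \<open>simp add: S_def\<close>)
    then show "\<gamma> \<in> S k"
      using \<gamma> by (simp add: S_def)
  qed
  have S_eq: "S k = S 2" if k: "k \<ge> 2" for k
  proof (rule ccontr)
    assume "S k \<noteq> S 2"
    then have ne: "S k - S 2 \<noteq> {}" using S_mono[OF k] by auto
    have "(\<Sum>\<gamma>\<in>S k. root_mult (jac f g) \<gamma>) = (\<Sum>\<gamma>\<in>S 2. root_mult (jac f g) \<gamma>) + (\<Sum>\<gamma>\<in>S k - S 2. root_mult (jac f g) \<gamma>)"
      using sum.subset_diff[OF S_mono[OF k] count(1)[OF k]] by (simp add: add.commute)
    moreover have "(\<Sum>\<gamma>\<in>S k - S 2. root_mult (jac f g) \<gamma>) > 0"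
      using ne count(1,2)[OF k] by (intro sum_pos) auto
    moreover have "int (\<Sum>\<gamma>\<in>S k. root_mult (jac f g) \<gamma>) = int (\<Sum>\<gamma>\<in>S 2. root_mult (jac f g) \<gamma>)"
      by (simp only: count(3)[OF k] count(3)[OF order_refl])
    ultimately show False
      by (simp only: of_nat_eq_iff)
  qed
  have polar_0: "polar_at f g B 0 = S 2"
  proof (intro equalityI subsetI)
    show "\<gamma> \<in> S 2" if "\<gamma> \<in> polar_at f g B 0" for \<gamma>
      using that polar_S S_eq unfolding polar_at_def by blast
    show "\<gamma> \<in> polar_at f g B 0" if "\<gamma> \<in> S 2" for \<gamma>
    proof -
      have "\<gamma> e = 0" if "e \<le> 0" for e
      proof -
        have "e < 1 / real (n0 * 2)"
          using that n0 by (intro le_less_trans[OF that]) simp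
        then show ?thesis using \<open>\<gamma> \<in> S 2\<close> by (simp add: S_def)
      qed
      then show ?thesis
        using \<open>\<gamma> \<in> S 2\<close> by (simp add: polar_at_def climbs_def height base S_def)
    qed
  qed
  have polar_n0: "polar_at f g B z = {}" if "z \<noteq> 0" for z
    using that by (auto simp: polar_at_def climbs_def height polar_root_iff)
  have zero_n0: "tau_at P Q B z + mu_at f g P Q B z = 0" if z: "z \<noteq> 0" for z
  proof -
    note formulas = bar_formulas[OF B(1)]
    have img: "(\<lambda>\<xi>. \<xi> (snd B)) ` (fst B \<inter> P \<union> fst B \<inter> Q) = {0}"
      using \<open>\<xi>1 \<in> P \<union> Q\<close> root_ram(2) unfolding B(2) by force
    have no: "{\<xi> \<in> fst B \<inter> P. \<xi> (snd B) = z} = {}" "{\<xi> \<in> fst B \<inter> Q. \<xi> (snd B) = z} = {}"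
      using z root_ram(2) unfolding B(2) by auto
    have tau0: "tau_at P Q B z = 0"
      unfolding formulas(3) no by simp
    have N: "noncollinear_pts f g P Q B \<noteq> {}"
      using nc by (simp add: noncollinear_def)
    then have "mero f g P Q B z \<noteq> 0" "z \<notin> noncollinear_pts f g P Q B"
      using z unfolding formulas(1,2) img by (auto simp del: of_real_diff of_real_mult)
    then show ?thesis
      by (simp add: mu_at_def mero_zeros_def tau0)
  qed
  show "finite (polar_at f g B z)" "\<forall>\<gamma>\<in>polar_at f g B z. root_mult (jac f g) \<gamma> > 0"
    using count(1,2)[of 2] polar_0 polar_n0 by (cases "z = 0"; simp)+
  show "int (polar_count_at f g B z) = tau_at P Q B z + mu_at f g P Q B z"
    using count(3)[of 2] polar_0 polar_n0 zero_n0 by (cases "z = 0") (simp_all add: polar_count_at_def)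
qed

section \<open>The polar root count\<close>

lemma finite_supports:
  assumes B: "admissible_bar n0 (P \<union> Q) B" and nc: "noncollinear f g P Q B"
  shows "finite {z. tau_at P Q B z \<noteq> 0}" and "finite {z. mu_at f g P Q B z \<noteq> 0}"
proof -
  have "{z. tau_at P Q B z \<noteq> 0} \<subseteq> (\<lambda>\<xi>. \<xi> (snd B)) ` (P \<union> Q)"
  proof
    fix z assume "z \<in> {z. tau_at P Q B z \<noteq> 0}"
    then have "{\<xi> \<in> fst B \<inter> P. \<xi> (snd B) = z} \<noteq> {} \<or> {\<xi> \<in> fst B \<inter> Q. \<xi> (snd B) = z} \<noteq> {}"
      unfolding mem_Collect_eq bar_formulas(3)[OF B] by (metis add_is_0 card.empty of_nat_0)
    then show "z \<in> (\<lambda>\<xi>. \<xi> (snd B)) ` (P \<union> Q)" by auto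
  qed
  then show tau: "finite {z. tau_at P Q B z \<noteq> 0}"
    by (rule finite_subset) (use finite_roots in simp)
  obtain Wr where main: "Wr \<noteq> 0" "\<And>z. int (order z Wr) = tau_at P Q B z + mu_at f g P Q B z"
    using order_eq_tau_plus_mu[OF B nc, where pt = "\<lambda>\<xi>. \<xi> (snd B)", OF refl refl] by blast
  have "{z. mu_at f g P Q B z \<noteq> 0} \<subseteq> {z. tau_at P Q B z \<noteq> 0} \<union> {z. tau_at P Q B z + mu_at f g P Q B z \<noteq> 0}"
    by auto
  moreover have "finite {z. tau_at P Q B z + mu_at f g P Q B z \<noteq> 0}"
    unfolding main(2)[symmetric] using poly_roots_finite[OF main(1)] order_root[of Wr] main(1)
    by (elim rev_finite_subset) auto
  ultimately show "finite {z. mu_at f g P Q B z \<noteq> 0}"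
    using tau by (meson finite_UnI finite_subset)
qed

end

theorem theoremT:
  fixes f g u u' :: "complex fps fps"
    and E1 E2 p q :: nat
    and \<alpha> \<beta> :: "nat \<Rightarrow> arc"
    and P Q :: "arc set"
    and B :: bar
  assumes "holo_germ f" and "germ_at_O f = 0"
    and "holo_germ g" and "germ_at_O g = 0"
    and "holo_germ u" and "germ_at_O u \<noteq> 0"
    and "holo_germ u'" and "germ_at_O u' \<noteq> 0"
    and "np_factorisation f u E1 p \<alpha>"
    and "np_factorisation g u' E2 q \<beta>"
    and "p + q \<ge> 1"
    and "inj_on \<alpha> {1..p}" and "inj_on \<beta> {1..q}"
    and "\<forall>i\<in>{1..p}. \<forall>j\<in>{1..q}. \<alpha> i \<noteq> \<beta> j"
    and "P = \<alpha> ` {1..p}" and "Q = \<beta> ` {1..q}"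
    and "B \<in> bars (P \<union> Q)"
    and "noncollinear f g P Q B"
  shows "finite (polar_over f g B)
     \<and> (\<forall>z. int (polar_count_at f g B z) = tau_at P Q B z + mu_at f g P Q B z)
     \<and> int (polar_count f g B) = tau P Q B + mu f g P Q B"
proof -
  obtain n1 where n1: "factors_over f u E1 P n1"
    using np_factorisation_factors_over[OF assms(9,12)] assms(15) by blast
  obtain n2 where n2: "factors_over g u' E2 Q n2"
    using np_factorisation_factors_over[OF assms(10,13)] assms(16) by blast
  have ge: "n1 \<ge> 1" "n2 \<ge> 1"
    using n1 n2 by (auto simp: factors_over_def)
  interpret germ_pair f g u u' E1 E2 "n1 * n2" P Q
  proof
    show "factors_over f u E1 P (n1 * n2)"
      by (rule factors_over_mult[OF n1 ge(2)])
    show "factors_over g u' E2 Q (n1 * n2)"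
      using factors_over_mult[OF n2 ge(1)] by (simp add: mult.commute)
    show "P \<inter> Q = {}"
      using assms(14) unfolding assms(15,16) by auto
  qed (fact assms)+
  have R: "finite (P \<union> Q)" "P \<union> Q \<noteq> {}" "\<forall>\<xi>\<in>P \<union> Q. has_ram (n1 * n2) \<xi>"
    using finite_roots root_ram assms(11) unfolding assms(15,16) by auto
  have ok: "admissible_bar (n1 * n2) (P \<union> Q) B"
    by (rule bars_admissible[OF R assms(17)])
  have local_count: "finite (polar_at f g B z) \<and> (\<forall>\<gamma>\<in>polar_at f g B z. root_mult (jac f g) \<gamma> > 0)
      \<and> int (polar_count_at f g B z) = tau_at P Q B z + mu_at f g P Q B z" for z
  proof (cases "B = (P \<union> Q, 0)")
    case True
    then show ?thesis
      using polar_count_ground[OF ok _ assms(18)] by blast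
  next
    case False
    then obtain a where "a \<ge> 1" "snd B = real a / real (n1 * n2)"
      using ok by (auto simp: admissible_bar_def)
    then show ?thesis
      using polar_count_positive_height[OF ok _ _ assms(18)] by blast
  qed
  then have "finite (polar_over f g B) \<and> int (polar_count f g B) = tau P Q B + mu f g P Q B"
    using finite_supports[OF ok assms(18)] by (intro polar_totals) auto
  with local_count show ?thesis by blast
qed

end
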